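(* Let $n\in\{2,3\}$, $\lambda_0,\Gamma_0\in\mathbb R$, $\Gamma_2>0$, $V\in\mathbb R^n$, $M\in\mathbb R^{n\times n}$ symmetric, and $T\in(0,\infty)$. For every $f\in L^1((0,T),\mathrm{FM}_{0,\sigma}(\mathbb R^n))$ and $u_0\in\mathrm{FM}_{0,\sigma}(\mathbb R^n)$ there exists a unique solution $(u,q)$ of the linear system $$u_t+\lambda_0(V\cdot\nabla)u+Mu-\Gamma_0\Delta u+\Gamma_2\Delta^2u+\nabla q=f,\quad\operatorname{div}u=0\ \text{in }(0,T)\times\mathbb R^n,\qquad u(0)=u_0,$$ and it satisfies $$\|u\|_{W^{1,1}((0,T),\mathrm{FM})}+\|u\|_{L^1((0,T),\mathrm{FM}^4)}+\|\nabla q\|_{L^1((0,T),\mathrm{FM})}\le C(T)\big(\|f\|_{L^1((0,T),\mathrm{FM})}+\|u_0\|_{\mathrm{FM}}\big)$$ with $C(T)>0$ independent of $u,q,f,u_0$.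
   Context: $\mathrm M(\mathbb R^n)$: Banach space of finite vector valued Radon measures on $\mathbb R^n$ with total variation norm; $\mathrm M_0=\{\mu\in\mathrm M:\mu(\{0\})=0\}$. For bounded continuous $\psi$, $\mu\lfloor\psi$ is the measure with density $\psi$ w.r.t. $\mu$. $\mathrm{FM}(\mathbb R^n)=\{\hat\mu:\mu\in\mathrm M\}$ with $\|u\|_{\mathrm{FM}}=\|\mathcal F^{-1}u\|_{\mathrm M}$, $\mathrm{FM}_0=\{\hat\mu:\mu\in\mathrm M_0\}$; $\mathrm{FM}^k=\{u\in\mathrm{FM}:\partial^\kappa u\in\mathrm{FM},|\kappa|\le k\}$ normed by $\sum_{|\kappa|\le k}\|\partial^\kappa u\|_{\mathrm{FM}}$. $\mathrm{FM}_{0,\sigma}(\mathbb R^n)=\{u\in\mathrm{FM}_0(\mathbb R^n,\mathbb C^n):\operatorname{div}u=0\}$, the range of the Helmholtz projection $Pu=\mathcal F^{-1}(\hat u\lfloor(I-\xi\xi^T/|\xi|^2))$. $W^{1,1}((0,T),X)$ is the Bochner–Sobolev space. *)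

theory Defs
  imports "HOL-Analysis.Analysis"
begin

text \<open>A finite C^m-valued Radon measure mu on R^n is represented as mu = h nu with nu a
finite (positive) Borel measure and h in L^1(nu; C^m) (polar decomposition); the total
variation norm of mu is then the integral of the norm of h w.r.t. nu, independently of the
representation. Convention: the Fourier transform is x maps to the integral of
exp(-i x.xi) d mu(xi).\<close>

definition cscale :: "complex \<Rightarrow> complex^'m \<Rightarrow> complex^'m" where
  "cscale c v = (\<chi> j. c * v $ j)"

definition fourier_meas :: "(real^'n) measure \<Rightarrow> (real^'n \<Rightarrow> complex^'m) \<Rightarrow> real^'n \<Rightarrow> complex^'m" where
  "fourier_meas \<nu> h x = (\<chi> j. integral\<^sup>L \<nu> (\<lambda>\<xi>. exp (- \<i> * complex_of_real (x \<bullet> \<xi>)) * (h \<xi> $ j)))"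

definition fm_rep :: "(real^'n) measure \<Rightarrow> (real^'n \<Rightarrow> complex^'m) \<Rightarrow> (real^'n \<Rightarrow> complex^'m) \<Rightarrow> bool" where
  "fm_rep \<nu> h u \<longleftrightarrow> sets \<nu> = sets borel \<and> finite_measure \<nu> \<and> integrable \<nu> h \<and> u = fourier_meas \<nu> h"

definition in_FM :: "(real^'n \<Rightarrow> complex^'m) \<Rightarrow> bool" where
  "in_FM u \<longleftrightarrow> (\<exists>\<nu> h. fm_rep \<nu> h u)"

text \<open>norm of FM: total variation of the inverse Fourier transform (all representations
give the same value, so the infimum is that value)\<close>
definition fm_norm :: "(real^'n \<Rightarrow> complex^'m) \<Rightarrow> real" where
  "fm_norm u = Inf {integral\<^sup>L \<nu> (\<lambda>\<xi>. norm (h \<xi>)) | \<nu> h. fm_rep \<nu> h u}"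

text \<open>FM_{0,sigma}: mu({0}) = 0 and div u = 0, i.e. the measure xi . mu vanishes\<close>
definition in_FM0s :: "(real^'n \<Rightarrow> complex^'n) \<Rightarrow> bool" where
  "in_FM0s u \<longleftrightarrow> (\<exists>\<nu> h. fm_rep \<nu> h u \<and> set_lebesgue_integral \<nu> {0} h = 0 \<and>
      (AE \<xi> in \<nu>. (\<Sum>j\<in>UNIV. complex_of_real (\<xi> $ j) * (h \<xi> $ j)) = 0))"

text \<open>Fourier multiplier: F(m mu), defined when m mu is again a finite measure
(independent of the chosen representation by injectivity of the Fourier transform).\<close>
definition has_fm_mult :: "(real^'n \<Rightarrow> complex) \<Rightarrow> (real^'n \<Rightarrow> complex^'m) \<Rightarrow> bool" where
  "has_fm_mult m u \<longleftrightarrow> (\<exists>\<nu> h. fm_rep \<nu> h u \<and> integrable \<nu> (\<lambda>\<xi>. cscale (m \<xi>) (h \<xi>)))"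

definition fm_mult :: "(real^'n \<Rightarrow> complex) \<Rightarrow> (real^'n \<Rightarrow> complex^'m) \<Rightarrow> real^'n \<Rightarrow> complex^'m" where
  "fm_mult m u = (let p = (SOME p. fm_rep (fst p) (snd p) u \<and>
                      integrable (fst p) (\<lambda>\<xi>. cscale (m \<xi>) (snd p \<xi>)))
                  in fourier_meas (fst p) (\<lambda>\<xi>. cscale (m \<xi>) (snd p \<xi>)))"

definition mi_abs :: "('n::finite \<Rightarrow> nat) \<Rightarrow> nat" where
  "mi_abs \<kappa> = (\<Sum>i\<in>UNIV. \<kappa> i)"

definition mi_symbol :: "('n::finite \<Rightarrow> nat) \<Rightarrow> real^'n \<Rightarrow> complex" where
  "mi_symbol \<kappa> \<xi> = (\<Prod>i\<in>UNIV. (- \<i> * complex_of_real (\<xi> $ i)) ^ \<kappa> i)"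

definition fm_deriv :: "('n::finite \<Rightarrow> nat) \<Rightarrow> (real^'n \<Rightarrow> complex^'m) \<Rightarrow> real^'n \<Rightarrow> complex^'m" where
  "fm_deriv \<kappa> u = fm_mult (mi_symbol \<kappa>) u"

definition in_FMk :: "nat \<Rightarrow> (real^'n::finite \<Rightarrow> complex^'m) \<Rightarrow> bool" where
  "in_FMk k u \<longleftrightarrow> in_FM u \<and> (\<forall>\<kappa>::'n \<Rightarrow> nat. mi_abs \<kappa> \<le> k \<longrightarrow> has_fm_mult (mi_symbol \<kappa>) u)"

definition fmk_norm :: "nat \<Rightarrow> (real^'n::finite \<Rightarrow> complex^'m) \<Rightarrow> real" where
  "fmk_norm k u = (\<Sum>\<kappa>\<in>{\<kappa>::'n \<Rightarrow> nat. mi_abs \<kappa> \<le> k}. fm_norm (fm_deriv \<kappa> u))"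

definition unit_mi :: "nat \<Rightarrow> 'n \<Rightarrow> 'n \<Rightarrow> nat" where
  "unit_mi a j = (\<lambda>i. if i = j then a else 0)"

definition fm_vgrad :: "real^'n::finite \<Rightarrow> (real^'n \<Rightarrow> complex^'m) \<Rightarrow> real^'n \<Rightarrow> complex^'m" where
  "fm_vgrad V u x = (\<Sum>j\<in>UNIV. (V $ j) *\<^sub>R fm_deriv (unit_mi 1 j) u x)"

definition fm_laplace :: "(real^'n::finite \<Rightarrow> complex^'m) \<Rightarrow> real^'n \<Rightarrow> complex^'m" where
  "fm_laplace u x = (\<Sum>j\<in>UNIV. fm_deriv (unit_mi 2 j) u x)"

definition mat_act :: "real^'n^'n \<Rightarrow> complex^'n \<Rightarrow> complex^'n" where
  "mat_act M v = (\<chi> i. \<Sum>j\<in>UNIV. complex_of_real (M $ i $ j) * v $ j)"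

text \<open>L^1((0,T), X) for X given by a membership predicate and a norm: strongly
(Bochner) measurable, i.e. a.e. limit in the norm of X of X-valued simple functions,
values a.e. in X, and integrable norm.\<close>
definition L1_sp :: "(('a \<Rightarrow> 'b::ab_group_add) \<Rightarrow> bool) \<Rightarrow> (('a \<Rightarrow> 'b) \<Rightarrow> real) \<Rightarrow> real \<Rightarrow> (real \<Rightarrow> 'a \<Rightarrow> 'b) \<Rightarrow> bool" where
  "L1_sp X nrm T u \<longleftrightarrow>
     (\<exists>s::nat \<Rightarrow> real \<Rightarrow> 'a \<Rightarrow> 'b.
        (\<forall>k. finite (s k ` {0<..<T}) \<and> (\<forall>t\<in>{0<..<T}. X (s k t)) \<and>
             (\<forall>y. {t\<in>{0<..<T}. s k t = y} \<in> sets lebesgue)) \<and>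
        (AE t in lebesgue. t \<in> {0<..<T} \<longrightarrow> (\<lambda>k. nrm (u t - s k t)) \<longlonglongrightarrow> 0)) \<and>
     (AE t in lebesgue. t \<in> {0<..<T} \<longrightarrow> X (u t)) \<and>
     set_integrable lebesgue {0<..<T} (\<lambda>t. nrm (u t))"

definition L1_norm :: "(('a \<Rightarrow> 'b) \<Rightarrow> real) \<Rightarrow> real \<Rightarrow> (real \<Rightarrow> 'a \<Rightarrow> 'b) \<Rightarrow> real" where
  "L1_norm nrm T u = (LINT t:{0<..<T}|lebesgue. nrm (u t))"

text \<open>W^{1,1}((0,T), FM) with (continuous representative) u and weak derivative u'.
The FM-valued Bochner integral evaluated at x is the integral of the values at x,
since point evaluation is a bounded linear functional on FM.\<close>
definition W11_FM :: "real \<Rightarrow> (real \<Rightarrow> real^'n \<Rightarrow> complex^'m) \<Rightarrow> (real \<Rightarrow> real^'n \<Rightarrow> complex^'m) \<Rightarrow> bool" where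
  "W11_FM T u u' \<longleftrightarrow> L1_sp in_FM fm_norm T u \<and> L1_sp in_FM fm_norm T u' \<and>
     (\<forall>t\<in>{0..T}. \<forall>x. u t x = u 0 x + (LINT s:{0..t}|lebesgue. u' s x))"

definition pgrad :: "(real^'n \<Rightarrow> complex) \<Rightarrow> real^'n \<Rightarrow> complex^'n" where
  "pgrad q x = (\<chi> j. vector_derivative (\<lambda>s. q (x + s *\<^sub>R axis j 1)) (at 0))"

definition pgrad_exists :: "(real^'n \<Rightarrow> complex) \<Rightarrow> bool" where
  "pgrad_exists q \<longleftrightarrow> (\<forall>x j. (\<lambda>s. q (x + s *\<^sub>R axis j 1)) differentiable (at 0))"

definition lin_sol_with ::
  "real \<Rightarrow> real \<Rightarrow> real \<Rightarrow> real \<Rightarrow> real^'n::finite \<Rightarrow> real^'n^'n \<Rightarrow>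
   (real \<Rightarrow> real^'n \<Rightarrow> complex^'n) \<Rightarrow> (real^'n \<Rightarrow> complex^'n) \<Rightarrow>
   (real \<Rightarrow> real^'n \<Rightarrow> complex^'n) \<Rightarrow> (real \<Rightarrow> real^'n \<Rightarrow> complex^'n) \<Rightarrow>
   (real \<Rightarrow> real^'n \<Rightarrow> complex) \<Rightarrow> bool" where
  "lin_sol_with T lam\<^sub>0 Gam\<^sub>0 Gam\<^sub>2 V M f u\<^sub>0 u u' q \<longleftrightarrow>
     W11_FM T u u' \<and>
     (\<forall>t\<in>{0..T}. in_FM0s (u t)) \<and>
     L1_sp (in_FMk 4) (fmk_norm 4) T u \<and>
     (AE t in lebesgue. t \<in> {0<..<T} \<longrightarrow> pgrad_exists (q t)) \<and>
     L1_sp in_FM fm_norm T (\<lambda>t. pgrad (q t)) \<and>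
     (AE t in lebesgue. t \<in> {0<..<T} \<longrightarrow>
        (\<forall>x. u' t x + lam\<^sub>0 *\<^sub>R fm_vgrad V (u t) x + mat_act M (u t x)
              - Gam\<^sub>0 *\<^sub>R fm_laplace (u t) x + Gam\<^sub>2 *\<^sub>R fm_laplace (fm_laplace (u t)) x
              + pgrad (q t) x = f t x)) \<and>
     u 0 = u\<^sub>0"

definition lin_sol where
  "lin_sol T lam\<^sub>0 Gam\<^sub>0 Gam\<^sub>2 V M f u\<^sub>0 u q \<longleftrightarrow> (\<exists>u'. lin_sol_with T lam\<^sub>0 Gam\<^sub>0 Gam\<^sub>2 V M f u\<^sub>0 u u' q)"

end

theory Submission
  imports Defs
begin

text \<open>
  Finite measures can be written as densities over one common finite measure \<open>\<nu>\<close>. Approximating a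
  Bochner integrable \<open>FM\<close>-valued function by simple functions, all of whose values have densities over
  the same \<open>\<nu>\<close>, turns it into a single density \<open>h t \<xi>\<close> that is integrable over time and \<open>\<nu>\<close>; injectivity
  of the Fourier transform makes \<open>FM\<close>-norms equal to \<open>L\<^sup>1(\<nu>)\<close>-norms of densities. On the Fourier side the
  Helmholtz projection removes the pressure, and the system becomes, for each frequency \<open>\<xi>\<close> separately,
  a linear ordinary differential equation with matrix \<open>A(\<xi>) = \<sigma>(\<xi>) I + P(\<xi>) M\<close>. It is solved by
  Duhamel's formula and uniquely so by Gronwall's inequality; since \<open>Re \<sigma>(\<xi>) \<ge> c \<bar>\<xi>\<bar>\<^sup>4 - C\<close>, the time integral
  of \<open>(1 + \<bar>\<xi>\<bar>\<^sup>4) \<bar>exp (-t A(\<xi>))\<bar>\<close> is bounded uniformly in \<open>\<xi>\<close>, which gives the maximal regularity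
  estimate by Tonelli. A pressure gradient has a density parallel to \<open>\<xi>\<close> because its line integrals
  around rectangles vanish.
\<close>

section \<open>Injectivity of the Fourier transform of measures\<close>

text \<open>Unit point masses at distinct points have distance 2 in the space of measures, so
  \<open>FM\<close> is not separable and no finite measure dominates all of it. A common
  \<open>\<nu>\<close> exists only because Bochner measurability leaves countably many values to
  dominate. It may change with the data and with the solutions under comparison; this is harmless,
  since norms are independent of the representation and the final constant is fixed before any data
  appear. The end point exponent 1 in time costs nothing because \<open>FM\<close> norms are plain
  (weighted) integrals over \<open>\<xi>\<close>. As \<open>P(\<xi>)\<close> and \<open>M\<close> do
  not commute in general, the semigroup is written as a scalar exponential, which carries all the
  decay, times a power series in a matrix bounded uniformly in \<open>\<xi>\<close>. In the
  uniqueness part the recurring obstacle is that facts hold at each time outside a null set of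
  frequencies depending on that time; Fubini and rational times convert them into facts at almost
  every frequency.\<close>

lemma AE_zero_if_integral_zero_on_generator:
  fixes f :: "'a \<Rightarrow> 'b::{second_countable_topology,banach}"
  assumes M: "sigma_finite_measure M" and f: "integrable M f"
    and G: "G \<subseteq> sets M" "Int_stable G"
    and approx: "\<And>A. A \<in> sets M \<Longrightarrow> \<exists>B\<in>sigma_sets (space M) G. AE x in M. x \<in> A \<longleftrightarrow> x \<in> B"
    and z: "\<And>A. A \<in> G \<Longrightarrow> set_lebesgue_integral M A f = 0" "integral\<^sup>L M f = 0"
  shows "AE x in M. f x = 0"
proof (rule sigma_finite_measure.density_zero[OF M f])
  have si: "set_integrable M A f" if "A \<in> sets M" for A
    using integrable_mult_indicator[OF that f] by (simp add: set_integrable_def)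
  have sp: "set_lebesgue_integral M (space M) f = 0"
    using z(2) by (simp add: set_lebesgue_integral_def cong: Bochner_Integration.integral_cong)
  have Gsp: "G \<subseteq> Pow (space M)" using G(1) sets.space_closed[of M] by (rule order_trans)
  have GM: "A \<in> sets M" if "A \<in> sigma_sets (space M) G" for A
    using that sets.sigma_sets_subset[OF G(1)] by blast
  \<comment> \<open>The sets on which \<open>f\<close> integrates to 0 are closed under complements
    and disjoint unions, so an intersection stable generator suffices.\<close>
  have zero: "set_lebesgue_integral M B f = 0" if B: "B \<in> sigma_sets (space M) G" for B
    using G(2) Gsp B
  proof (induct rule: sigma_sets_induct_disjoint)
    case (basic A) then show ?case by (rule z)
  next
    case empty then show ?case by (simp add: set_lebesgue_integral_def)
  next
    case (compl A)
    then have A: "A \<in> sets M" by (intro GM)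
    have "set_lebesgue_integral M (A \<union> (space M - A)) f
        = set_lebesgue_integral M A f + set_lebesgue_integral M (space M - A) f"
      using A by (intro set_integral_Un si) auto
    moreover have "A \<union> (space M - A) = space M"
      using A sets.sets_into_space by auto
    ultimately show ?case using compl sp by simp
  next
    case (union A)
    then have A: "A i \<in> sets M" for i by (intro GM) auto
    have "set_lebesgue_integral M (\<Union>i. A i) f = (\<Sum>i. set_lebesgue_integral M (A i) f)"
      using union(1) A by (intro lebesgue_integral_countable_add si) (auto simp: disjoint_family_on_def)
    then show ?case using union by simp
  qed
  \<comment> \<open>Agreement up to a null set is enough here. This matters for Lebesgue measurable
    time sets, where intervals generate only the Borel ones.\<close>
  fix A assume A: "A \<in> sets M"
  then obtain B where B: "B \<in> sigma_sets (space M) G" "AE x in M. x \<in> A \<longleftrightarrow> x \<in> B"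
    using approx by blast
  have "set_lebesgue_integral M A f = set_lebesgue_integral M B f"
    unfolding set_lebesgue_integral_def
  proof (rule integral_cong_AE)
    show "AE x in M. indicator A x *\<^sub>R f x = indicator B x *\<^sub>R f x"
      using B(2) by eventually_elim (simp add: indicator_def)
  qed (use A GM[OF B(1)] borel_measurable_integrable[OF f] in measurable)
  with zero[OF B(1)] show "set_lebesgue_integral M A f = 0" by simp
qed

text \<open>The indicator of a closed set \<open>C\<close> is the pointwise limit of the continuous
  cut-offs \<open>max 0 (1 - n * infdist \<xi> C)\<close>, and closed sets generate the Borel
  sets.\<close>

lemma AE_zero_if_bounded_continuous_integral_zero:
  fixes k :: "'a::euclidean_space \<Rightarrow> 'b::{second_countable_topology,banach}"
  assumes M: "finite_measure M" and k: "integrable M k" and sets: "sets M = sets borel"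
    and z: "\<And>\<phi>::'a \<Rightarrow> real. continuous_on UNIV \<phi> \<Longrightarrow> (\<And>\<xi>. \<bar>\<phi> \<xi>\<bar> \<le> 1) \<Longrightarrow> (\<integral>\<xi>. \<phi> \<xi> *\<^sub>R k \<xi> \<partial>M) = 0"
  shows "AE \<xi> in M. k \<xi> = 0"
proof (rule AE_zero_if_integral_zero_on_generator[OF _ k, of "Collect closed"])
  show "sigma_finite_measure M" by (rule finite_measure.axioms[OF M])
  have sp: "space M = UNIV" using sets_eq_imp_space_eq[OF sets] by simp
  have "sets M = sigma_sets (space M) (Collect closed)"
    unfolding sets sp borel_eq_closed by simp
  then show "\<exists>B\<in>sigma_sets (space M) (Collect closed). AE x in M. x \<in> A \<longleftrightarrow> x \<in> B" if "A \<in> sets M" for A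
    using that by auto
  show "Int_stable (Collect closed :: 'a set set)" by (auto intro!: Int_stableI)
  show "Collect closed \<subseteq> sets M" by (auto simp: sets)
  show "integral\<^sup>L M k = 0" using z[of "\<lambda>_. 1"] by simp
  fix C :: "'a set" assume "C \<in> Collect closed"
  then have C: "closed C" by simp
  \<comment> \<open>The empty set is separate because \<open>infdist\<close> to it is 0 by
    convention, so the cut-offs would be constantly 1.\<close>
  show "set_lebesgue_integral M C k = 0"
  proof (cases "C = {}")
    case True then show ?thesis by (simp add: set_lebesgue_integral_def)
  next
    case False
    define \<phi> where "\<phi> n \<xi> = max 0 (1 - real n * infdist \<xi> C)" for n \<xi>
    have cont: "continuous_on UNIV (\<phi> n)" for n
      unfolding \<phi>_def by (intro continuous_intros)
    have bd: "\<bar>\<phi> n \<xi>\<bar> \<le> 1" for n \<xi>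
      by (auto simp: \<phi>_def max_def infdist_nonneg)
    have [measurable]: "\<phi> n \<in> borel_measurable M" for n
      using borel_measurable_continuous_onI[OF cont] sets by (simp cong: measurable_cong_sets)
    have [measurable]: "C \<in> sets M" using C sets by auto
    note [measurable] = borel_measurable_integrable[OF k]
    have lim: "(\<lambda>n. \<phi> n \<xi>) \<longlonglongrightarrow> indicator C \<xi>" for \<xi>
    proof (cases "\<xi> \<in> C")
      case True then show ?thesis by (simp add: \<phi>_def)
    next
      case nC: False
      then have p: "infdist \<xi> C > 0"
        using in_closed_iff_infdist_zero[OF C \<open>C \<noteq> {}\<close>] infdist_nonneg[of \<xi> C] by (simp add: less_le)
      obtain N where N: "real N > 1 / infdist \<xi> C" using reals_Archimedean2 by blast
      have "\<phi> n \<xi> = 0" if "n \<ge> N" for n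
      proof -
        have "1 / infdist \<xi> C < real n" using N that by linarith
        then show ?thesis using p by (simp add: \<phi>_def field_simps)
      qed
      then have "eventually (\<lambda>n. \<phi> n \<xi> = 0) sequentially"
        by (auto simp: eventually_sequentially)
      then show ?thesis using nC by (simp add: tendsto_eventually)
    qed
    have "(\<lambda>n. \<integral>\<xi>. \<phi> n \<xi> *\<^sub>R k \<xi> \<partial>M) \<longlonglongrightarrow> (\<integral>\<xi>. indicator C \<xi> *\<^sub>R k \<xi> \<partial>M)"
    proof (rule integral_dominated_convergence[where w = "\<lambda>\<xi>. norm (k \<xi>)"])
      show "AE \<xi> in M. (\<lambda>n. \<phi> n \<xi> *\<^sub>R k \<xi>) \<longlonglongrightarrow> indicator C \<xi> *\<^sub>R k \<xi>"
        by (intro AE_I2 tendsto_intros lim)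
      show "AE \<xi> in M. norm (\<phi> n \<xi> *\<^sub>R k \<xi>) \<le> norm (k \<xi>)" for n
        using bd by (auto intro!: AE_I2 mult_left_le_one_le)
    qed (use k in auto)
    moreover have "(\<integral>\<xi>. \<phi> n \<xi> *\<^sub>R k \<xi> \<partial>M) = 0" for n
      by (rule z[OF cont bd])
    ultimately have "0 = (\<integral>\<xi>. indicator C \<xi> *\<^sub>R k \<xi> \<partial>M)" by (simp add: LIMSEQ_const_iff)
    then show ?thesis by (simp add: set_lebesgue_integral_def)
  qed
qed

section \<open>Characters and trigonometric test functions\<close>

definition ek :: "'a::euclidean_space \<Rightarrow> 'a \<Rightarrow> complex" where
  "ek x \<xi> = exp (- \<i> * complex_of_real (x \<bullet> \<xi>))"

lemma ek_0 [simp]: "ek 0 \<xi> = 1" by (simp add: ek_def)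

lemma norm_ek [simp]: "norm (ek x \<xi>) = 1"
  using norm_exp_i_times[of "- (x \<bullet> \<xi>)"] by (simp add: ek_def)

lemma ek_add: "ek (x + y) \<xi> = ek x \<xi> * ek y \<xi>"
  by (simp add: ek_def inner_add_left algebra_simps flip: exp_add)

lemma continuous_ek: "continuous_on UNIV (ek x)"
  unfolding ek_def by (intro continuous_intros)

lemma borel_measurable_ek [measurable]: "ek x \<in> borel_measurable borel"
  by (rule borel_measurable_continuous_onI[OF continuous_ek])

lemma sin_inner_eq_ek: "complex_of_real (sin (a * (\<xi> \<bullet> b))) = (ek (- a *\<^sub>R b) \<xi> - ek (a *\<^sub>R b) \<xi>) / (2 * \<i>)"
  by (simp add: ek_def sin_exp_eq inner_commute flip: sin_of_real)

text \<open>All its values lie in one compact cube, where polynomials are dense, while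
  \<open>sin_vec a \<xi> /\<^sub>R a\<close> tends to \<open>\<xi>\<close> as \<open>a\<close> tends
  to 0.\<close>

definition sin_vec :: "real \<Rightarrow> 'a::euclidean_space \<Rightarrow> 'a" where
  "sin_vec a \<xi> = (\<Sum>b\<in>Basis. sin (a * (\<xi> \<bullet> b)) *\<^sub>R b)"

lemma continuous_sin_vec [continuous_intros]: "continuous_on A (sin_vec a)"
  unfolding sin_vec_def by (intro continuous_intros)

text \<open>A factor \<open>sin (a \<xi>\<^sub>b)\<close> turns the transform into a linear combination of its own translates.\<close>
lemma fourier_zero_mult_polynomial_sin_vec:
  fixes k :: "'a::euclidean_space \<Rightarrow> complex"
  assumes p: "real_polynomial_function p" and s: "sets M = sets borel"
    and k: "integrable M k" "\<And>x. (\<integral>\<xi>. ek x \<xi> * k \<xi> \<partial>M) = 0"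
  shows "integrable M (\<lambda>\<xi>. complex_of_real (p (sin_vec a \<xi>)) * k \<xi>) \<and>
    (\<forall>x. (\<integral>\<xi>. ek x \<xi> * (complex_of_real (p (sin_vec a \<xi>)) * k \<xi>) \<partial>M) = 0)"
proof -
  have [measurable]: "ek x \<in> borel_measurable M" for x using s by (simp cong: measurable_cong_sets)
  have ie: "integrable M (\<lambda>\<xi>. ek x \<xi> * k \<xi>)" if k: "integrable M k" for x and k :: "'a \<Rightarrow> complex"
  proof -
    note [measurable] = borel_measurable_integrable[OF k]
    show ?thesis by (rule Bochner_Integration.integrable_bound[OF k]) (auto simp: norm_mult)
  qed
  show ?thesis using p k
  proof (induction arbitrary: k)
    case (linear f)
    define c where "c b = complex_of_real (f b) / (2 * \<i>)" for b
    have eq: "complex_of_real (f (sin_vec a \<xi>)) * k \<xi>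
        = (\<Sum>b\<in>Basis. c b * (ek (- a *\<^sub>R b) \<xi> * k \<xi>) - c b * (ek (a *\<^sub>R b) \<xi> * k \<xi>))" for \<xi>
    proof -
      have "complex_of_real (f (sin_vec a \<xi>)) = (\<Sum>b\<in>Basis. complex_of_real (sin (a * (\<xi> \<bullet> b))) * f b)"
        using linear(1) unfolding sin_vec_def
        by (simp add: linear_sum[OF bounded_linear.linear] linear_scale[OF bounded_linear.linear])
      also have "\<dots> = (\<Sum>b\<in>Basis. c b * ek (- a *\<^sub>R b) \<xi> - c b * ek (a *\<^sub>R b) \<xi>)"
        by (intro sum.cong refl, subst sin_inner_eq_ek) (simp add: c_def diff_divide_distrib algebra_simps)
      finally show ?thesis by (simp add: sum_distrib_right left_diff_distrib mult.assoc)
    qed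
    have i1: "integrable M (\<lambda>\<xi>. complex_of_real (f (sin_vec a \<xi>)) * k \<xi>)"
      unfolding eq by (intro Bochner_Integration.integrable_sum Bochner_Integration.integrable_diff integrable_mult_right ie linear)
    have "(\<integral>\<xi>. ek x \<xi> * (complex_of_real (f (sin_vec a \<xi>)) * k \<xi>) \<partial>M) = 0" for x
    proof -
      have "(\<integral>\<xi>. ek x \<xi> * (complex_of_real (f (sin_vec a \<xi>)) * k \<xi>) \<partial>M)
        = (\<integral>\<xi>. (\<Sum>b\<in>Basis. c b * (ek (x - a *\<^sub>R b) \<xi> * k \<xi>) - c b * (ek (x + a *\<^sub>R b) \<xi> * k \<xi>)) \<partial>M)"
        unfolding eq using ek_add[of x "- a *\<^sub>R b" for b]
        by (intro Bochner_Integration.integral_cong refl)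
          (simp add: sum_distrib_left ek_add right_diff_distrib mult_ac)
      also have "\<dots> = (\<Sum>b\<in>Basis. c b * (\<integral>\<xi>. ek (x - a *\<^sub>R b) \<xi> * k \<xi> \<partial>M) - c b * (\<integral>\<xi>. ek (x + a *\<^sub>R b) \<xi> * k \<xi> \<partial>M))"
        by (simp add: ie linear)
      finally show ?thesis by (simp add: linear)
    qed
    with i1 show ?case by blast
  next
    case (const c)
    have "(\<integral>\<xi>. ek x \<xi> * (complex_of_real c * k \<xi>) \<partial>M) = complex_of_real c * (\<integral>\<xi>. ek x \<xi> * k \<xi> \<partial>M)" for x
      by (subst integral_mult_right_zero[symmetric]) (simp add: mult_ac)
    then show ?case using const by simp
  next
    case (add f g)
    from add.IH(1)[OF add.prems] add.IH(2)[OF add.prems] show ?case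
      by (simp add: ring_distribs ie)
  next
    \<comment> \<open>The hypothesis for \<open>f\<close> is applied to the density already
      multiplied by \<open>g\<close>; this is why \<open>k\<close> is arbitrary and why
      integrability is carried along.\<close>
    case (mult f g)
    from mult.IH(2)[OF mult.prems] have "integrable M (\<lambda>\<xi>. complex_of_real (g (sin_vec a \<xi>)) * k \<xi>)"
      "\<And>x. (\<integral>\<xi>. ek x \<xi> * (complex_of_real (g (sin_vec a \<xi>)) * k \<xi>) \<partial>M) = 0" by auto
    from mult.IH(1)[OF this] show ?case by (simp add: mult.assoc)
  qed
qed

text \<open>A test function \<open>\<phi> (sin_vec a \<xi> /\<^sub>R a)\<close> is periodic in
  \<open>\<xi>\<close> and factors through a compact cube, so by Stone-Weierstrass it is a uniform
  limit, on the whole space, of polynomials in sines, against which \<open>k\<close> integrates to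
  0. Letting \<open>a\<close> tend to 0 recovers \<open>\<phi>\<close> by dominated convergence.
  Periodicity replaces any tightness argument for the measure.\<close>

lemma fourier_injective_scalar:
  fixes k :: "'a::euclidean_space \<Rightarrow> complex"
  assumes M: "finite_measure M" and s: "sets M = sets borel" and k: "integrable M k"
    and z: "\<And>x. (\<integral>\<xi>. ek x \<xi> * k \<xi> \<partial>M) = 0"
  shows "AE \<xi> in M. k \<xi> = 0"
proof (rule AE_zero_if_bounded_continuous_integral_zero[OF M k s])
  fix \<phi> :: "'a \<Rightarrow> real" assume cont: "continuous_on UNIV \<phi>" and bd: "\<And>\<xi>. \<bar>\<phi> \<xi>\<bar> \<le> 1"
  have meas: "f \<in> borel_measurable M" if "continuous_on UNIV f" for f :: "'a \<Rightarrow> real"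
    using borel_measurable_continuous_onI[OF that] s by (simp cong: measurable_cong_sets)
  note [measurable] = borel_measurable_integrable[OF k]
  have zero: "(\<integral>\<xi>. \<phi> (sin_vec a \<xi> /\<^sub>R a) *\<^sub>R k \<xi> \<partial>M) = 0" if "a > 0" for a
  proof -
    have c: "continuous_on UNIV (\<lambda>\<xi>. \<phi> (sin_vec a \<xi> /\<^sub>R a))"
      by (intro continuous_on_compose2[OF cont] continuous_intros) auto
    note [measurable] = meas[OF c]
    have ip: "integrable M (\<lambda>\<xi>. \<phi> (sin_vec a \<xi> /\<^sub>R a) *\<^sub>R k \<xi>)"
      by (rule Bochner_Integration.integrable_bound[OF k]) (use bd in \<open>auto intro!: AE_I2 mult_left_le_one_le\<close>)
    have "norm (\<integral>\<xi>. \<phi> (sin_vec a \<xi> /\<^sub>R a) *\<^sub>R k \<xi> \<partial>M) \<le> 0 + e" if "e > 0" for e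
    proof -
      \<comment> \<open>The summand 1 keeps the denominator positive when \<open>k\<close> vanishes
        almost everywhere.\<close>
      define e' where "e' = e / (1 + (\<integral>\<xi>. norm (k \<xi>) \<partial>M))"
      have nn: "(\<integral>\<xi>. norm (k \<xi>) \<partial>M) \<ge> 0" by simp
      have e': "e' > 0" using \<open>e > 0\<close> nn unfolding e'_def by (intro divide_pos_pos) linarith+
      obtain p where p: "real_polynomial_function p"
          "\<And>y. y \<in> cbox (- One) One \<Longrightarrow> \<bar>\<phi> (y /\<^sub>R a) - p y\<bar> < e'"
        by (rule Stone_Weierstrass_real_polynomial_function[OF compact_cbox _ e', of "- One" One "\<lambda>y. \<phi> (y /\<^sub>R a)"])
          (auto intro!: continuous_on_compose2[OF cont] continuous_intros)
      have mem: "sin_vec a \<xi> \<in> cbox (- One) One" for \<xi>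
        by (auto simp: mem_box sin_vec_def inner_sum_left inner_Basis if_distrib cong: if_cong)
      note P = fourier_zero_mult_polynomial_sin_vec[OF p(1) s k z, of a]
      have iq: "integrable M (\<lambda>\<xi>. complex_of_real (p (sin_vec a \<xi>)) * k \<xi>)" using P by blast
      have "(\<integral>\<xi>. complex_of_real (p (sin_vec a \<xi>)) * k \<xi> \<partial>M) = 0" using P[THEN conjunct2, rule_format, of 0] by simp
      then have "(\<integral>\<xi>. \<phi> (sin_vec a \<xi> /\<^sub>R a) *\<^sub>R k \<xi> \<partial>M)
          = (\<integral>\<xi>. \<phi> (sin_vec a \<xi> /\<^sub>R a) *\<^sub>R k \<xi> - complex_of_real (p (sin_vec a \<xi>)) * k \<xi> \<partial>M)"
        by (simp add: Bochner_Integration.integral_diff[OF ip iq])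
      also have "norm \<dots> \<le> (\<integral>\<xi>. e' * norm (k \<xi>) \<partial>M)"
      proof (rule Bochner_Integration.integral_norm_bound_integral)
        fix \<xi>
        have "norm (\<phi> (sin_vec a \<xi> /\<^sub>R a) *\<^sub>R k \<xi> - complex_of_real (p (sin_vec a \<xi>)) * k \<xi>)
          = \<bar>\<phi> (sin_vec a \<xi> /\<^sub>R a) - p (sin_vec a \<xi>)\<bar> * norm (k \<xi>)"
          by (simp add: scaleR_conv_of_real norm_mult flip: left_diff_distrib of_real_diff)
        also have "\<dots> \<le> e' * norm (k \<xi>)"
          using p(2)[OF mem] by (intro mult_right_mono) (auto intro: less_imp_le)
        finally show "norm (\<phi> (sin_vec a \<xi> /\<^sub>R a) *\<^sub>R k \<xi> - complex_of_real (p (sin_vec a \<xi>)) * k \<xi>) \<le> e' * norm (k \<xi>)" .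
      qed (use ip iq k in auto)
      also have "\<dots> = e' * (\<integral>\<xi>. norm (k \<xi>) \<partial>M)" by simp
      also have "\<dots> \<le> e' * (1 + (\<integral>\<xi>. norm (k \<xi>) \<partial>M))" using e' by (intro mult_left_mono) auto
      also have "\<dots> = e" using nn by (simp add: e'_def add_nonneg_eq_0_iff)
      finally show ?thesis by simp
    qed
    then show ?thesis using field_le_epsilon[of "norm (\<integral>\<xi>. \<phi> (sin_vec a \<xi> /\<^sub>R a) *\<^sub>R k \<xi> \<partial>M)" 0] by simp
  qed
  define a where "a n = 1 / real (Suc n)" for n
  have a0: "a \<longlonglongrightarrow> 0" unfolding a_def using LIMSEQ_inverse_real_of_nat by (simp add: inverse_eq_divide)
  have apos: "a n > 0" for n by (simp add: a_def)
  have lim: "(\<lambda>n. sin_vec (a n) \<xi> /\<^sub>R a n) \<longlonglongrightarrow> \<xi>" for \<xi> :: 'a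
  proof -
    have l1: "((\<lambda>x. sin (x * y) / x) \<longlongrightarrow> y) (at (0::real))" for y :: real
    proof -
      have "((\<lambda>x. sin (x * y)) has_real_derivative y) (at 0)"
        by (auto intro!: derivative_eq_intros)
      then show ?thesis by (simp add: has_field_derivative_iff)
    qed
    have l2: "(\<lambda>n. sin (a n * y) / a n) \<longlonglongrightarrow> y" for y
      using filterlim_compose[OF l1, of a sequentially y] a0 apos
      by (auto simp: filterlim_at less_imp_neq[THEN not_sym])
    have "(\<lambda>n. \<Sum>b\<in>Basis. (sin (a n * (\<xi> \<bullet> b)) / a n) *\<^sub>R b) \<longlonglongrightarrow> (\<Sum>b\<in>Basis. (\<xi> \<bullet> b) *\<^sub>R b)"
      by (intro tendsto_intros l2)
    then show ?thesis by (simp add: sin_vec_def scaleR_sum_right euclidean_representation divide_inverse mult.commute)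
  qed
  have "(\<lambda>n. \<integral>\<xi>. \<phi> (sin_vec (a n) \<xi> /\<^sub>R a n) *\<^sub>R k \<xi> \<partial>M) \<longlonglongrightarrow> (\<integral>\<xi>. \<phi> \<xi> *\<^sub>R k \<xi> \<partial>M)"
  proof (rule integral_dominated_convergence[where w = "\<lambda>\<xi>. norm (k \<xi>)"])
    show "AE \<xi> in M. (\<lambda>n. \<phi> (sin_vec (a n) \<xi> /\<^sub>R a n) *\<^sub>R k \<xi>) \<longlonglongrightarrow> \<phi> \<xi> *\<^sub>R k \<xi>"
      using continuous_on_tendsto_compose[OF cont lim] by (intro AE_I2 tendsto_intros) auto
    show "AE \<xi> in M. norm (\<phi> (sin_vec (a n) \<xi> /\<^sub>R a n) *\<^sub>R k \<xi>) \<le> norm (k \<xi>)" for n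
      using bd by (auto intro!: AE_I2 mult_left_le_one_le)
    show "(\<lambda>\<xi>. \<phi> \<xi> *\<^sub>R k \<xi>) \<in> borel_measurable M" using meas[OF cont] by measurable
    have "continuous_on UNIV (\<lambda>\<xi>. \<phi> (sin_vec (a n) \<xi> /\<^sub>R a n))" for n
      by (intro continuous_on_compose2[OF cont] continuous_intros) auto
    from meas[OF this] show "(\<lambda>\<xi>. \<phi> (sin_vec (a n) \<xi> /\<^sub>R a n) *\<^sub>R k \<xi>) \<in> borel_measurable M" for n by measurable
  qed (use k in auto)
  then show "(\<integral>\<xi>. \<phi> \<xi> *\<^sub>R k \<xi> \<partial>M) = 0" by (simp add: zero[OF apos] LIMSEQ_const_iff)
qed

section \<open>Densities representing elements of FM\<close>

lemma cscale_nth [simp]: "cscale c v $ j = c * v $ j"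
  by (simp add: cscale_def)

lemma norm_cscale [simp]: "norm (cscale c v) = norm c * norm v"
  by (simp add: norm_vec_def norm_mult L2_set_right_distrib)

lemma cscale_eq_0_iff [simp]: "cscale c v = 0 \<longleftrightarrow> c = 0 \<or> v = 0"
  using norm_cscale[of c v] by (metis mult_eq_0_iff norm_eq_zero)

lemma bounded_bilinear_cscale: "bounded_bilinear (cscale :: complex \<Rightarrow> complex^'m \<Rightarrow> complex^'m)"
proof
  show "\<exists>K. \<forall>c (v::complex^'m). norm (cscale c v) \<le> norm c * norm v * K"
    by (rule exI[of _ 1]) simp
qed (simp_all add: vec_eq_iff algebra_simps)

lemmas cscale_simps = bounded_bilinear.add_left[OF bounded_bilinear_cscale]
  bounded_bilinear.add_right[OF bounded_bilinear_cscale]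
  bounded_bilinear.diff_left[OF bounded_bilinear_cscale]
  bounded_bilinear.diff_right[OF bounded_bilinear_cscale]
  bounded_bilinear.scaleR_left[OF bounded_bilinear_cscale]
  bounded_bilinear.scaleR_right[OF bounded_bilinear_cscale]

lemma cscale_0_right [simp]: "cscale c 0 = 0" and cscale_0_left [simp]: "cscale 0 v = 0"
  and cscale_1 [simp]: "cscale 1 v = v" and cscale_cscale [simp]: "cscale c (cscale d v) = cscale (c * d) v"
  by (simp_all add: vec_eq_iff mult.assoc)

lemma borel_measurable_cscale [measurable (raw)]:
  assumes "f \<in> borel_measurable M" "g \<in> borel_measurable M"
  shows "(\<lambda>x. cscale (f x) (g x)) \<in> borel_measurable M"
  using assms by (rule borel_measurable_continuous_Pair)
    (intro bounded_bilinear.continuous_on[OF bounded_bilinear_cscale] continuous_intros)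

lemma integrable_vec_nth: "integrable M h \<Longrightarrow> integrable M (\<lambda>\<xi>. (h \<xi> :: complex^'m) $ j)"
  by (rule integrable_bounded_linear[OF bounded_linear_vec_nth])

lemma integral_vec_nth:
  "integrable M h \<Longrightarrow> (\<integral>\<xi>. (h \<xi> :: complex^'m) $ j \<partial>M) = (\<integral>\<xi>. h \<xi> \<partial>M) $ j"
  by (rule integral_bounded_linear[OF bounded_linear_vec_nth])

lemma measurable_if_sets_borel: "sets M = sets borel \<Longrightarrow> f \<in> borel_measurable borel \<Longrightarrow> f \<in> borel_measurable M"
  by (simp cong: measurable_cong_sets)

lemma integrable_cscale_bounded:
  assumes "integrable M h" "m \<in> borel_measurable M" "\<And>\<xi>. norm (m \<xi>) \<le> C"
  shows "integrable M (\<lambda>\<xi>. cscale (m \<xi>) (h \<xi>))"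
proof (rule Bochner_Integration.integrable_bound)
  show "integrable M (\<lambda>\<xi>. C * norm (h \<xi>))" using assms by auto
  have "0 \<le> C" using norm_ge_zero order_trans assms(3) by blast
  then show "AE \<xi> in M. norm (cscale (m \<xi>) (h \<xi>)) \<le> norm (C * norm (h \<xi>))"
    using assms(3) by (auto intro!: AE_I2 mult_right_mono simp: abs_mult)
qed (use assms in measurable)

lemma integrable_cscale_ek:
  "sets M = sets borel \<Longrightarrow> integrable M h \<Longrightarrow> integrable M (\<lambda>\<xi>. cscale (ek x \<xi>) (h \<xi>))"
  by (rule integrable_cscale_bounded[where C = 1]) (auto intro: measurable_if_sets_borel)

lemma fourier_meas_nth: "fourier_meas \<nu> h x $ j = (\<integral>\<xi>. ek x \<xi> * h \<xi> $ j \<partial>\<nu>)"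
  by (simp add: fourier_meas_def ek_def)

text \<open>One vector valued Bochner integral replaces the integrals of the components; linearity,
  Fubini and the norm bound with constant 1 then apply directly.\<close>

lemma fourier_meas_eq:
  assumes "sets \<nu> = sets borel" "integrable \<nu> h"
  shows "fourier_meas \<nu> h x = (\<integral>\<xi>. cscale (ek x \<xi>) (h \<xi>) \<partial>\<nu>)"
  by (simp add: vec_eq_iff fourier_meas_nth flip: integral_vec_nth[OF integrable_cscale_ek[OF assms]])

lemma norm_fourier_meas_le:
  assumes "sets \<nu> = sets borel" "integrable \<nu> h"
  shows "norm (fourier_meas \<nu> h x) \<le> (\<integral>\<xi>. norm (h \<xi>) \<partial>\<nu>)"
  unfolding fourier_meas_eq[OF assms]
  by (rule order_trans[OF integral_norm_bound]) simp

lemma fourier_meas_diff: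
  assumes "sets \<nu> = sets borel" "integrable \<nu> g" "integrable \<nu> h"
  shows "fourier_meas \<nu> (\<lambda>\<xi>. g \<xi> - h \<xi>) x = fourier_meas \<nu> g x - fourier_meas \<nu> h x"
  using assms by (simp add: fourier_meas_eq cscale_simps integrable_cscale_ek)

lemma fourier_meas_add:
  assumes "sets \<nu> = sets borel" "integrable \<nu> g" "integrable \<nu> h"
  shows "fourier_meas \<nu> (\<lambda>\<xi>. g \<xi> + h \<xi>) x = fourier_meas \<nu> g x + fourier_meas \<nu> h x"
  using assms by (simp add: fourier_meas_eq cscale_simps integrable_cscale_ek)

lemma fourier_meas_scaleR:
  assumes "sets \<nu> = sets borel" "integrable \<nu> g"
  shows "fourier_meas \<nu> (\<lambda>\<xi>. c *\<^sub>R g \<xi>) x = c *\<^sub>R fourier_meas \<nu> g x"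
  using assms by (simp add: fourier_meas_eq cscale_simps integrable_cscale_ek)

lemma fourier_meas_sum:
  assumes "sets \<nu> = sets borel" "\<And>i. i \<in> I \<Longrightarrow> integrable \<nu> (g i)"
  shows "fourier_meas \<nu> (\<lambda>\<xi>. \<Sum>i\<in>I. g i \<xi>) x = (\<Sum>i\<in>I. fourier_meas \<nu> (g i) x)"
  using assms by (simp add: fourier_meas_eq integrable_cscale_ek
      bounded_bilinear.sum_right[OF bounded_bilinear_cscale])

lemma fourier_meas_cong_AE:
  assumes "sets \<nu> = sets borel" "integrable \<nu> g" "integrable \<nu> h" "AE \<xi> in \<nu>. g \<xi> = h \<xi>"
  shows "fourier_meas \<nu> g = fourier_meas \<nu> h"
proof
  fix x
  note [measurable] = measurable_if_sets_borel[OF assms(1) borel_measurable_ek]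
    borel_measurable_integrable[OF assms(2)] borel_measurable_integrable[OF assms(3)]
  show "fourier_meas \<nu> g x = fourier_meas \<nu> h x"
    unfolding fourier_meas_eq[OF assms(1,2)] fourier_meas_eq[OF assms(1,3)]
    by (rule integral_cong_AE) (use assms(4) in auto)
qed

lemma fourier_meas_injective:
  assumes M: "finite_measure \<nu>" "sets \<nu> = sets borel" and i: "integrable \<nu> g" "integrable \<nu> h"
    and eq: "fourier_meas \<nu> g = fourier_meas \<nu> h"
  shows "AE \<xi> in \<nu>. g \<xi> = h \<xi>"
proof -
  have "AE \<xi> in \<nu>. g \<xi> $ j - h \<xi> $ j = 0" for j
  proof (rule fourier_injective_scalar[OF M])
    show "integrable \<nu> (\<lambda>\<xi>. g \<xi> $ j - h \<xi> $ j)"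
      by (intro Bochner_Integration.integrable_diff integrable_vec_nth i)
    fix x
    have "integrable \<nu> (\<lambda>\<xi>. ek x \<xi> * g \<xi> $ j)" "integrable \<nu> (\<lambda>\<xi>. ek x \<xi> * h \<xi> $ j)"
      using integrable_vec_nth[OF integrable_cscale_ek[OF M(2) i(1)], of x j]
        integrable_vec_nth[OF integrable_cscale_ek[OF M(2) i(2)], of x j] by simp_all
    then show "(\<integral>\<xi>. ek x \<xi> * (g \<xi> $ j - h \<xi> $ j) \<partial>\<nu>) = 0"
      using fun_cong[OF eq, of x] by (simp add: right_diff_distrib flip: fourier_meas_nth)
  qed
  then have "AE \<xi> in \<nu>. \<forall>j\<in>UNIV. g \<xi> $ j - h \<xi> $ j = 0"
    by (intro AE_finite_allI) auto
  then show ?thesis by eventually_elim (simp add: vec_eq_iff)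
qed

section \<open>Dominating measures and change of representation\<close>

lemma countable_dominating_measure:
  fixes \<nu> :: "nat \<Rightarrow> 'a measure"
  assumes s: "\<And>i. sets (\<nu> i) = sets N" and fin: "\<And>i. finite_measure (\<nu> i)"
  obtains \<mu> where "sets \<mu> = sets N" "finite_measure \<mu>" "\<And>i. absolutely_continuous \<mu> (\<nu> i)"
proof -
  have sp: "space (\<nu> i) = space N" for i using sets_eq_imp_space_eq[OF s] .
  \<comment> \<open>Positive weights make every null set of the weighted sum null for each summand;
    the factor \<open>(1/2)^i\<close> divided by the mass makes the sum finite, and the 1 avoids a
    division by zero.\<close>
  define c where "c i = (1/2)^i / (1 + measure (\<nu> i) (space N))" for i
  have c: "c i > 0" "c i * measure (\<nu> i) (space N) \<le> (1/2)^i" for i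
    by (auto simp: c_def field_simps add_pos_nonneg)
  define F where "F A = (\<integral>\<^sup>+i. ennreal (c i) * emeasure (\<nu> i) A \<partial>count_space UNIV)" for A
  define \<mu> where "\<mu> = measure_of (space N) (sets N) F"
  have [simp]: "sets \<mu> = sets N" "space \<mu> = space N" by (simp_all add: \<mu>_def)
  have em: "emeasure \<mu> A = F A" if "A \<in> sets N" for A
    unfolding \<mu>_def
  proof (rule emeasure_measure_of_sigma)
    show "sigma_algebra (space N) (sets N)" ..
    show "positive (sets N) F" by (simp add: positive_def F_def)
    show "countably_additive (sets N) F"
    proof (rule countably_additiveI)
      fix A :: "nat \<Rightarrow> _" assume A: "range A \<subseteq> sets N" "disjoint_family A"
      have "(\<Sum>n. F (A n)) = (\<integral>\<^sup>+i. (\<Sum>n. ennreal (c i) * emeasure (\<nu> i) (A n)) \<partial>count_space UNIV)"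
        unfolding F_def by (subst nn_integral_suminf) auto
      also have "\<dots> = F (\<Union>n. A n)"
        unfolding F_def using A s by (subst ennreal_suminf_cmult) (simp add: suminf_emeasure)
      finally show "(\<Sum>n. F (A n)) = F (\<Union>n. A n)" .
    qed
  qed (rule that)
  have "F (space N) \<le> (\<integral>\<^sup>+i. ennreal ((1/2)^i) \<partial>count_space UNIV)"
    unfolding F_def
  proof (intro nn_integral_mono)
    fix i
    have "emeasure (\<nu> i) (space N) = ennreal (measure (\<nu> i) (space N))"
      by (rule finite_measure.emeasure_eq_measure[OF fin])
    then show "ennreal (c i) * emeasure (\<nu> i) (space N) \<le> ennreal ((1/2)^i)"
      using c(2)[of i] c(1)[of i] by (simp add: ennreal_leI flip: ennreal_mult)
  qed
  also have "\<dots> = (\<Sum>i. ennreal ((1/2)^i))" by (rule nn_integral_count_space_nat)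
  also have "\<dots> < \<infinity>"
    by (simp add: suminf_ennreal2 summable_geometric)
  finally have "finite_measure \<mu>" by (intro finite_measureI) (simp add: em less_top)
  moreover have "absolutely_continuous \<mu> (\<nu> i)" for i
    unfolding absolutely_continuous_def
  proof
    fix A assume "A \<in> null_sets \<mu>"
    then have A: "A \<in> sets N" "F A = 0" using em by (auto simp: null_sets_def)
    then have "AE i in count_space UNIV. ennreal (c i) * emeasure (\<nu> i) A = 0"
      unfolding F_def by (subst (asm) nn_integral_0_iff_AE) auto
    then have "ennreal (c i) * emeasure (\<nu> i) A = 0" by (simp add: AE_count_space)
    then show "A \<in> null_sets (\<nu> i)" using A c(1)[of i] s by (auto simp: null_sets_def)
  qed
  ultimately show ?thesis by (intro that) auto
qed

lemma absolutely_continuous_real_density: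
  assumes "finite_measure \<mu>" "finite_measure \<nu>" "sets \<nu> = sets \<mu>" "absolutely_continuous \<mu> \<nu>"
  obtains \<rho> where "\<rho> \<in> borel_measurable \<mu>" "\<And>x. 0 \<le> \<rho> x" "\<nu> = density \<mu> (\<lambda>x. ennreal (\<rho> x))"
proof -
  interpret finite_measure \<mu> by fact
  obtain D where D: "D \<in> borel_measurable \<mu>" "AE x in \<mu>. RN_deriv \<mu> \<nu> x = ennreal (D x)" "\<And>x. 0 \<le> D x"
    using real_RN_deriv[OF assms(2,4,3)] by metis
  have "\<nu> = density \<mu> (RN_deriv \<mu> \<nu>)" using density_RN_deriv[OF assms(4,3)] by simp
  also have "\<dots> = density \<mu> (\<lambda>x. ennreal (D x))"
    using D by (intro density_cong) auto
  finally show ?thesis using D that by blast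
qed

lemma fm_rep_density:
  fixes g :: "real^'n \<Rightarrow> complex^'m"
  assumes \<mu>: "finite_measure \<mu>" "sets \<mu> = sets borel"
    and \<rho>: "\<rho> \<in> borel_measurable \<mu>" "\<And>x. 0 \<le> \<rho> x" and g: "integrable (density \<mu> (\<lambda>x. ennreal (\<rho> x))) g"
  shows "integrable \<mu> (\<lambda>\<xi>. \<rho> \<xi> *\<^sub>R g \<xi>)"
    and "fourier_meas (density \<mu> (\<lambda>x. ennreal (\<rho> x))) g = fourier_meas \<mu> (\<lambda>\<xi>. \<rho> \<xi> *\<^sub>R g \<xi>)"
    and "(\<integral>\<xi>. norm (g \<xi>) \<partial>density \<mu> (\<lambda>x. ennreal (\<rho> x))) = (\<integral>\<xi>. norm (\<rho> \<xi> *\<^sub>R g \<xi>) \<partial>\<mu>)"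
proof -
  have gm[measurable]: "g \<in> borel_measurable \<mu>" using borel_measurable_integrable[OF g] by simp
  show i: "integrable \<mu> (\<lambda>\<xi>. \<rho> \<xi> *\<^sub>R g \<xi>)"
    using g \<rho> by (subst (asm) integrable_density) auto
  note [measurable] = \<rho>(1) measurable_if_sets_borel[OF \<mu>(2) borel_measurable_ek]
  show "fourier_meas (density \<mu> (\<lambda>x. ennreal (\<rho> x))) g = fourier_meas \<mu> (\<lambda>\<xi>. \<rho> \<xi> *\<^sub>R g \<xi>)"
  proof
    fix x
    show "fourier_meas (density \<mu> (\<lambda>x. ennreal (\<rho> x))) g x = fourier_meas \<mu> (\<lambda>\<xi>. \<rho> \<xi> *\<^sub>R g \<xi>) x"
      using \<rho> \<mu> g i by (simp add: fourier_meas_eq integral_density cscale_simps)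
  qed
  show "(\<integral>\<xi>. norm (g \<xi>) \<partial>density \<mu> (\<lambda>x. ennreal (\<rho> x))) = (\<integral>\<xi>. norm (\<rho> \<xi> *\<^sub>R g \<xi>) \<partial>\<mu>)"
    using \<rho> by (simp add: integral_density)
qed

text \<open>Both representations are pulled back to a measure dominating \<open>\<nu>\<close> and
  \<open>\<nu>'\<close>, where injectivity of the Fourier transform identifies the densities. The
  independence of norms, multipliers and the solenoidal condition from the chosen representation
  rests on this.\<close>

lemma fm_reps_common:
  fixes g :: "real^'n \<Rightarrow> complex^'m"
  assumes "fm_rep \<nu> g u" "fm_rep \<nu>' g' u"
  obtains \<mu> \<rho> \<rho>' where "finite_measure \<mu>" "sets \<mu> = sets borel"
    "\<rho> \<in> borel_measurable \<mu>" "\<And>x. 0 \<le> \<rho> x" "\<nu> = density \<mu> (\<lambda>x. ennreal (\<rho> x))"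
    "\<rho>' \<in> borel_measurable \<mu>" "\<And>x. 0 \<le> \<rho>' x" "\<nu>' = density \<mu> (\<lambda>x. ennreal (\<rho>' x))"
    "AE \<xi> in \<mu>. \<rho> \<xi> *\<^sub>R g \<xi> = \<rho>' \<xi> *\<^sub>R g' \<xi>"
proof -
  \<comment> \<open>The pair is stretched to a sequence that is constant from index 1 on.\<close>
  obtain \<mu> :: "(real^'n) measure" where \<mu>: "sets \<mu> = sets borel" "finite_measure \<mu>"
    "\<And>i. absolutely_continuous \<mu> (if i = (0::nat) then \<nu> else \<nu>')"
  proof (rule countable_dominating_measure[of "\<lambda>i. if i = (0::nat) then \<nu> else \<nu>'" borel])
  qed (use assms in \<open>auto simp: fm_rep_def\<close>)
  have ac: "absolutely_continuous \<mu> \<nu>" "absolutely_continuous \<mu> \<nu>'" using \<mu>(3)[of 0] \<mu>(3)[of 1] by auto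
  obtain \<rho> where r: "\<rho> \<in> borel_measurable \<mu>" "\<And>x. 0 \<le> \<rho> x" "\<nu> = density \<mu> (\<lambda>x. ennreal (\<rho> x))"
    using absolutely_continuous_real_density[OF \<mu>(2) _ _ ac(1)] assms \<mu> by (auto simp: fm_rep_def)
  obtain \<rho>' where r': "\<rho>' \<in> borel_measurable \<mu>" "\<And>x. 0 \<le> \<rho>' x" "\<nu>' = density \<mu> (\<lambda>x. ennreal (\<rho>' x))"
    using absolutely_continuous_real_density[OF \<mu>(2) _ _ ac(2)] assms \<mu> by (auto simp: fm_rep_def)
  note a = fm_rep_density[OF \<mu>(2,1) r(1,2)] and b = fm_rep_density[OF \<mu>(2,1) r'(1,2)]
  have "AE \<xi> in \<mu>. \<rho> \<xi> *\<^sub>R g \<xi> = \<rho>' \<xi> *\<^sub>R g' \<xi>"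
    using assms r(3) r'(3)
    by (intro fourier_meas_injective[OF \<mu>(2,1)]) (auto simp: fm_rep_def a b simp flip: a(2) b(2))
  with \<mu> r r' show ?thesis using that by blast
qed

lemma fm_norm_eq:
  assumes u: "fm_rep \<nu> g u"
  shows "fm_norm u = (\<integral>\<xi>. norm (g \<xi>) \<partial>\<nu>)"
proof -
  have "(\<integral>\<xi>. norm (g' \<xi>) \<partial>\<nu>') = (\<integral>\<xi>. norm (g \<xi>) \<partial>\<nu>)" if u': "fm_rep \<nu>' g' u" for \<nu>' g'
  proof -
    obtain \<mu> \<rho> \<rho>' where m: "finite_measure \<mu>" "sets \<mu> = sets borel"
    "\<rho> \<in> borel_measurable \<mu>" "\<And>x. 0 \<le> \<rho> x" "\<nu> = density \<mu> (\<lambda>x. ennreal (\<rho> x))"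
    "\<rho>' \<in> borel_measurable \<mu>" "\<And>x. 0 \<le> \<rho>' x" "\<nu>' = density \<mu> (\<lambda>x. ennreal (\<rho>' x))"
    and ae: "AE \<xi> in \<mu>. \<rho> \<xi> *\<^sub>R g \<xi> = \<rho>' \<xi> *\<^sub>R g' \<xi>"
      using fm_reps_common[OF u u'] by blast
    have i: "integrable \<nu> g" "integrable \<nu>' g'" using u u' by (auto simp: fm_rep_def)
    note a = fm_rep_density[OF m(1-4) i(1)[unfolded m(5)]]
      and b = fm_rep_density[OF m(1,2,6,7) i(2)[unfolded m(8)]]
    have "(\<integral>\<xi>. norm (\<rho> \<xi> *\<^sub>R g \<xi>) \<partial>\<mu>) = (\<integral>\<xi>. norm (\<rho>' \<xi> *\<^sub>R g' \<xi>) \<partial>\<mu>)"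
      by (rule integral_cong_AE) (use a(1) b(1) ae in \<open>auto simp del: norm_scaleR\<close>)
    then show ?thesis unfolding m(5,8) a(3) b(3) by simp
  qed
  then have "{integral\<^sup>L \<nu> (\<lambda>\<xi>. norm (h \<xi>)) | \<nu> h. fm_rep \<nu> h u} = {\<integral>\<xi>. norm (g \<xi>) \<partial>\<nu>}"
    using u by blast
  then show ?thesis by (simp add: fm_norm_def)
qed

text \<open>Multiplication by \<open>m \<xi>\<close> commutes with the scalar factors
  \<open>\<rho> \<xi>\<close> and \<open>\<rho>' \<xi>\<close>, so the representation picked by
  \<open>SOME\<close> gives the same function as any other.\<close>

lemma fm_mult_eq:
  assumes u: "fm_rep \<nu> g u" and m: "integrable \<nu> (\<lambda>\<xi>. cscale (m \<xi>) (g \<xi>))"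
  shows "fm_mult m u = fourier_meas \<nu> (\<lambda>\<xi>. cscale (m \<xi>) (g \<xi>))"
proof -
  define p where "p = (SOME p. fm_rep (fst p) (snd p) u \<and> integrable (fst p) (\<lambda>\<xi>. cscale (m \<xi>) (snd p \<xi>)))"
  obtain \<nu>' g' where p': "p = (\<nu>', g')" by (cases p)
  have "fm_rep (fst p) (snd p) u \<and> integrable (fst p) (\<lambda>\<xi>. cscale (m \<xi>) (snd p \<xi>))"
    unfolding p_def by (rule someI[of _ "(\<nu>, g)"]) (use u m in auto)
  then have u': "fm_rep \<nu>' g' u" and m': "integrable \<nu>' (\<lambda>\<xi>. cscale (m \<xi>) (g' \<xi>))" by (auto simp: p')
  obtain \<mu> \<rho> \<rho>' where r: "finite_measure \<mu>" "sets \<mu> = sets borel"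
    "\<rho> \<in> borel_measurable \<mu>" "\<And>x. 0 \<le> \<rho> x" "\<nu> = density \<mu> (\<lambda>x. ennreal (\<rho> x))"
    "\<rho>' \<in> borel_measurable \<mu>" "\<And>x. 0 \<le> \<rho>' x" "\<nu>' = density \<mu> (\<lambda>x. ennreal (\<rho>' x))"
    and ae: "AE \<xi> in \<mu>. \<rho> \<xi> *\<^sub>R g \<xi> = \<rho>' \<xi> *\<^sub>R g' \<xi>"
    using fm_reps_common[OF u u'] by blast
  note a = fm_rep_density[OF r(1-4) m[unfolded r(5)]]
    and b = fm_rep_density[OF r(1,2,6,7) m'[unfolded r(8)]]
  have "fourier_meas \<nu> (\<lambda>\<xi>. cscale (m \<xi>) (g \<xi>)) = fourier_meas \<nu>' (\<lambda>\<xi>. cscale (m \<xi>) (g' \<xi>))"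
    unfolding r(5,8) a(2) b(2)
  proof (rule fourier_meas_cong_AE[OF r(2) a(1) b(1)])
    show "AE \<xi> in \<mu>. \<rho> \<xi> *\<^sub>R cscale (m \<xi>) (g \<xi>) = \<rho>' \<xi> *\<^sub>R cscale (m \<xi>) (g' \<xi>)"
      using ae by eventually_elim (simp flip: bounded_bilinear.scaleR_right[OF bounded_bilinear_cscale])
  qed
  then show ?thesis unfolding fm_mult_def p_def[symmetric] p' by simp
qed

section \<open>The Helmholtz symbol and the solenoidal space\<close>

definition cvec :: "real^'n \<Rightarrow> complex^'n" where
  "cvec \<xi> = (\<chi> j. complex_of_real (\<xi> $ j))"

definition cdot :: "real^'n \<Rightarrow> complex^'n \<Rightarrow> complex" where
  "cdot \<xi> v = (\<Sum>j\<in>UNIV. complex_of_real (\<xi> $ j) * v $ j)"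

text \<open>The Helmholtz symbol, with the value 0 (not the identity) at the origin: then the measures of
  \<open>FM\<^sub>0\<^sub>,\<^sub>\<sigma>\<close> are exactly those whose density is fixed by \<open>Pr\<close>.\<close>
definition Pr :: "real^'n \<Rightarrow> complex^'n \<Rightarrow> complex^'n" where
  "Pr \<xi> v = (if \<xi> = 0 then 0 else v - cscale (cdot \<xi> v / of_real ((norm \<xi>)\<^sup>2)) (cvec \<xi>))"

lemma cdot_cvec: "cdot \<xi> (cvec \<xi>) = of_real ((norm \<xi>)\<^sup>2)"
  by (simp add: cdot_def cvec_def power2_norm_eq_inner inner_vec_def)

lemma norm_cvec [simp]: "norm (cvec \<xi>) = norm \<xi>"
  by (simp add: cvec_def norm_vec_def)

lemma cvec_eq_0_iff [simp]: "cvec \<xi> = 0 \<longleftrightarrow> \<xi> = 0"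
  using norm_cvec[of \<xi>] by (metis norm_eq_zero)

lemma cdot_simps: "cdot \<xi> (v + w) = cdot \<xi> v + cdot \<xi> w" "cdot \<xi> (v - w) = cdot \<xi> v - cdot \<xi> w"
  "cdot \<xi> (cscale c v) = c * cdot \<xi> v" "cdot \<xi> (r *\<^sub>R v) = r *\<^sub>R cdot \<xi> v" "cdot 0 v = 0" "cdot \<xi> 0 = 0"
proof -
  show "cdot \<xi> (r *\<^sub>R v) = r *\<^sub>R cdot \<xi> v" by (simp add: cdot_def scaleR_sum_right)
qed (simp_all add: cdot_def algebra_simps sum.distrib sum_subtractf sum_distrib_left)

lemma norm_cdot_le: "norm (cdot \<xi> v) \<le> norm \<xi> * norm v"
proof -
  have "norm (cdot \<xi> v) \<le> (\<Sum>j\<in>UNIV. \<bar>\<xi> $ j\<bar> * \<bar>norm (v $ j)\<bar>)"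
    unfolding cdot_def by (rule order_trans[OF norm_sum]) (simp add: norm_mult)
  also have "\<dots> \<le> L2_set (\<lambda>j. \<xi> $ j) UNIV * L2_set (\<lambda>j. norm (v $ j)) UNIV"
    by (rule L2_set_mult_ineq)
  finally show ?thesis by (simp add: norm_vec_def L2_set_def)
qed

lemma Pr_eq_iff: "Pr \<xi> v = v \<longleftrightarrow> (\<xi> = 0 \<longrightarrow> v = 0) \<and> cdot \<xi> v = 0"
proof (cases "\<xi> = 0")
  case False
  have "cscale (cdot \<xi> v / of_real ((norm \<xi>)\<^sup>2)) (cvec \<xi>) = 0 \<longleftrightarrow> cdot \<xi> v = 0"
    using False by simp
  then show ?thesis using False by (simp add: Pr_def)
qed (auto simp: Pr_def cdot_simps)

lemma Pr_Pr [simp]: "Pr \<xi> (Pr \<xi> v) = Pr \<xi> v"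
  by (subst Pr_eq_iff) (auto simp: Pr_def cdot_simps cdot_cvec)

lemma bounded_linear_Pr: "bounded_linear (Pr \<xi>)"
  and norm_Pr_le: "norm (Pr \<xi> v) \<le> 2 * norm v"
proof -
  \<comment> \<open>The triangle inequality yields 2 instead of the sharp constant 1 of an
    orthogonal projection. What counts is uniformity in \<open>\<xi>\<close>; the value enters later
    only through \<open>bM\<close>.\<close>
  have n: "norm (Pr \<xi> v) \<le> 2 * norm v" for v
  proof (cases "\<xi> = 0")
    case False
    have "norm (cscale (cdot \<xi> v / of_real ((norm \<xi>)\<^sup>2)) (cvec \<xi>)) = norm (cdot \<xi> v) / norm \<xi>"
      using False by (simp add: norm_divide norm_power) (simp add: power2_eq_square)
    also have "\<dots> \<le> norm v" using norm_cdot_le[of \<xi> v] False by (simp add: field_simps)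
    finally have "norm (cscale (cdot \<xi> v / of_real ((norm \<xi>)\<^sup>2)) (cvec \<xi>)) \<le> norm v" .
    then show ?thesis using False norm_triangle_ineq4[of v "cscale (cdot \<xi> v / of_real ((norm \<xi>)\<^sup>2)) (cvec \<xi>)"]
      by (simp add: Pr_def)
  qed (simp add: Pr_def)
  then show "norm (Pr \<xi> v) \<le> 2 * norm v" .
  show "bounded_linear (Pr \<xi>)"
  proof (rule bounded_linear_intro[where K = 2])
    show "norm (Pr \<xi> v) \<le> norm v * 2" for v using n[of v] by simp
    show "Pr \<xi> (r *\<^sub>R v) = r *\<^sub>R Pr \<xi> v" for r v
      by (simp add: Pr_def cdot_simps scaleR_right_diff_distrib flip: cscale_simps)
        (simp add: scaleR_conv_of_real)
    show "Pr \<xi> (v + w) = Pr \<xi> v + Pr \<xi> w" for v w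
      by (simp add: Pr_def cdot_simps cscale_simps add_divide_distrib)
  qed
qed

text \<open>On the common measure, wherever \<open>\<rho>'\<close> is positive, \<open>g'\<close> is
  a nonnegative multiple of \<open>g\<close>. A property that is invariant under positive scaling
  and true at 0 is therefore shared by all representations.\<close>

lemma fm_rep_AE_transfer:
  assumes u: "fm_rep \<nu> g u" and u': "fm_rep \<nu>' g' u"
    and Q: "\<And>\<xi> v c. c > 0 \<Longrightarrow> Q \<xi> (c *\<^sub>R v) \<longleftrightarrow> Q \<xi> v" "\<And>\<xi>. Q \<xi> 0"
    and g: "AE \<xi> in \<nu>. Q \<xi> (g \<xi>)"
  shows "AE \<xi> in \<nu>'. Q \<xi> (g' \<xi>)"
proof -
  obtain \<mu> \<rho> \<rho>' where r: "finite_measure \<mu>" "sets \<mu> = sets borel"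
    "\<rho> \<in> borel_measurable \<mu>" "\<And>x. 0 \<le> \<rho> x" "\<nu> = density \<mu> (\<lambda>x. ennreal (\<rho> x))"
    "\<rho>' \<in> borel_measurable \<mu>" "\<And>x. 0 \<le> \<rho>' x" "\<nu>' = density \<mu> (\<lambda>x. ennreal (\<rho>' x))"
    and ae: "AE \<xi> in \<mu>. \<rho> \<xi> *\<^sub>R g \<xi> = \<rho>' \<xi> *\<^sub>R g' \<xi>"
    using fm_reps_common[OF u u'] by blast
  from g[unfolded r(5)] have "AE \<xi> in \<mu>. \<rho> \<xi> > 0 \<longrightarrow> Q \<xi> (g \<xi>)"
    by (subst (asm) AE_density) (use r(3) in auto)
  with ae have "AE \<xi> in \<mu>. \<rho>' \<xi> > 0 \<longrightarrow> Q \<xi> (g' \<xi>)"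
  proof eventually_elim
    case (elim \<xi>)
    have "Q \<xi> (\<rho> \<xi> *\<^sub>R g \<xi>)"
      using elim(2) Q r(4)[of \<xi>] by (cases "\<rho> \<xi> = 0") (auto simp: less_le)
    then show ?case using elim(1) Q(1) by auto
  qed
  then show ?thesis unfolding r(8) by (subst AE_density) (use r(6) in auto)
qed

text \<open>Over the single point 0 the integral of the density is mass times one vector, so its
  vanishing says that the point is null or the vector is 0. This is the clause at the origin in
  \<open>Pr_eq_iff\<close>. Transfer between representations turns the existential definition into a
  test on whichever density is at hand.\<close>

lemma in_FM0s_iff:
  fixes u :: "real^'n \<Rightarrow> complex^'n"
  assumes u: "fm_rep \<nu> g u"
  shows "in_FM0s u \<longleftrightarrow> (AE \<xi> in \<nu>. Pr \<xi> (g \<xi>) = g \<xi>)"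
proof -
  have zero: "set_lebesgue_integral \<nu>' {0} g' = 0 \<longleftrightarrow> (AE \<xi> in \<nu>'. \<xi> = 0 \<longrightarrow> g' \<xi> = 0)"
    if u': "fm_rep \<nu>' g' u" for \<nu>' and g' :: "real^'n \<Rightarrow> complex^'n"
  proof -
    have s: "sets \<nu>' = sets borel" "finite_measure \<nu>'" using u' by (auto simp: fm_rep_def)
    interpret finite_measure \<nu>' by (rule s)
    have sp: "space \<nu>' = UNIV" using sets_eq_imp_space_eq[OF s(1)] by simp
    have m: "{0} \<in> sets \<nu>'" by (simp add: s)
    have "set_lebesgue_integral \<nu>' {0} g' = (\<integral>\<xi>. indicator {0} \<xi> *\<^sub>R g' 0 \<partial>\<nu>')"
      unfolding set_lebesgue_integral_def by (intro Bochner_Integration.integral_cong) (auto simp: indicator_def)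
    also have "\<dots> = measure \<nu>' {0} *\<^sub>R g' 0"
      using m has_bochner_integral_indicator[OF m, of "g' 0"]
      by (intro has_bochner_integral_integral_eq) (simp add: emeasure_eq_measure)
    finally have 1: "set_lebesgue_integral \<nu>' {0} g' = 0 \<longleftrightarrow> measure \<nu>' {0} = 0 \<or> g' 0 = 0" by simp
    have "(AE \<xi> in \<nu>'. \<xi> = 0 \<longrightarrow> g' \<xi> = 0) \<longleftrightarrow> measure \<nu>' {0} = 0 \<or> g' 0 = 0"
    proof (cases "g' 0 = 0")
      case False
      have "(AE \<xi> in \<nu>'. \<xi> = 0 \<longrightarrow> g' \<xi> = 0) \<longleftrightarrow> (AE \<xi> in \<nu>'. \<xi> \<notin> {0})"
        using False by (intro AE_cong) auto
      also have "\<dots> \<longleftrightarrow> {0} \<in> null_sets \<nu>'" using AE_iff_null_sets[OF m] by simp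
      also have "\<dots> \<longleftrightarrow> measure \<nu>' {0} = 0" using m by (auto simp: null_sets_def emeasure_eq_measure)
      finally show ?thesis using False by simp
    qed auto
    then show ?thesis using 1 by simp
  qed
  have *: "set_lebesgue_integral \<nu>' {0} g' = 0 \<and> (AE \<xi> in \<nu>'. (\<Sum>j\<in>UNIV. complex_of_real (\<xi> $ j) * (g' \<xi> $ j)) = 0)
     \<longleftrightarrow> (AE \<xi> in \<nu>'. Pr \<xi> (g' \<xi>) = g' \<xi>)"
    if u': "fm_rep \<nu>' g' u" for \<nu>' g'
    unfolding zero[OF u'] Pr_eq_iff by (simp add: cdot_def)
  show ?thesis
  proof
    assume "in_FM0s u"
    then obtain \<nu>' g' where u': "fm_rep \<nu>' g' u" and "AE \<xi> in \<nu>'. Pr \<xi> (g' \<xi>) = g' \<xi>"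
      unfolding in_FM0s_def using * by blast
    then show "AE \<xi> in \<nu>. Pr \<xi> (g \<xi>) = g \<xi>"
      by (intro fm_rep_AE_transfer[OF u' u, of "\<lambda>\<xi> v. Pr \<xi> v = v"]) (auto simp: Pr_eq_iff cdot_simps)
  next
    assume "AE \<xi> in \<nu>. Pr \<xi> (g \<xi>) = g \<xi>"
    then show "in_FM0s u" unfolding in_FM0s_def using u *[OF u] by blast
  qed
qed

text \<open>Countability of the family is what allows one finite measure; Radon-Nikodym factors are
  absorbed into the densities.\<close>

lemma in_FM_common:
  fixes u :: "nat \<Rightarrow> real^'n \<Rightarrow> complex^'m"
  assumes "\<And>i. in_FM (u i)"
  obtains \<mu> g where "finite_measure \<mu>" "sets \<mu> = sets borel" "\<And>i. fm_rep \<mu> (g i) (u i)"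
proof -
  obtain \<nu> h where r: "\<And>i. fm_rep (\<nu> i) (h i) (u i)" using assms unfolding in_FM_def by metis
  obtain \<mu> :: "(real^'n) measure" where \<mu>: "sets \<mu> = sets borel" "finite_measure \<mu>"
    "\<And>i. absolutely_continuous \<mu> (\<nu> i)"
    using countable_dominating_measure[of \<nu> borel] r by (auto simp: fm_rep_def)
  have "\<exists>g. fm_rep \<mu> g (u i)" for i
  proof -
    have n: "finite_measure (\<nu> i)" "sets (\<nu> i) = sets \<mu>" "integrable (\<nu> i) (h i)" "u i = fourier_meas (\<nu> i) (h i)"
      using r[of i] \<mu> by (auto simp: fm_rep_def)
    obtain \<rho> where \<rho>: "\<rho> \<in> borel_measurable \<mu>" "\<And>x. 0 \<le> \<rho> x" "\<nu> i = density \<mu> (\<lambda>x. ennreal (\<rho> x))"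
      using absolutely_continuous_real_density[OF \<mu>(2) n(1,2) \<mu>(3)] by blast
    note a = fm_rep_density[OF \<mu>(2,1) \<rho>(1,2) n(3)[unfolded \<rho>(3)]]
    show ?thesis
      using a n(4) \<mu> unfolding fm_rep_def \<rho>(3)[symmetric] by auto
  qed
  then show ?thesis using \<mu> that by metis
qed

section \<open>Bochner integrability and joint densities\<close>

text \<open>Completeness of Lebesgue measure: every subset of a null set is measurable. It gives
  measurability of functions such as \<open>nrm (u t)\<close>, where \<open>u t\<close> is
  identified only for almost every \<open>t\<close>.\<close>

lemma borel_measurable_lebesgue_on_AE_eq:
  fixes f g :: "real \<Rightarrow> 'b::topological_space"
  assumes g: "g \<in> borel_measurable (lebesgue_on S)" and S: "S \<in> sets lebesgue"
    and ae: "AE t in lebesgue_on S. f t = g t"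
  shows "f \<in> borel_measurable (lebesgue_on S)"
proof (rule measurableI)
  fix B :: "'b set" assume B: "B \<in> sets borel"
  have "AE t in lebesgue. \<not> (t \<in> S \<and> f t \<noteq> g t)"
    using ae S by (subst (asm) AE_restrict_space_iff) auto
  then have ae': "AE t in lborel. \<not> (t \<in> S \<and> f t \<noteq> g t)" by (simp add: AE_completion_iff)
  have "Measurable.pred lebesgue (\<lambda>t. t \<in> S \<and> f t \<noteq> g t)"
    by (rule sets_completion_AE[OF ae'])
  moreover have "Measurable.pred lebesgue (\<lambda>t. t \<in> S \<and> f t \<noteq> g t \<and> f t \<in> B)"
    by (rule sets_completion_AE) (use ae' in eventually_elim, auto)
  ultimately have s: "{t. t \<in> S \<and> f t \<noteq> g t} \<in> sets lebesgue" "{t. t \<in> S \<and> f t \<noteq> g t \<and> f t \<in> B} \<in> sets lebesgue"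
    by (simp_all add: pred_def)
  have "g -` B \<inter> S \<in> sets (lebesgue_on S)" using measurable_sets[OF g B] by simp
  then have "g -` B \<inter> S \<in> sets lebesgue" using S by (simp add: sets_restrict_space_iff)
  then have "(g -` B \<inter> S - {t. t \<in> S \<and> f t \<noteq> g t}) \<union> {t. t \<in> S \<and> f t \<noteq> g t \<and> f t \<in> B} \<in> sets lebesgue"
    using s by blast
  moreover have "(g -` B \<inter> S - {t. t \<in> S \<and> f t \<noteq> g t}) \<union> {t. t \<in> S \<and> f t \<noteq> g t \<and> f t \<in> B} = f -` B \<inter> S"
    by auto
  ultimately show "f -` B \<inter> space (lebesgue_on S) \<in> sets (lebesgue_on S)"
    using S by (simp add: sets_restrict_space_iff)
qed simp

text \<open>The Riesz-Fischer argument, with summable increments giving convergence almost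
  everywhere. The limit is an explicit pointwise \<open>lim\<close>, a form that stays jointly
  measurable when the sequence also depends on time; an abstract limit in \<open>L^1\<close> would
  give nothing of the kind.\<close>

lemma L1_fast_Cauchy_limit:
  fixes H :: "nat \<Rightarrow> 'a \<Rightarrow> 'b::{banach,second_countable_topology}"
  assumes H: "\<And>i. integrable M (H i)" and fast: "\<And>i. (\<integral>x. norm (H (Suc i) x - H i x) \<partial>M) \<le> (1/2)^i"
  shows "integrable M (\<lambda>x. lim (\<lambda>i. H i x))"
    and "(\<lambda>i. \<integral>x. norm (H i x - lim (\<lambda>i. H i x)) \<partial>M) \<longlonglongrightarrow> 0"
proof -
  note [measurable] = borel_measurable_integrable[OF H]
  define d where "d i x = norm (H (Suc i) x - H i x)" for i x
  have di: "integrable M (d i)" for i unfolding d_def using H by auto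
  have [measurable]: "d i \<in> borel_measurable M" for i using di by (rule borel_measurable_integrable)
  have d0: "0 \<le> d i x" for i x by (simp add: d_def)
  have sum2: "summable (\<lambda>i. (1/2::real)^i)" by (simp add: summable_geometric)
  have "(\<integral>\<^sup>+x. (\<Sum>i. ennreal (d i x)) \<partial>M) = (\<Sum>i. \<integral>\<^sup>+x. ennreal (d i x) \<partial>M)"
    by (intro nn_integral_suminf) simp
  also have "\<dots> = (\<Sum>i. ennreal (\<integral>x. d i x \<partial>M))"
    using di d0 by (simp add: nn_integral_eq_integral)
  also have "\<dots> \<le> (\<Sum>i. ennreal ((1/2)^i))"
    using fast by (intro suminf_le) (auto simp: d_def intro: ennreal_leI)
  also have "\<dots> < \<infinity>" using sum2 by (simp add: suminf_ennreal2)
  finally have "AE x in M. (\<Sum>i. ennreal (d i x)) \<noteq> \<infinity>"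
    by (intro nn_integral_PInf_AE) auto
  then have s: "AE x in M. summable (\<lambda>i. d i x)"
    by eventually_elim (auto intro!: summable_suminf_not_top d0)
  define w where "w x = norm (H 0 x) + (\<Sum>i. d i x)" for x
  have wi: "integrable M w"
    unfolding w_def
  proof (intro Bochner_Integration.integrable_add integrable_suminf integrable_norm H di)
    show "AE x in M. summable (\<lambda>i. norm (d i x))" using s d0 by simp
    show "summable (\<lambda>i. \<integral>x. norm (d i x) \<partial>M)"
      by (rule summable_comparison_test'[OF sum2, of 0]) (use fast in \<open>simp add: d_def\<close>)
  qed
  have conv: "AE x in M. H i x = H i x \<and> (\<lambda>i. H i x) \<longlonglongrightarrow> lim (\<lambda>i. H i x) \<and> (\<forall>i. norm (H i x) \<le> w x)" for i
    using s
  proof eventually_elim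
    case (elim x)
    have tel: "H n x = H 0 x + (\<Sum>i<n. H (Suc i) x - H i x)" for n
      using sum_lessThan_telescope[of "\<lambda>i. H i x" n] by simp
    have "summable (\<lambda>i. H (Suc i) x - H i x)"
      using elim unfolding d_def by (rule summable_norm_cancel)
    then have "convergent (\<lambda>n. \<Sum>i<n. H (Suc i) x - H i x)" by (simp add: summable_iff_convergent)
    then have "convergent (\<lambda>n. H 0 x + (\<Sum>i<n. H (Suc i) x - H i x))"
      by (intro convergent_add convergent_const)
    then have "(\<lambda>i. H i x) \<longlonglongrightarrow> lim (\<lambda>i. H i x)"
      by (simp add: convergent_LIMSEQ_iff flip: tel)
    moreover have "norm (H n x) \<le> w x" for n
    proof -
      have "norm (H n x) \<le> norm (H 0 x) + norm (\<Sum>i<n. H (Suc i) x - H i x)"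
        by (subst tel) (rule norm_triangle_ineq)
      also have "norm (\<Sum>i<n. H (Suc i) x - H i x) \<le> (\<Sum>i<n. d i x)"
        unfolding d_def by (rule norm_sum)
      also have "\<dots> \<le> (\<Sum>i. d i x)" using elim d0 by (intro sum_le_suminf) auto
      finally show ?thesis by (simp add: w_def)
    qed
    ultimately show ?case by simp
  qed
  have lw: "AE x in M. norm (lim (\<lambda>i. H i x)) \<le> w x"
    using conv[of 0]
  proof eventually_elim
    case (elim x)
    then have "(\<lambda>i. norm (H i x)) \<longlonglongrightarrow> norm (lim (\<lambda>i. H i x))" by (auto intro: tendsto_norm)
    then show ?case using elim by (intro LIMSEQ_le_const2) auto
  qed
  show "integrable M (\<lambda>x. lim (\<lambda>i. H i x))"
    by (rule Bochner_Integration.integrable_bound[OF wi]) (use lw in \<open>auto elim: eventually_mono\<close>)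
  have "(\<lambda>i. \<integral>x. norm (H i x - lim (\<lambda>i. H i x)) \<partial>M) \<longlonglongrightarrow> (\<integral>x. 0 \<partial>M)"
  proof (rule integral_dominated_convergence[where w = "\<lambda>x. 2 * w x"])
    show "AE x in M. (\<lambda>i. norm (H i x - lim (\<lambda>i. H i x))) \<longlonglongrightarrow> 0"
      using conv[of 0] by eventually_elim (auto simp: tendsto_norm_zero_iff intro: LIM_zero)
    show "AE x in M. norm (norm (H i x - lim (\<lambda>i. H i x))) \<le> 2 * w x" for i
      using conv[of i] lw
    proof eventually_elim
      case (elim x)
      then have "norm (H i x) \<le> w x" by blast
      with elim(2) norm_triangle_ineq4[of "H i x" "lim (\<lambda>i. H i x)"] show ?case by simp
    qed
  qed (use wi in auto)
  then show "(\<lambda>i. \<integral>x. norm (H i x - lim (\<lambda>i. H i x)) \<partial>M) \<longlonglongrightarrow> 0" by simp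
qed

text \<open>Over a common measure this is the triangle inequality in \<open>L^1\<close>. The second
  claim is boundedness of point evaluation, through which limits in \<open>FM\<close> are recognised
  pointwise.\<close>

lemma fm_norm_diff_le:
  fixes u v w :: "real^'n \<Rightarrow> complex^'m"
  assumes "in_FM u" "in_FM v" "in_FM w"
  shows "fm_norm (v - w) \<le> fm_norm (u - v) + fm_norm (u - w)"
    and "norm (u x - v x) \<le> fm_norm (u - v)"
proof -
  obtain \<mu> g where m: "finite_measure \<mu>" "sets \<mu> = sets borel"
    and r: "\<And>i. fm_rep \<mu> (g i) (if i = (0::nat) then u else if i = 1 then v else w)"
    by (rule in_FM_common[of "\<lambda>i::nat. if i = 0 then u else if i = 1 then v else w"]) (use assms in auto)
  have g: "integrable \<mu> (g i)" for i using r[of i] by (simp add: fm_rep_def)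
  have e: "u = fourier_meas \<mu> (g 0)" "v = fourier_meas \<mu> (g 1)" "w = fourier_meas \<mu> (g 2)"
    using r[of 0] r[of 1] r[of 2] by (auto simp: fm_rep_def)
  have d: "fm_rep \<mu> (\<lambda>\<xi>. g i \<xi> - g j \<xi>) (fourier_meas \<mu> (g i) - fourier_meas \<mu> (g j))" for i j
    using m g by (auto simp: fm_rep_def fun_eq_iff fourier_meas_diff)
  show "fm_norm (v - w) \<le> fm_norm (u - v) + fm_norm (u - w)"
    unfolding e fm_norm_eq[OF d]
  proof (subst Bochner_Integration.integral_add[symmetric])
    show "(\<integral>\<xi>. norm (g 1 \<xi> - g 2 \<xi>) \<partial>\<mu>) \<le> (\<integral>\<xi>. norm (g 0 \<xi> - g 1 \<xi>) + norm (g 0 \<xi> - g 2 \<xi>) \<partial>\<mu>)"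
      by (intro integral_mono) (use g norm_triangle_ineq4[of "g 0 \<xi> - g 2 \<xi>" "g 0 \<xi> - g 1 \<xi>" for \<xi>] in \<open>auto simp: add.commute\<close>)
  qed (use g in auto)
  show "norm (u x - v x) \<le> fm_norm (u - v)"
    unfolding e fm_norm_eq[OF d] using norm_fourier_meas_le[OF m(2), of "\<lambda>\<xi>. g 0 \<xi> - g 1 \<xi>" x] m g
    by (simp add: fourier_meas_diff)
qed

section \<open>From Bochner functions to joint densities\<close>

abbreviation Lon :: "real \<Rightarrow> real measure" where "Lon T \<equiv> lebesgue_on {0<..<T}"

lemma finite_measure_Lon: "finite_measure (Lon T)"
  by (rule finite_measure_lebesgue_on) simp

lemma AE_Lon: "(AE t in Lon T. P t) \<longleftrightarrow> (AE t in lebesgue. t \<in> {0<..<T} \<longrightarrow> P t)"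
  by (rule AE_restrict_space_iff) simp

lemma set_integrable_Lon:
  fixes f :: "real \<Rightarrow> 'b::{banach,second_countable_topology}"
  shows "set_integrable lebesgue {0<..<T} f \<longleftrightarrow> integrable (Lon T) f"
  unfolding set_integrable_def by (rule integrable_restrict_space[symmetric]) simp

lemma set_integral_Lon:
  fixes f :: "real \<Rightarrow> 'b::{banach,second_countable_topology}"
  shows "set_lebesgue_integral lebesgue {0<..<T} f = integral\<^sup>L (Lon T) f"
  unfolding set_lebesgue_integral_def by (rule integral_restrict_space[symmetric]) simp

text \<open>The Fubini form of \<open>L^1((0,T), L^1(\<nu>))\<close>. The representation is demanded
  for almost every time because \<open>L1_sp\<close> constrains the values only almost
  everywhere.\<close>

definition joint_rep ::
  "real \<Rightarrow> (real^'n) measure \<Rightarrow> (real \<Rightarrow> real^'n \<Rightarrow> complex^'m) \<Rightarrow> (real \<Rightarrow> real^'n \<Rightarrow> complex^'m) \<Rightarrow> bool" where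
  "joint_rep T \<nu> h f \<longleftrightarrow> integrable (Lon T \<Otimes>\<^sub>M \<nu>) (\<lambda>(t,\<xi>). h t \<xi>) \<and>
     (AE t in Lon T. fm_rep \<nu> (h t) (f t))"

text \<open>The approximants converge at almost every time, but with no rate uniform in time. A
  measurable, time dependent index selects a fast Cauchy subsequence at each such time; the
  densities then converge in \<open>L^1(\<nu>)\<close> and almost everywhere, and the pointwise
  limit is jointly measurable.\<close>

lemma joint_rep_of_simple_limit:
  fixes f :: "real \<Rightarrow> real^'n \<Rightarrow> complex^'m"
  assumes \<nu>: "finite_measure \<nu>" "sets \<nu> = sets borel"
    and s: "\<And>k. simple_function (Lon T) (s k)"
    and G: "\<And>k t. t \<in> {0<..<T} \<Longrightarrow> fm_rep \<nu> (G (s k t)) (s k t)"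
    and lim: "AE t in Lon T. (\<lambda>k::nat. fm_norm (f t - s k t)) \<longlonglongrightarrow> 0"
    and f: "AE t in Lon T. in_FM (f t)" "integrable (Lon T) (\<lambda>t. fm_norm (f t))"
  shows "\<exists>h. joint_rep T \<nu> h f"
proof -
  interpret L: finite_measure "Lon T" by (rule finite_measure_Lon)
  interpret N: finite_measure \<nu> by (rule \<nu>)
  interpret P: pair_sigma_finite "Lon T" \<nu> ..
  define D where "D k l t = fm_norm (s k t - s l t)" for k l t
  have [measurable]: "D k l \<in> borel_measurable (Lon T)" for k l
    unfolding D_def by (intro borel_measurable_simple_function simple_function_compose2[OF s s])
  \<comment> \<open>The Cauchy differences \<open>D\<close> between simple functions are measurable
    in time; distances to \<open>f t\<close> are not known to be.\<close>
  define N where "N i t = (LEAST N. \<forall>k\<ge>N. \<forall>l\<ge>N. D k l t \<le> (1/2)^i)" for i t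
  \<comment> \<open>Adding \<open>i\<close> forces the index to infinity even where
    \<open>N i t\<close> stays bounded.\<close>
  define m where "m i t = N i t + i" for i t
  have [measurable]: "Measurable.pred (Lon T) (\<lambda>t. \<forall>k\<ge>n. \<forall>l\<ge>n. D k l t \<le> (1/2)^i)" for n i
    by measurable
  have N_meas: "N i \<in> measurable (Lon T) (count_space UNIV)" for i
    unfolding N_def[abs_def] by (rule measurable_Least) measurable
  have mm: "m i \<in> measurable (Lon T) (count_space UNIV)" for i
    unfolding m_def[abs_def] by (rule measurable_compose[OF N_meas]) simp
  define H where "H i t \<xi> = G (s (m i t) t) \<xi>" for i t \<xi>
  \<comment> \<open>\<open>G\<close> is an arbitrary choice of densities; joint measurability holds
    because \<open>s k\<close> takes only finitely many values.\<close>
  have Gk: "(\<lambda>p. G (s k (fst p)) (snd p)) \<in> borel_measurable (Lon T \<Otimes>\<^sub>M \<nu>)" for k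
  proof (rule measurable_compose_countable'[where I = "s k ` {0<..<T}" and g = "\<lambda>p. s k (fst p)" and f = "\<lambda>y p. G y (snd p)"])
    show "countable (s k ` {0<..<T})" using simple_functionD(1)[OF s, of k] by (simp add: countable_finite)
    have "s k \<in> measurable (Lon T) (count_space (s k ` {0<..<T}))"
      using simple_functionD[OF s, of k] by (subst measurable_count_space_eq2) auto
    then show "(\<lambda>p. s k (fst p)) \<in> measurable (Lon T \<Otimes>\<^sub>M \<nu>) (count_space (s k ` {0<..<T}))"
      by (rule measurable_compose[OF measurable_fst])
    fix y assume "y \<in> s k ` {0<..<T}"
    then have "fm_rep \<nu> (G y) y" using G by blast
    then have "G y \<in> borel_measurable \<nu>" by (auto simp: fm_rep_def)
    then show "(\<lambda>p. G y (snd p)) \<in> borel_measurable (Lon T \<Otimes>\<^sub>M \<nu>)" by (rule measurable_compose[OF measurable_snd])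
  qed
  have [measurable]: "(\<lambda>p. H i (fst p) (snd p)) \<in> borel_measurable (Lon T \<Otimes>\<^sub>M \<nu>)" for i
    unfolding H_def
    by (rule measurable_compose_countable[OF Gk measurable_compose[OF measurable_fst mm]])
  define h where "h t \<xi> = lim (\<lambda>i. H i t \<xi>)" for t \<xi>
  have hm: "(\<lambda>p. h (fst p) (snd p)) \<in> borel_measurable (Lon T \<Otimes>\<^sub>M \<nu>)"
    unfolding h_def by measurable
  have pt: "AE t in Lon T. fm_rep \<nu> (h t) (f t)"
    using lim f(1) AE_space[of "Lon T"]
  proof eventually_elim
    case (elim t)
    have t: "t \<in> {0<..<T}" using elim(3) by simp
    have inF: "in_FM (s k t)" for k unfolding in_FM_def using G[OF t, of k] by blast
    have Dle: "D k l t \<le> fm_norm (f t - s k t) + fm_norm (f t - s l t)" for k l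
      unfolding D_def by (rule fm_norm_diff_le[OF elim(2) inF inF])
    have ex: "\<exists>N. \<forall>k\<ge>N. \<forall>l\<ge>N. D k l t \<le> (1/2)^i" for i
    proof -
      have "eventually (\<lambda>k. fm_norm (f t - s k t) < (1/2)^i / 2) sequentially"
        by (rule order_tendstoD(2)[OF elim(1)]) simp
      then obtain N where N: "\<And>k. k \<ge> N \<Longrightarrow> fm_norm (f t - s k t) < (1/2)^i / 2" by (auto simp: eventually_sequentially)
      have "D k l t \<le> (1/2)^i" if "k \<ge> N" "l \<ge> N" for k l
        using N[OF that(1)] N[OF that(2)] Dle[of k l] by simp
      then show ?thesis by blast
    qed
    have Nall: "\<forall>k\<ge>N i t. \<forall>l\<ge>N i t. D k l t \<le> (1/2)^i" for i
      unfolding N_def by (rule LeastI_ex[OF ex[of i]])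
    then have Nprop: "D k l t \<le> (1/2)^i" if "k \<ge> N i t" "l \<ge> N i t" for i k l
      using that by simp
    have Nmono: "N i t \<le> N (Suc i) t" for i
    proof -
      have "(1/2::real)^Suc i \<le> (1/2)^i" by (rule power_decreasing) auto
      then have *: "\<forall>k\<ge>N (Suc i) t. \<forall>l\<ge>N (Suc i) t. D k l t \<le> (1/2)^i"
        using Nprop[where i = "Suc i"] by (intro allI impI) (rule order_trans)
      show ?thesis
        unfolding N_def[of i]
        by (rule Least_le[where P = "\<lambda>N. \<forall>k\<ge>N. \<forall>l\<ge>N. D k l t \<le> (1/2)^i", OF *])
    qed
    have Hr: "fm_rep \<nu> (H i t) (s (m i t) t)" for i
      unfolding H_def[abs_def] by (rule G[OF t])
    have Hi: "integrable \<nu> (H i t)" for i using Hr[of i] unfolding fm_rep_def by (elim conjE)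
    have Hf: "s (m i t) t = fourier_meas \<nu> (H i t)" for i using Hr[of i] unfolding fm_rep_def by (elim conjE)
    have "(\<integral>\<xi>. norm (H (Suc i) t \<xi> - H i t \<xi>) \<partial>\<nu>) \<le> (1/2)^i" for i
    proof -
      have "fm_rep \<nu> (\<lambda>\<xi>. H (Suc i) t \<xi> - H i t \<xi>) (s (m (Suc i) t) t - s (m i t) t)"
        unfolding fm_rep_def
      proof (intro conjI \<nu> Bochner_Integration.integrable_diff Hi)
        show "s (m (Suc i) t) t - s (m i t) t = fourier_meas \<nu> (\<lambda>\<xi>. H (Suc i) t \<xi> - H i t \<xi>)"
          by (rule ext) (simp only: fun_diff_def Hf fourier_meas_diff[OF \<nu>(2) Hi Hi])
      qed
      then have "(\<integral>\<xi>. norm (H (Suc i) t \<xi> - H i t \<xi>) \<partial>\<nu>) = D (m (Suc i) t) (m i t) t"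
        unfolding D_def by (simp add: fm_norm_eq)
      also have "\<dots> \<le> (1/2)^i" using Nmono[of i] by (intro Nprop) (auto simp: m_def)
      finally show ?thesis .
    qed
    note lims = L1_fast_Cauchy_limit[of \<nu> "\<lambda>i. H i t", OF Hi this, folded h_def]
    have "f t = fourier_meas \<nu> (h t)"
    proof
      fix x
      have m_top: "filterlim (\<lambda>i. m i t) at_top sequentially"
        by (rule filterlim_at_top_mono[OF filterlim_ident]) (simp add: m_def)
      have "(\<lambda>i. norm (s (m i t) t x - f t x)) \<longlonglongrightarrow> 0"
      proof (rule tendsto_sandwich[OF _ _ tendsto_const])
        show "(\<lambda>i. fm_norm (f t - s (m i t) t)) \<longlonglongrightarrow> 0"
          by (rule filterlim_compose[OF elim(1) m_top])
      qed (use fm_norm_diff_le(2)[OF elim(2) inF inF] in \<open>auto simp: norm_minus_commute\<close>)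
      then have 1: "(\<lambda>i. s (m i t) t x) \<longlonglongrightarrow> f t x"
        by (simp add: tendsto_norm_zero_iff LIM_zero_iff)
      have "(\<lambda>i. norm (s (m i t) t x - fourier_meas \<nu> (h t) x)) \<longlonglongrightarrow> 0"
      proof (rule tendsto_sandwich[OF _ _ tendsto_const lims(2)])
        have "norm (s (m i t) t x - fourier_meas \<nu> (h t) x) \<le> (\<integral>\<xi>. norm (H i t \<xi> - h t \<xi>) \<partial>\<nu>)" for i
          using norm_fourier_meas_le[OF \<nu>(2), of "\<lambda>\<xi>. H i t \<xi> - h t \<xi>" x] Hi lims(1)
          by (simp add: fourier_meas_diff[OF \<nu>(2)] Hf)
        then show "\<forall>\<^sub>F i in sequentially. norm (s (m i t) t x - fourier_meas \<nu> (h t) x) \<le> (\<integral>\<xi>. norm (H i t \<xi> - h t \<xi>) \<partial>\<nu>)" by simp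
      qed simp
      then have 2: "(\<lambda>i. s (m i t) t x) \<longlonglongrightarrow> fourier_meas \<nu> (h t) x"
        by (simp add: tendsto_norm_zero_iff LIM_zero_iff)
      show "f t x = fourier_meas \<nu> (h t) x" by (rule LIMSEQ_unique[OF 1 2])
    qed
    then show ?case using lims(1) \<nu> by (simp add: fm_rep_def)
  qed
  have "integrable (Lon T \<Otimes>\<^sub>M \<nu>) (\<lambda>p. h (fst p) (snd p))"
  proof (rule P.Fubini_integrable[OF hm])
    show "AE t in Lon T. integrable \<nu> (\<lambda>\<xi>. h (fst (t, \<xi>)) (snd (t, \<xi>)))"
      using pt by eventually_elim (simp add: fm_rep_def)
    have "(\<lambda>t. \<integral>\<xi>. norm (h (fst (t, \<xi>)) (snd (t, \<xi>))) \<partial>\<nu>) \<in> borel_measurable (Lon T)"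
      using hm by measurable
    moreover have "AE t in Lon T. fm_norm (f t) = (\<integral>\<xi>. norm (h (fst (t, \<xi>)) (snd (t, \<xi>))) \<partial>\<nu>)"
      using pt by eventually_elim (drule fm_norm_eq, simp)
    ultimately show "integrable (Lon T) (\<lambda>t. \<integral>\<xi>. norm (h (fst (t, \<xi>)) (snd (t, \<xi>))) \<partial>\<nu>)"
      by (rule integrable_cong_AE_imp[OF f(2)])
  qed
  then show ?thesis using pt unfolding joint_rep_def case_prod_beta by blast
qed

text \<open>The values of all simple approximants of all the given functions form a countable set,
  and the measure is built for that set. Densities are chosen through an enumeration of the set, so
  they depend on the value \<open>s i k t\<close> alone.\<close>

lemma joint_rep_exists:
  fixes f :: "nat \<Rightarrow> real \<Rightarrow> real^'n \<Rightarrow> complex^'m"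
  assumes f: "\<And>i. L1_sp in_FM fm_norm T (f i)"
  obtains \<nu> h where "finite_measure \<nu>" "sets \<nu> = sets borel" "\<And>i. joint_rep T \<nu> (h i) (f i)"
proof -
  have "\<exists>s::nat \<Rightarrow> real \<Rightarrow> real^'n \<Rightarrow> complex^'m. \<forall>k. simple_function (Lon T) (s k) \<and> (\<forall>t\<in>{0<..<T}. in_FM (s k t)) \<and>
      (AE t in Lon T. (\<lambda>k. fm_norm (f i t - s k t)) \<longlonglongrightarrow> 0)" for i
  proof -
    obtain s where s: "\<And>k. finite (s k ` {0<..<T}) \<and> (\<forall>t\<in>{0<..<T}. in_FM (s k t)) \<and> (\<forall>y. {t\<in>{0<..<T}. s k t = y} \<in> sets lebesgue)"
      "AE t in lebesgue. t \<in> {0<..<T} \<longrightarrow> (\<lambda>k::nat. fm_norm (f i t - s k t)) \<longlonglongrightarrow> 0"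
      using f[of i, unfolded L1_sp_def, THEN conjunct1] by (elim exE conjE) (rule that, simp_all)
    have "s k -` {y} \<inter> {0<..<T} = {t\<in>{0<..<T}. s k t = y}" for k y by auto
    then have "s k -` {y} \<inter> {0<..<T} \<in> sets (Lon T)" for k y
      using s(1)[of k] by (subst sets_restrict_space_iff) auto
    then have "simple_function (Lon T) (s k)" for k
      using s(1)[of k] by (simp add: simple_function_def)
    then show ?thesis using s by (intro exI[of _ s]) (simp add: AE_Lon)
  qed
  from choice[OF allI[OF this]] obtain s :: "nat \<Rightarrow> nat \<Rightarrow> real \<Rightarrow> real^'n \<Rightarrow> complex^'m" where
    s0: "\<forall>i. \<forall>k. simple_function (Lon T) (s i k) \<and> (\<forall>t\<in>{0<..<T}. in_FM (s i k t)) \<and>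
      (AE t in Lon T. (\<lambda>k. fm_norm (f i t - s i k t)) \<longlonglongrightarrow> 0)" ..
  have s: "\<And>i k. simple_function (Lon T) (s i k)" "\<And>i k t. t \<in> {0<..<T} \<Longrightarrow> in_FM (s i k t)"
      "\<And>i. AE t in Lon T. (\<lambda>k. fm_norm (f i t - s i k t)) \<longlonglongrightarrow> 0"
    using s0 by simp_all
  have zero: "in_FM (\<lambda>_::real^'n. 0 :: complex^'m)"
  proof -
    have "fm_rep (null_measure borel) (\<lambda>_. 0) (\<lambda>_::real^'n. 0 :: complex^'m)"
      by (simp add: fm_rep_def fourier_meas_def vec_eq_iff fun_eq_iff finite_measureI)
    then show ?thesis unfolding in_FM_def by blast
  qed
  \<comment> \<open>The zero function keeps the set nonempty even if the time interval is
    empty.\<close>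
  define Y where "Y = insert (\<lambda>_. 0) (\<Union>i k. s i k ` {0<..<T})"
  have "countable (s i k ` {0<..<T})" for i k
    using simple_functionD(1)[OF s(1), of i k] by (simp add: countable_finite)
  then have Y: "countable Y" unfolding Y_def
    by (intro countable_insert countable_UN countableI_type)
  have Yne: "Y \<noteq> {}" by (auto simp: Y_def)
  have YF: "in_FM y" if "y \<in> Y" for y
    using that unfolding Y_def by (elim insertE UN_E imageE) (simp_all add: zero s(2))
  have "in_FM (from_nat_into Y n)" for n using from_nat_into[OF Yne] YF by blast
  then obtain \<nu> g where \<nu>: "finite_measure \<nu>" "sets \<nu> = sets borel" and g: "\<And>n. fm_rep \<nu> (g n) (from_nat_into Y n)"
    using in_FM_common[of "from_nat_into Y"] by blast
  have *: "fm_rep \<nu> (g (to_nat_on Y y)) y" if "y \<in> Y" for y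
    using g[of "to_nat_on Y y"] that Y by simp
  have G: "fm_rep \<nu> (g (to_nat_on Y (s i k t))) (s i k t)" if "t \<in> {0<..<T}" for i k t
  proof (rule *)
    have "s i k t \<in> s i k ` {0<..<T}" using that by (rule imageI)
    then show "s i k t \<in> Y" unfolding Y_def by blast
  qed
  have "\<exists>h. joint_rep T \<nu> h (f i)" for i
  proof (rule joint_rep_of_simple_limit[OF \<nu> s(1)[of i] G s(3)])
    show "AE t in Lon T. in_FM (f i t)" "integrable (Lon T) (\<lambda>t. fm_norm (f i t))"
      using f[of i] by (auto simp: L1_sp_def AE_Lon set_integrable_Lon)
  qed
  then have "\<forall>i. \<exists>h. joint_rep T \<nu> h (f i)" ..
  from choice[OF this] show ?thesis using that[OF \<nu>] by blast
qed

section \<open>From joint densities back to Bochner functions: approximation by functions simple in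
  time\<close>

definition step_approximable ::
  "'a measure \<Rightarrow> 'b measure \<Rightarrow> ('a \<times> 'b \<Rightarrow> 'c::{banach,second_countable_topology}) \<Rightarrow> bool" where
  "step_approximable L N h \<longleftrightarrow> integrable (L \<Otimes>\<^sub>M N) h \<and>
    (\<forall>e>0. \<exists>s. simple_function L s \<and> (\<forall>t\<in>space L. integrable N (s t)) \<and>
       integrable (L \<Otimes>\<^sub>M N) (\<lambda>p. s (fst p) (snd p)) \<and>
       (\<integral>p. norm (h p - s (fst p) (snd p)) \<partial>(L \<Otimes>\<^sub>M N)) < e)"

lemma step_approximable_limit:
  assumes h: "integrable (L \<Otimes>\<^sub>M N) h"
    and "\<And>e. e > 0 \<Longrightarrow> \<exists>g. step_approximable L N g \<and> (\<integral>p. norm (h p - g p) \<partial>(L \<Otimes>\<^sub>M N)) < e"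
  shows "step_approximable L N h"
  unfolding step_approximable_def
proof (intro conjI h allI impI)
  fix e :: real assume "e > 0"
  then obtain g where g: "step_approximable L N g" "(\<integral>p. norm (h p - g p) \<partial>(L \<Otimes>\<^sub>M N)) < e / 2"
    using assms(2)[of "e/2"] by auto
  then obtain s where s: "simple_function L s" "\<forall>t\<in>space L. integrable N (s t)"
      "integrable (L \<Otimes>\<^sub>M N) (\<lambda>p. s (fst p) (snd p))"
      "(\<integral>p. norm (g p - s (fst p) (snd p)) \<partial>(L \<Otimes>\<^sub>M N)) < e / 2"
    using \<open>e > 0\<close> unfolding step_approximable_def by (meson half_gt_zero)
  have gi: "integrable (L \<Otimes>\<^sub>M N) g" using g(1) by (simp add: step_approximable_def)
  have "(\<integral>p. norm (h p - s (fst p) (snd p)) \<partial>(L \<Otimes>\<^sub>M N))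
      \<le> (\<integral>p. norm (h p - g p) + norm (g p - s (fst p) (snd p)) \<partial>(L \<Otimes>\<^sub>M N))"
    using h gi s(3) norm_triangle_ineq[of "h p - g p" "g p - s (fst p) (snd p)" for p]
    by (intro integral_mono) auto
  also have "\<dots> = (\<integral>p. norm (h p - g p) \<partial>(L \<Otimes>\<^sub>M N)) + (\<integral>p. norm (g p - s (fst p) (snd p)) \<partial>(L \<Otimes>\<^sub>M N))"
    using h gi s(3) by (intro Bochner_Integration.integral_add) auto
  also have "\<dots> < e" using g(2) s(4) by simp
  finally show "\<exists>s. simple_function L s \<and> (\<forall>t\<in>space L. integrable N (s t)) \<and>
       integrable (L \<Otimes>\<^sub>M N) (\<lambda>p. s (fst p) (snd p)) \<and>
       (\<integral>p. norm (h p - s (fst p) (snd p)) \<partial>(L \<Otimes>\<^sub>M N)) < e"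
    using s by blast
qed

lemma step_approximable_add:
  assumes f: "step_approximable L N f" and g: "step_approximable L N g"
  shows "step_approximable L N (\<lambda>p. f p + g p)"
  unfolding step_approximable_def
proof (intro conjI allI impI)
  have fi: "integrable (L \<Otimes>\<^sub>M N) f" and gi: "integrable (L \<Otimes>\<^sub>M N) g"
    using f g by (simp_all add: step_approximable_def)
  then show "integrable (L \<Otimes>\<^sub>M N) (\<lambda>p. f p + g p)" by simp
  fix e :: real assume "e > 0"
  then have e2: "e / 2 > 0" by simp
  obtain s where s: "simple_function L s" "\<forall>t\<in>space L. integrable N (s t)"
      "integrable (L \<Otimes>\<^sub>M N) (\<lambda>p. s (fst p) (snd p))"
      "(\<integral>p. norm (f p - s (fst p) (snd p)) \<partial>(L \<Otimes>\<^sub>M N)) < e / 2"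
    using f e2 unfolding step_approximable_def by meson
  obtain r where r: "simple_function L r" "\<forall>t\<in>space L. integrable N (r t)"
      "integrable (L \<Otimes>\<^sub>M N) (\<lambda>p. r (fst p) (snd p))"
      "(\<integral>p. norm (g p - r (fst p) (snd p)) \<partial>(L \<Otimes>\<^sub>M N)) < e / 2"
    using g e2 unfolding step_approximable_def by meson
  have sr: "simple_function L (\<lambda>t \<xi>. s t \<xi> + r t \<xi>)"
    by (rule simple_function_compose2[OF s(1) r(1)])
  have "(\<integral>p. norm (f p + g p - (s (fst p) (snd p) + r (fst p) (snd p))) \<partial>(L \<Otimes>\<^sub>M N))
      \<le> (\<integral>p. norm (f p - s (fst p) (snd p)) + norm (g p - r (fst p) (snd p)) \<partial>(L \<Otimes>\<^sub>M N))"
    using fi gi s(3) r(3) norm_triangle_ineq[of "f p - s (fst p) (snd p)" "g p - r (fst p) (snd p)" for p]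
    by (intro integral_mono) (auto simp: algebra_simps)
  also have "\<dots> = (\<integral>p. norm (f p - s (fst p) (snd p)) \<partial>(L \<Otimes>\<^sub>M N)) + (\<integral>p. norm (g p - r (fst p) (snd p)) \<partial>(L \<Otimes>\<^sub>M N))"
    using fi gi s(3) r(3) by (intro Bochner_Integration.integral_add) auto
  also have "\<dots> < e" using s(4) r(4) by simp
  finally have lt: "(\<integral>p. norm (f p + g p - (s (fst p) (snd p) + r (fst p) (snd p))) \<partial>(L \<Otimes>\<^sub>M N)) < e" .
  show "\<exists>s. simple_function L s \<and> (\<forall>t\<in>space L. integrable N (s t)) \<and>
       integrable (L \<Otimes>\<^sub>M N) (\<lambda>p. s (fst p) (snd p)) \<and>
       (\<integral>p. norm (f p + g p - s (fst p) (snd p)) \<partial>(L \<Otimes>\<^sub>M N)) < e"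
    by (rule exI[of _ "\<lambda>t \<xi>. s t \<xi> + r t \<xi>"]) (use sr lt s(2,3) r(2,3) in simp)
qed

text \<open>Rectangles are simple in time already, and the sets with this property form a Dynkin
  system. Complements are obtained by adding an approximation with the vector \<open>- c\<close>,
  which is why the induction quantifies over all vectors.\<close>

lemma step_approximable_indicator:
  fixes c :: "'c::{banach,second_countable_topology}"
  assumes L: "finite_measure L" and N: "finite_measure N" and A: "A \<in> sets (L \<Otimes>\<^sub>M N)"
  shows "step_approximable L N (\<lambda>p. indicator A p *\<^sub>R c)"
proof -
  interpret L: finite_measure L by fact
  interpret N: finite_measure N by fact
  interpret P: pair_sigma_finite L N ..
  interpret LN: finite_measure "L \<Otimes>\<^sub>M N"
    by (rule finite_measure_pair_measure[OF N L])
  define G where "G = {a \<times> b | a b. a \<in> sets L \<and> b \<in> sets N}"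
  have int: "integrable (L \<Otimes>\<^sub>M N) (\<lambda>p. indicator B p *\<^sub>R c)" if "B \<in> sets (L \<Otimes>\<^sub>M N)" for B and c :: 'c
    using that by (intro integrable_indicator) (auto simp: LN.emeasure_eq_measure)
  have rect: "step_approximable L N (\<lambda>p. indicator (a \<times> b) p *\<^sub>R c)" if ab: "a \<in> sets L" "b \<in> sets N" for a b and c :: 'c
    unfolding step_approximable_def
  proof (intro conjI allI impI)
    have AB: "a \<times> b \<in> sets (L \<Otimes>\<^sub>M N)" using ab by simp
    show "integrable (L \<Otimes>\<^sub>M N) (\<lambda>p. indicator (a \<times> b) p *\<^sub>R c)" by (rule int[OF AB])
    fix e :: real assume "e > 0"
    define s where "s t \<xi> = (indicator a t * indicator b \<xi> :: real) *\<^sub>R c" for t \<xi>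
    have eq: "s (fst p) (snd p) = indicator (a \<times> b) p *\<^sub>R c" for p
      by (cases p) (simp add: s_def indicator_times)
    have "simple_function L (\<lambda>t. indicator a t :: real)" using ab by simp
    then have "simple_function L (\<lambda>t. (\<lambda>r \<xi>. (r * indicator b \<xi>) *\<^sub>R c) (indicator a t :: real))"
      by (rule simple_function_compose1)
    then have "simple_function L s" unfolding s_def[abs_def] .
    moreover have "integrable N (s t)" for t
      unfolding s_def[abs_def] using ab(2)
      by (simp flip: scaleR_scaleR add: N.emeasure_eq_measure)
    ultimately show "\<exists>s. simple_function L s \<and> (\<forall>t\<in>space L. integrable N (s t)) \<and>
       integrable (L \<Otimes>\<^sub>M N) (\<lambda>p. s (fst p) (snd p)) \<and>
       (\<integral>p. norm (indicator (a \<times> b) p *\<^sub>R c - s (fst p) (snd p)) \<partial>(L \<Otimes>\<^sub>M N)) < e"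
      by (intro exI[of _ s]) (use int[OF AB] \<open>e > 0\<close> in \<open>simp add: eq\<close>)
  qed
  have AG: "A \<in> sigma_sets (space L \<times> space N) G"
    using A unfolding sets_pair_measure G_def .
  have Gi: "Int_stable G" unfolding G_def by (rule Int_stable_pair_measure_generator)
  have Gp: "G \<subseteq> Pow (space L \<times> space N)"
    unfolding G_def by (rule pair_measure_closed)
  from Gi Gp AG have "\<forall>c::'c. step_approximable L N (\<lambda>p. indicator A p *\<^sub>R c)"
  proof (induct rule: sigma_sets_induct_disjoint)
    case (basic A)
    then obtain a b where "A = a \<times> b" "a \<in> sets L" "b \<in> sets N" unfolding G_def by blast
    then show ?case using rect by simp
  next
    case empty
    have "step_approximable L N (\<lambda>p. indicator ({} \<times> {}) p *\<^sub>R c)" for c :: 'c by (rule rect) auto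
    then show ?case by simp
  next
    case (compl A)
    show ?case
    proof
      fix c :: 'c
      have "step_approximable L N (\<lambda>p. indicator (space L \<times> space N) p *\<^sub>R c + indicator A p *\<^sub>R (- c))"
        by (intro step_approximable_add rect compl(2)[rule_format]) auto
      moreover have "A \<subseteq> space L \<times> space N"
        by (rule sigma_sets_into_sp[OF Gp compl(1)])
      then have "indicator (space L \<times> space N) p *\<^sub>R c + indicator A p *\<^sub>R (- c) = indicator (space L \<times> space N - A) p *\<^sub>R c" for p
        unfolding indicator_def by (cases "p \<in> A"; cases "p \<in> space L \<times> space N") auto
      ultimately show "step_approximable L N (\<lambda>p. indicator (space L \<times> space N - A) p *\<^sub>R c)" by simp
    qed
  next
    case (union A)
    have As: "A i \<in> sets (L \<Otimes>\<^sub>M N)" for i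
      using union(2) unfolding sets_pair_measure G_def by blast
    show ?case
    proof
      fix c :: 'c
      have fin: "step_approximable L N (\<lambda>p. indicator (\<Union>i<n. A i) p *\<^sub>R c)" for n
      proof (induction n)
        case 0
        have "step_approximable L N (\<lambda>p. indicator ({} \<times> {}) p *\<^sub>R c)" by (rule rect) auto
        then show ?case by simp
      next
        case (Suc n)
        have "(\<Union>i<n. A i) \<inter> A n = {}"
          using union(1) by (auto simp: disjoint_family_on_def) (metis IntI emptyE less_irrefl)
        then have "indicator (\<Union>i<Suc n. A i) p *\<^sub>R c = indicator (\<Union>i<n. A i) p *\<^sub>R c + indicator (A n) p *\<^sub>R c" for p
          by (auto simp: indicator_def lessThan_Suc)
        then show ?case using step_approximable_add[OF Suc union(3)[rule_format, of n c]] by simp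
      qed
      have "(\<lambda>n. \<integral>p. norm (indicator (\<Union>i. A i) p *\<^sub>R c - indicator (\<Union>i<n. A i) p *\<^sub>R c) \<partial>(L \<Otimes>\<^sub>M N)) \<longlonglongrightarrow> (\<integral>p. 0 \<partial>(L \<Otimes>\<^sub>M N))"
      proof (rule integral_dominated_convergence[where w = "\<lambda>_. norm c"])
        show "AE p in L \<Otimes>\<^sub>M N. (\<lambda>n. norm (indicator (\<Union>i. A i) p *\<^sub>R c - indicator (\<Union>i<n. A i) p *\<^sub>R c)) \<longlonglongrightarrow> 0"
          using LIMSEQ_indicator_UN[of A, where 'a = real]
          by (intro AE_I2 tendsto_eq_intros) (auto intro!: tendsto_eq_intros)
        show "AE p in L \<Otimes>\<^sub>M N. norm (norm (indicator (\<Union>i. A i) p *\<^sub>R c - indicator (\<Union>i<n. A i) p *\<^sub>R c)) \<le> norm c" for n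
          by (intro AE_I2) (auto simp: indicator_def)
        show "(\<lambda>p. norm (indicator (\<Union>i. A i) p *\<^sub>R c - indicator (\<Union>i<n. A i) p *\<^sub>R c)) \<in> borel_measurable (L \<Otimes>\<^sub>M N)" for n
          using As by measurable
      qed auto
      then have lim: "(\<lambda>n. \<integral>p. norm (indicator (\<Union>i. A i) p *\<^sub>R c - indicator (\<Union>i<n. A i) p *\<^sub>R c) \<partial>(L \<Otimes>\<^sub>M N)) \<longlonglongrightarrow> 0" by simp
      show "step_approximable L N (\<lambda>p. indicator (\<Union>i. A i) p *\<^sub>R c)"
      proof (rule step_approximable_limit)
        show "integrable (L \<Otimes>\<^sub>M N) (\<lambda>p. indicator (\<Union>i. A i) p *\<^sub>R c)" using As by (intro int) auto
        fix e :: real assume "e > 0"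
        then have "eventually (\<lambda>n. (\<integral>p. norm (indicator (\<Union>i. A i) p *\<^sub>R c - indicator (\<Union>i<n. A i) p *\<^sub>R c) \<partial>(L \<Otimes>\<^sub>M N)) < e) sequentially"
          by (rule order_tendstoD(2)[OF lim])
        then obtain n where "(\<integral>p. norm (indicator (\<Union>i. A i) p *\<^sub>R c - indicator (\<Union>i<n. A i) p *\<^sub>R c) \<partial>(L \<Otimes>\<^sub>M N)) < e"
          by (auto simp: eventually_sequentially)
        then show "\<exists>g. step_approximable L N g \<and> (\<integral>p. norm (indicator (\<Union>i. A i) p *\<^sub>R c - g p) \<partial>(L \<Otimes>\<^sub>M N)) < e"
          by (intro exI[of _ "\<lambda>p. indicator (\<Union>i<n. A i) p *\<^sub>R c"] conjI fin)
      qed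
    qed
  qed
  then show ?thesis ..
qed

lemma step_approximable_integrable:
  assumes L: "finite_measure L" and N: "finite_measure N" and h: "integrable (L \<Otimes>\<^sub>M N) h"
  shows "step_approximable L N h"
  using h
proof (induct rule: integrable_induct)
  case (base A c)
  then show ?case by (intro step_approximable_indicator L N)
next
  case (add f g)
  then show ?case by (intro step_approximable_add)
next
  case (lim f s)
  note [measurable] = borel_measurable_integrable[OF lim(5)] borel_measurable_integrable[OF lim(1)]
  have "(\<lambda>i. \<integral>p. norm (f p - s i p) \<partial>(L \<Otimes>\<^sub>M N)) \<longlonglongrightarrow> (\<integral>p. 0 \<partial>(L \<Otimes>\<^sub>M N))"
  proof (rule integral_dominated_convergence[where w = "\<lambda>p. 3 * norm (f p)"])
    show "AE p in L \<Otimes>\<^sub>M N. (\<lambda>i. norm (f p - s i p)) \<longlonglongrightarrow> 0"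
    proof (rule AE_I2)
      fix p assume "p \<in> space (L \<Otimes>\<^sub>M N)"
      from lim(3)[OF this] have "(\<lambda>i. norm (f p - s i p)) \<longlonglongrightarrow> norm (f p - f p)"
        by (intro tendsto_norm tendsto_diff tendsto_const)
      then show "(\<lambda>i. norm (f p - s i p)) \<longlonglongrightarrow> 0" by simp
    qed
    show "AE p in L \<Otimes>\<^sub>M N. norm (norm (f p - s i p)) \<le> 3 * norm (f p)" for i
    proof (rule AE_I2)
      fix p assume "p \<in> space (L \<Otimes>\<^sub>M N)"
      from lim(4)[OF this, of i] norm_triangle_ineq4[of "f p" "s i p"]
      show "norm (norm (f p - s i p)) \<le> 3 * norm (f p)" by simp
    qed
  qed (use lim(5) in auto)
  then have l: "(\<lambda>i. \<integral>p. norm (f p - s i p) \<partial>(L \<Otimes>\<^sub>M N)) \<longlonglongrightarrow> 0" by simp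
  show ?case
  proof (rule step_approximable_limit[OF lim(5)])
    fix e :: real assume "e > 0"
    then have "eventually (\<lambda>i. (\<integral>p. norm (f p - s i p) \<partial>(L \<Otimes>\<^sub>M N)) < e) sequentially"
      by (rule order_tendstoD(2)[OF l])
    then obtain i where "(\<integral>p. norm (f p - s i p) \<partial>(L \<Otimes>\<^sub>M N)) < e"
      by (auto simp: eventually_sequentially)
    then show "\<exists>g. step_approximable L N g \<and> (\<integral>p. norm (f p - g p) \<partial>(L \<Otimes>\<^sub>M N)) < e"
      by (intro exI[of _ "s i"] conjI lim(2))
  qed
qed

text \<open>Approximation in \<open>L^1\<close> of the product only gives convergence in mean over
  time; a subsequence converges at almost every time, as \<open>L1_sp\<close> requires.\<close>

lemma integrable_pair_AE_simple_limit:
  fixes h :: "'a \<Rightarrow> 'b \<Rightarrow> 'c::{banach,second_countable_topology}"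
  assumes L: "finite_measure L" and N: "finite_measure N" and h: "integrable (L \<Otimes>\<^sub>M N) (\<lambda>p. h (fst p) (snd p))"
  obtains s where "\<And>k::nat. simple_function L (s k)" "\<And>k t. t \<in> space L \<Longrightarrow> integrable N (s k t)"
    "AE t in L. (\<lambda>k. \<integral>\<xi>. norm (h t \<xi> - s k t \<xi>) \<partial>N) \<longlonglongrightarrow> 0"
proof -
  interpret L: finite_measure L by fact
  interpret N: finite_measure N by fact
  interpret P: pair_sigma_finite L N ..
  have "\<exists>s. simple_function L s \<and> (\<forall>t\<in>space L. integrable N (s t)) \<and>
       integrable (L \<Otimes>\<^sub>M N) (\<lambda>p. s (fst p) (snd p)) \<and>
       (\<integral>p. norm (h (fst p) (snd p) - s (fst p) (snd p)) \<partial>(L \<Otimes>\<^sub>M N)) < (1/2)^k" for k :: nat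
    using step_approximable_integrable[OF L N h] unfolding step_approximable_def by simp
  from choice[OF allI[OF this]] obtain s where s: "\<forall>k. simple_function L (s k) \<and> (\<forall>t\<in>space L. integrable N (s k t)) \<and>
       integrable (L \<Otimes>\<^sub>M N) (\<lambda>p. s k (fst p) (snd p)) \<and>
       (\<integral>p. norm (h (fst p) (snd p) - s k (fst p) (snd p)) \<partial>(L \<Otimes>\<^sub>M N)) < (1/2)^k" ..
  define u where "u k t = (\<integral>\<xi>. norm (h t \<xi> - s k t \<xi>) \<partial>N)" for k t
  have i: "integrable (L \<Otimes>\<^sub>M N) (\<lambda>p. norm (h (fst p) (snd p) - s k (fst p) (snd p)))" for k
    using s h by (intro integrable_norm Bochner_Integration.integrable_diff) auto
  have ui: "integrable L (u k)" for k
    using P.integrable_fst'[OF i[of k]] by (simp add: u_def[abs_def])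
  have u0: "u k t \<ge> 0" for k t by (simp add: u_def)
  have ule: "(\<integral>t. norm (u k t) \<partial>L) \<le> (1/2)^k" for k
    using P.integral_fst'[OF i[of k]] s u0 by (simp add: u_def[symmetric] less_imp_le)
  have "\<exists>r::nat\<Rightarrow>nat. strict_mono r \<and> (AE t in L. (\<lambda>k. u (r k) t) \<longlonglongrightarrow> 0)"
  proof (rule tendsto_L1_AE_subseq[OF ui])
    show "(\<lambda>k. \<integral>t. norm (u k t) \<partial>L) \<longlonglongrightarrow> 0"
      by (rule tendsto_sandwich[OF _ _ tendsto_const LIMSEQ_power_zero[of "1/2::real"]]) (use ule in auto)
  qed
  then obtain r :: "nat \<Rightarrow> nat" where r: "AE t in L. (\<lambda>k. u (r k) t) \<longlonglongrightarrow> 0" by blast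
  show ?thesis
    by (rule that[of "\<lambda>k. s (r k)"]) (use s r in \<open>auto simp: u_def\<close>)
qed

section \<open>Higher regularity norms\<close>

text \<open>\<open>has_fm_mult\<close> promises integrability for some representation. On the common
  measure the two products agree almost everywhere, so the promise extends to the given one.\<close>

lemma has_fm_mult_integrable:
  assumes u: "fm_rep \<nu> g u" and m: "has_fm_mult m u" and mm: "m \<in> borel_measurable borel"
  shows "integrable \<nu> (\<lambda>\<xi>. cscale (m \<xi>) (g \<xi>))"
proof -
  obtain \<nu>' g' where u': "fm_rep \<nu>' g' u" and i': "integrable \<nu>' (\<lambda>\<xi>. cscale (m \<xi>) (g' \<xi>))"
    using m unfolding has_fm_mult_def by (elim exE conjE)
  show ?thesis
  proof (rule fm_reps_common[OF u u'])
    fix \<mu> :: "(real^'a) measure" and \<rho> \<rho>' :: "real^'a \<Rightarrow> real"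
    assume r: "finite_measure \<mu>" "sets \<mu> = sets borel"
      "\<rho> \<in> borel_measurable \<mu>" "\<And>x. 0 \<le> \<rho> x" "\<nu> = density \<mu> (\<lambda>x. ennreal (\<rho> x))"
      "\<rho>' \<in> borel_measurable \<mu>" "\<And>x. 0 \<le> \<rho>' x" "\<nu>' = density \<mu> (\<lambda>x. ennreal (\<rho>' x))"
      and ae: "AE \<xi> in \<mu>. \<rho> \<xi> *\<^sub>R g \<xi> = \<rho>' \<xi> *\<^sub>R g' \<xi>"
    have "integrable \<nu> g" using u by (simp add: fm_rep_def)
    then have [measurable]: "g \<in> borel_measurable \<mu>" by (simp add: r(5) borel_measurable_integrable[where M = "density \<mu> (\<lambda>x. ennreal (\<rho> x))", simplified])
    note [measurable] = measurable_if_sets_borel[OF r(2) mm] r(3)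
    have 1: "integrable \<mu> (\<lambda>\<xi>. \<rho>' \<xi> *\<^sub>R cscale (m \<xi>) (g' \<xi>))"
      by (rule fm_rep_density(1)[OF r(1,2,6,7) i'[unfolded r(8)]])
    have "integrable \<mu> (\<lambda>\<xi>. \<rho> \<xi> *\<^sub>R cscale (m \<xi>) (g \<xi>))"
    proof (rule integrable_cong_AE_imp[OF 1])
      show "AE \<xi> in \<mu>. \<rho>' \<xi> *\<^sub>R cscale (m \<xi>) (g' \<xi>) = \<rho> \<xi> *\<^sub>R cscale (m \<xi>) (g \<xi>)"
        using ae by eventually_elim (simp flip: bounded_bilinear.scaleR_right[OF bounded_bilinear_cscale])
    qed measurable
    then show ?thesis unfolding r(5) by (subst integrable_density) (use r(4) in auto)
  qed
qed

lemma fm_rep_fourier_meas: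
  "finite_measure \<nu> \<Longrightarrow> sets \<nu> = sets borel \<Longrightarrow> integrable \<nu> g \<Longrightarrow> fm_rep \<nu> g (fourier_meas \<nu> g)"
  by (simp add: fm_rep_def)

text \<open>An abstract weight covers \<open>FM\<close> (weight 1) and \<open>FM^4\<close> (weight
  \<open>fm4_weight\<close>) at once. The weighted density is approximated and then divided by the
  weight, so the approximants lie in the weighted space automatically; a weight bounded below by 1
  keeps the quotients integrable.\<close>

lemma L1_spI:
  fixes X :: "(real^'n \<Rightarrow> complex^'m) \<Rightarrow> bool" and nrm :: "(real^'n \<Rightarrow> complex^'m) \<Rightarrow> real"
  assumes \<nu>: "finite_measure \<nu>" "sets \<nu> = sets borel"
    and \<omega>: "\<omega> \<in> borel_measurable borel" "\<And>\<xi>. 1 \<le> \<omega> \<xi>"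
    and N: "\<And>g. integrable \<nu> (\<lambda>\<xi>. \<omega> \<xi> *\<^sub>R g \<xi>) \<Longrightarrow> X (fourier_meas \<nu> g)"
      "\<And>g. integrable \<nu> (\<lambda>\<xi>. \<omega> \<xi> *\<^sub>R g \<xi>) \<Longrightarrow> nrm (fourier_meas \<nu> g) = (\<integral>\<xi>. \<omega> \<xi> * norm (g \<xi>) \<partial>\<nu>)"
    and v: "integrable (Lon T \<Otimes>\<^sub>M \<nu>) (\<lambda>p. \<omega> (snd p) *\<^sub>R v (fst p) (snd p))"
    and u: "AE t in Lon T. u t = fourier_meas \<nu> (v t)"
  shows "L1_sp X nrm T u"
    and "L1_norm nrm T u = (\<integral>p. \<omega> (snd p) * norm (v (fst p) (snd p)) \<partial>(Lon T \<Otimes>\<^sub>M \<nu>))"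
proof -
  interpret L: finite_measure "Lon T" by (rule finite_measure_Lon)
  interpret N: finite_measure \<nu> by (rule \<nu>)
  interpret P: pair_sigma_finite "Lon T" \<nu> ..
  have \<omega>0: "\<omega> \<xi> > 0" "\<omega> \<xi> \<noteq> 0" for \<xi> using \<omega>(2)[of \<xi>] by linarith+
  note [measurable] = measurable_if_sets_borel[OF \<nu>(2) \<omega>(1)]
  have int1: "integrable \<nu> g" if "integrable \<nu> (\<lambda>\<xi>. \<omega> \<xi> *\<^sub>R g \<xi>)" for g :: "real^'n \<Rightarrow> complex^'m"
  proof (rule Bochner_Integration.integrable_bound[OF that])
    have "(\<lambda>\<xi>. (1 / \<omega> \<xi>) *\<^sub>R (\<omega> \<xi> *\<^sub>R g \<xi>)) \<in> borel_measurable \<nu>"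
      using borel_measurable_integrable[OF that] by measurable
    then show "g \<in> borel_measurable \<nu>" using \<omega>0 by simp
    have "norm (g \<xi>) \<le> \<omega> \<xi> * norm (g \<xi>)" for \<xi> using mult_right_mono[OF \<omega>(2)[of \<xi>], of "norm (g \<xi>)"] by simp
    then show "AE \<xi> in \<nu>. norm (g \<xi>) \<le> norm (\<omega> \<xi> *\<^sub>R g \<xi>)" using \<omega>0 by (simp add: less_imp_le)
  qed
  obtain s where s: "\<And>k::nat. simple_function (Lon T) (s k)" "\<And>k t. t \<in> space (Lon T) \<Longrightarrow> integrable \<nu> (s k t)"
    and lim: "AE t in Lon T. (\<lambda>k. \<integral>\<xi>. norm (\<omega> \<xi> *\<^sub>R v t \<xi> - s k t \<xi>) \<partial>\<nu>) \<longlonglongrightarrow> 0"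
    by (rule integrable_pair_AE_simple_limit[OF finite_measure_Lon \<nu>(1) v], rule that)
  define r where "r k t = fourier_meas \<nu> (\<lambda>\<xi>. s k t \<xi> /\<^sub>R \<omega> \<xi>)" for k t
  have rs: "simple_function (Lon T) (r k)" for k
    unfolding r_def[abs_def] by (rule simple_function_compose1[OF s(1)])
  have rI: "integrable \<nu> (\<lambda>\<xi>. \<omega> \<xi> *\<^sub>R (s k t \<xi> /\<^sub>R \<omega> \<xi>))" if "t \<in> {0<..<T}" for k t
    using s(2)[of t k] that \<omega>0 by simp
  have vt: "AE t in Lon T. integrable \<nu> (\<lambda>\<xi>. \<omega> \<xi> *\<^sub>R v t \<xi>)"
    using P.AE_integrable_fst'[OF v] by simp
  have nrm: "AE t in Lon T. nrm (u t) = (\<integral>\<xi>. \<omega> \<xi> * norm (v t \<xi>) \<partial>\<nu>)"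
    using u vt by eventually_elim (simp add: N(2))
  have vn: "integrable (Lon T \<Otimes>\<^sub>M \<nu>) (\<lambda>p. \<omega> (snd p) * norm (v (fst p) (snd p)))"
    using integrable_norm[OF v] \<omega>0 by (simp add: less_imp_le)
  have i: "integrable (Lon T) (\<lambda>t. \<integral>\<xi>. \<omega> \<xi> * norm (v t \<xi>) \<partial>\<nu>)"
    using P.integrable_fst'[OF vn] by simp
  have meas: "(\<lambda>t. nrm (u t)) \<in> borel_measurable (Lon T)"
    by (rule borel_measurable_lebesgue_on_AE_eq[OF borel_measurable_integrable[OF i] _ nrm]) simp
  have ni: "integrable (Lon T) (\<lambda>t. nrm (u t))"
    by (rule integrable_cong_AE_imp[OF i meas]) (use nrm in \<open>eventually_elim, simp\<close>)
  have X: "AE t in Lon T. X (u t)"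
    using u vt by eventually_elim (simp add: N(1))
  have conv: "AE t in Lon T. (\<lambda>k. nrm (u t - r k t)) \<longlonglongrightarrow> 0"
    using u vt lim AE_space[of "Lon T"]
  proof eventually_elim
    case (elim t)
    have t: "t \<in> {0<..<T}" using elim(4) by simp
    have "nrm (u t - r k t) = (\<integral>\<xi>. norm (\<omega> \<xi> *\<^sub>R v t \<xi> - s k t \<xi>) \<partial>\<nu>)" for k
    proof -
      have e: "u t - r k t = fourier_meas \<nu> (\<lambda>\<xi>. v t \<xi> - s k t \<xi> /\<^sub>R \<omega> \<xi>)"
        by (rule ext) (simp only: fun_diff_def elim(1) r_def fourier_meas_diff[OF \<nu>(2) int1[OF elim(2)] int1[OF rI[OF t]]])
      have "nrm (u t - r k t) = (\<integral>\<xi>. \<omega> \<xi> * norm (v t \<xi> - s k t \<xi> /\<^sub>R \<omega> \<xi>) \<partial>\<nu>)"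
        unfolding e by (rule N(2)) (simp only: scaleR_diff_right Bochner_Integration.integrable_diff[OF elim(2) rI[OF t]])
      also have "\<dots> = (\<integral>\<xi>. norm (\<omega> \<xi> *\<^sub>R v t \<xi> - s k t \<xi>) \<partial>\<nu>)"
      proof (intro Bochner_Integration.integral_cong refl)
        fix \<xi>
        have "\<omega> \<xi> * norm (v t \<xi> - s k t \<xi> /\<^sub>R \<omega> \<xi>) = norm (\<omega> \<xi> *\<^sub>R (v t \<xi> - s k t \<xi> /\<^sub>R \<omega> \<xi>))"
          using \<omega>0(1)[of \<xi>] by simp
        then show "\<omega> \<xi> * norm (v t \<xi> - s k t \<xi> /\<^sub>R \<omega> \<xi>) = norm (\<omega> \<xi> *\<^sub>R v t \<xi> - s k t \<xi>)"
          using \<omega>0(2)[of \<xi>] by (simp add: scaleR_diff_right)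
      qed
      finally show ?thesis .
    qed
    then show ?case using elim(3) by simp
  qed
  have lev: "{t \<in> {0<..<T}. r k t = y} \<in> sets lebesgue" for k y
  proof -
    have "r k -` {y} \<inter> space (Lon T) \<in> sets (Lon T)" by (rule simple_functionD(2)[OF rs])
    then have "r k -` {y} \<inter> {0<..<T} \<in> sets lebesgue" by (simp add: sets_restrict_space_iff)
    moreover have "r k -` {y} \<inter> {0<..<T} = {t \<in> {0<..<T}. r k t = y}" by auto
    ultimately show ?thesis by simp
  qed
  have Xr: "X (r k t)" if "t \<in> {0<..<T}" for k t
    unfolding r_def by (rule N(1)[OF rI[OF that]])
  have fin: "finite (r k ` {0<..<T})" for k using simple_functionD(1)[OF rs, of k] by simp
  show "L1_sp X nrm T u"
    unfolding L1_sp_def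
  proof (intro conjI exI[of _ r])
    show "\<forall>k. finite (r k ` {0<..<T}) \<and> (\<forall>t\<in>{0<..<T}. X (r k t)) \<and> (\<forall>y. {t \<in> {0<..<T}. r k t = y} \<in> sets lebesgue)"
      using fin Xr lev by simp
  qed (use conv X ni in \<open>simp_all add: AE_Lon set_integrable_Lon\<close>)
  have "L1_norm nrm T u = (\<integral>t. nrm (u t) \<partial>Lon T)" by (simp add: L1_norm_def set_integral_Lon)
  also have "\<dots> = (\<integral>t. (\<integral>\<xi>. \<omega> \<xi> * norm (v t \<xi>) \<partial>\<nu>) \<partial>Lon T)"
    by (rule integral_cong_AE[OF meas borel_measurable_integrable[OF i] nrm])
  also have "\<dots> = (\<integral>p. \<omega> (snd p) * norm (v (fst p) (snd p)) \<partial>(Lon T \<Otimes>\<^sub>M \<nu>))"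
    using P.integral_fst'[OF vn] by simp
  finally show "L1_norm nrm T u = (\<integral>p. \<omega> (snd p) * norm (v (fst p) (snd p)) \<partial>(Lon T \<Otimes>\<^sub>M \<nu>))" .
qed

lemma L1_sp_fmI:
  assumes \<nu>: "finite_measure \<nu>" "sets \<nu> = sets borel"
    and v: "integrable (Lon T \<Otimes>\<^sub>M \<nu>) (\<lambda>p. v (fst p) (snd p))"
    and u: "AE t in Lon T. u t = fourier_meas \<nu> (v t)"
  shows "L1_sp in_FM fm_norm T u"
    and "L1_norm fm_norm T u = (\<integral>p. norm (v (fst p) (snd p)) \<partial>(Lon T \<Otimes>\<^sub>M \<nu>))"
proof -
  have r: "fm_rep \<nu> g (fourier_meas \<nu> g)" if "integrable \<nu> (\<lambda>\<xi>. 1 *\<^sub>R g \<xi>)" for g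
    using that by (intro fm_rep_fourier_meas \<nu>) simp
  have X: "in_FM (fourier_meas \<nu> g)" if "integrable \<nu> (\<lambda>\<xi>. 1 *\<^sub>R g \<xi>)" for g
    unfolding in_FM_def by (intro exI, rule r[OF that])
  have n: "fm_norm (fourier_meas \<nu> g) = (\<integral>\<xi>. 1 * norm (g \<xi>) \<partial>\<nu>)" if "integrable \<nu> (\<lambda>\<xi>. 1 *\<^sub>R g \<xi>)" for g
    using fm_norm_eq[OF r[OF that]] by simp
  have v': "integrable (Lon T \<Otimes>\<^sub>M \<nu>) (\<lambda>p. (\<lambda>_. 1) (snd p) *\<^sub>R v (fst p) (snd p))"
    using v by simp
  note * = L1_spI[where \<omega> = "\<lambda>_. 1" and X = in_FM and nrm = fm_norm and u = u and v = v and T = T and \<nu> = \<nu>,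
      OF \<nu> borel_measurable_const order_refl X n v' u]
  show "L1_sp in_FM fm_norm T u" by (rule *(1))
  show "L1_norm fm_norm T u = (\<integral>p. norm (v (fst p) (snd p)) \<partial>(Lon T \<Otimes>\<^sub>M \<nu>))"
    using *(2) by (simp only: mult_1)
qed

section \<open>Multi-indices and the weight of the fourth order norm\<close>

lemma finite_mi_abs_le: "finite {\<kappa>::'n::finite \<Rightarrow> nat. mi_abs \<kappa> \<le> k}"
proof (rule finite_subset)
  show "{\<kappa>::'n \<Rightarrow> nat. mi_abs \<kappa> \<le> k} \<subseteq> PiE UNIV (\<lambda>_. {..k})"
  proof (intro subsetI PiE_I)
    fix \<kappa> :: "'n \<Rightarrow> nat" and i assume "\<kappa> \<in> {\<kappa>. mi_abs \<kappa> \<le> k}"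
    moreover have "\<kappa> i \<le> mi_abs \<kappa>" unfolding mi_abs_def by (rule member_le_sum) simp_all
    ultimately show "\<kappa> i \<in> {..k}" by simp
  qed simp
  show "finite (PiE (UNIV::'n set) (\<lambda>_. {..k}))" by (intro finite_PiE) auto
qed

lemma borel_measurable_mi_symbol [measurable]: "mi_symbol \<kappa> \<in> borel_measurable borel"
  unfolding mi_symbol_def[abs_def] by measurable

lemma norm_mi_symbol_le: "norm (mi_symbol \<kappa> \<xi>) \<le> norm \<xi> ^ mi_abs \<kappa>"
proof -
  have "norm (mi_symbol \<kappa> \<xi>) = (\<Prod>i\<in>UNIV. \<bar>\<xi> $ i\<bar> ^ \<kappa> i)"
    by (simp add: mi_symbol_def norm_mult norm_power flip: prod_norm)
  also have "\<dots> \<le> (\<Prod>i\<in>UNIV. norm \<xi> ^ \<kappa> i)"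
    by (intro prod_mono conjI power_mono component_le_norm_cart) auto
  also have "\<dots> = norm \<xi> ^ mi_abs \<kappa>" by (simp add: mi_abs_def power_sum)
  finally show ?thesis .
qed

lemma power_le_1_plus_power4: "0 \<le> (x::real) \<Longrightarrow> k \<le> 4 \<Longrightarrow> x ^ k \<le> 1 + x ^ 4"
proof (cases "x \<le> 1")
  case True
  assume "0 \<le> x" then show ?thesis using True power_le_one[of x k] zero_le_power[of x 4] by linarith
next
  case False
  assume "k \<le> 4" then show ?thesis using power_increasing[of k 4 x] False by linarith
qed

lemma mi_symbol_unit [simp]: "mi_symbol (unit_mi a j) \<xi> = (- \<i> * complex_of_real (\<xi> $ j)) ^ a"
proof -
  have "(\<Prod>i\<in>UNIV. (- \<i> * complex_of_real (\<xi> $ i)) ^ (if i = j then a else 0))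
      = (\<Prod>i\<in>UNIV. if i = j then (- \<i> * complex_of_real (\<xi> $ i)) ^ a else 1)"
    by (intro prod.cong) auto
  then show ?thesis by (simp add: mi_symbol_def unit_mi_def)
qed

lemma mi_abs_unit [simp]: "mi_abs (unit_mi a j) = a"
  by (simp add: mi_abs_def unit_mi_def)

text \<open>With exactly this weight the norm of \<open>FM^4\<close> is a weighted
  \<open>L^1\<close> norm of the density, with equality and not mere equivalence. The comparison
  constants with \<open>1 + norm \<xi> ^ 4\<close> appear only when symbols are estimated, and end
  up in \<open>wconst\<close> and \<open>aconst\<close>.\<close>

definition fm4_weight :: "real^'n::finite \<Rightarrow> real" where
  "fm4_weight \<xi> = (\<Sum>\<kappa>\<in>{\<kappa>::'n \<Rightarrow> nat. mi_abs \<kappa> \<le> 4}. norm (mi_symbol \<kappa> \<xi>))"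

lemma borel_measurable_fm4_weight [measurable]: "fm4_weight \<in> borel_measurable borel"
  unfolding fm4_weight_def[abs_def] by measurable

lemma norm_mi_symbol_le_weight: "mi_abs \<kappa> \<le> 4 \<Longrightarrow> norm (mi_symbol \<kappa> \<xi>) \<le> fm4_weight \<xi>"
  unfolding fm4_weight_def by (intro member_le_sum finite_mi_abs_le) auto

lemma fm4_weight_ge_1: "1 \<le> fm4_weight (\<xi> :: real^'n)"
proof -
  have "mi_abs (\<lambda>_::'n. 0) \<le> 4" "mi_symbol (\<lambda>_. 0) \<xi> = 1" by (simp_all add: mi_abs_def mi_symbol_def)
  then show ?thesis using norm_mi_symbol_le_weight[of "\<lambda>_. 0" \<xi>] by simp
qed

lemma fm4_weight_le: "fm4_weight (\<xi>::real^'n) \<le> card {\<kappa>::'n::finite \<Rightarrow> nat. mi_abs \<kappa> \<le> 4} * (1 + norm \<xi> ^ 4)"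
  unfolding fm4_weight_def
  by (intro sum_bounded_above order_trans[OF norm_mi_symbol_le] power_le_1_plus_power4) auto

text \<open>Pure fourth derivatives suffice: \<open>norm \<xi> ^ 4\<close> expands into
  \<open>CARD('n)^2\<close> products of two squared coordinates, and each product is at most the
  mean of two fourth powers, hence at most the weight.\<close>

lemma power4_le_weight: "1 + norm (\<xi>::real^'n) ^ 4 \<le> (1 + real CARD('n) ^ 2) * fm4_weight \<xi>"
proof -
  have "norm \<xi> ^ 4 = (\<Sum>j\<in>UNIV. (\<xi> $ j)\<^sup>2)\<^sup>2"
  proof -
    have "norm \<xi> ^ 4 = ((norm \<xi>)\<^sup>2)\<^sup>2" by simp
    then show ?thesis by (simp only: power2_norm_eq_inner) (simp add: inner_vec_def power2_eq_square)
  qed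
  have j: "(\<xi> $ j) ^ 4 \<le> fm4_weight \<xi>" for j
    using norm_mi_symbol_le_weight[of "unit_mi 4 j" \<xi>] by (simp add: norm_power norm_mult)
  have "(\<Sum>j\<in>UNIV. (\<xi> $ j)\<^sup>2) ^ 2 = (\<Sum>i\<in>UNIV. \<Sum>j\<in>UNIV. (\<xi> $ i)\<^sup>2 * (\<xi> $ j)\<^sup>2)"
    by (simp add: power2_eq_square sum_product)
  also have "\<dots> \<le> (\<Sum>i\<in>(UNIV::'n set). \<Sum>j\<in>(UNIV::'n set). fm4_weight \<xi>)"
  proof (intro sum_mono)
    fix i j
    have "2 * ((\<xi> $ i)\<^sup>2 * (\<xi> $ j)\<^sup>2) \<le> ((\<xi> $ i)\<^sup>2)\<^sup>2 + ((\<xi> $ j)\<^sup>2)\<^sup>2"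
      using sum_squares_bound[of "(\<xi> $ i)\<^sup>2" "(\<xi> $ j)\<^sup>2"] by simp
    then show "(\<xi> $ i)\<^sup>2 * (\<xi> $ j)\<^sup>2 \<le> fm4_weight \<xi>" using j[of i] j[of j] by simp
  qed
  also have "\<dots> = real CARD('n) ^ 2 * fm4_weight \<xi>" by (simp add: power2_eq_square)
  finally have "norm \<xi> ^ 4 \<le> real CARD('n) ^ 2 * fm4_weight \<xi>"
    using \<open>norm \<xi> ^ 4 = (\<Sum>j\<in>UNIV. (\<xi> $ j)\<^sup>2)\<^sup>2\<close> by simp
  then show ?thesis using fm4_weight_ge_1[of \<xi>] by (simp add: algebra_simps)
qed

context
  fixes \<nu> :: "(real^'n::finite) measure"
  assumes \<nu>: "finite_measure \<nu>" "sets \<nu> = sets borel"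
begin

lemma integrable_cscale_weight:
  fixes g :: "real^'n \<Rightarrow> complex^'m"
  assumes g: "integrable \<nu> (\<lambda>\<xi>. fm4_weight \<xi> *\<^sub>R g \<xi>)" and m: "m \<in> borel_measurable borel"
    and le: "\<And>\<xi>. norm (m \<xi>) \<le> C * fm4_weight \<xi>"
  shows "integrable \<nu> (\<lambda>\<xi>. cscale (m \<xi>) (g \<xi>))"
proof (rule Bochner_Integration.integrable_bound)
  show "integrable \<nu> (\<lambda>\<xi>. C *\<^sub>R (fm4_weight \<xi> *\<^sub>R g \<xi>))" by (rule integrable_scaleR_right[OF g])
  have w0: "fm4_weight \<xi> > 0" for \<xi> :: "real^'n" using fm4_weight_ge_1[of \<xi>] by linarith
  note [measurable] = measurable_if_sets_borel[OF \<nu>(2) m] measurable_if_sets_borel[OF \<nu>(2) borel_measurable_fm4_weight]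
  have "(\<lambda>\<xi>. (1 / fm4_weight \<xi>) *\<^sub>R (fm4_weight \<xi> *\<^sub>R g \<xi>)) \<in> borel_measurable \<nu>"
    using borel_measurable_integrable[OF g] by measurable
  then have [measurable]: "g \<in> borel_measurable \<nu>" using w0 by (simp add: less_imp_neq[THEN not_sym])
  show "(\<lambda>\<xi>. cscale (m \<xi>) (g \<xi>)) \<in> borel_measurable \<nu>" by measurable
  have "norm (m \<xi>) * norm (g \<xi>) \<le> \<bar>C\<bar> * \<bar>fm4_weight \<xi>\<bar> * norm (g \<xi>)" for \<xi>
    using le[of \<xi>] by (intro mult_right_mono) (auto simp flip: abs_mult)
  then show "AE \<xi> in \<nu>. norm (cscale (m \<xi>) (g \<xi>)) \<le> norm (C *\<^sub>R (fm4_weight \<xi> *\<^sub>R g \<xi>))"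
    by (simp add: mult.assoc abs_mult)
qed

lemma integrable_of_weight:
  fixes g :: "real^'n \<Rightarrow> complex^'m"
  assumes g: "integrable \<nu> (\<lambda>\<xi>. fm4_weight \<xi> *\<^sub>R g \<xi>)"
  shows "integrable \<nu> g"
  using integrable_cscale_weight[OF g borel_measurable_const, of 1 1] by (simp add: fm4_weight_ge_1)

lemma fm_deriv_fourier_meas:
  fixes g :: "real^'n \<Rightarrow> complex^'m"
  assumes g: "integrable \<nu> g" "integrable \<nu> (\<lambda>\<xi>. cscale (mi_symbol \<kappa> \<xi>) (g \<xi>))"
  shows "fm_deriv \<kappa> (fourier_meas \<nu> g) = fourier_meas \<nu> (\<lambda>\<xi>. cscale (mi_symbol \<kappa> \<xi>) (g \<xi>))"
  unfolding fm_deriv_def by (rule fm_mult_eq[OF fm_rep_fourier_meas[OF \<nu> g(1)] g(2)])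

lemma in_FM4_fourier_meas:
  fixes g :: "real^'n \<Rightarrow> complex^'m"
  assumes g: "integrable \<nu> (\<lambda>\<xi>. fm4_weight \<xi> *\<^sub>R g \<xi>)"
  shows "in_FMk 4 (fourier_meas \<nu> g)"
    and "fmk_norm 4 (fourier_meas \<nu> g) = (\<integral>\<xi>. fm4_weight \<xi> * norm (g \<xi>) \<partial>\<nu>)"
proof -
  note r = fm_rep_fourier_meas[OF \<nu> integrable_of_weight[OF g]]
  have i: "integrable \<nu> (\<lambda>\<xi>. cscale (mi_symbol \<kappa> \<xi>) (g \<xi>))" if "mi_abs \<kappa> \<le> 4" for \<kappa>
    by (rule integrable_cscale_weight[OF g borel_measurable_mi_symbol, of _ 1])
      (use norm_mi_symbol_le_weight[OF that] in simp)
  show "in_FMk 4 (fourier_meas \<nu> g)"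
    unfolding in_FMk_def in_FM_def has_fm_mult_def
  proof (intro conjI allI impI)
    show "\<exists>\<nu>' h. fm_rep \<nu>' h (fourier_meas \<nu> g)" by (intro exI, rule r)
    fix \<kappa> :: "'n \<Rightarrow> nat" assume "mi_abs \<kappa> \<le> 4"
    then show "\<exists>\<nu>' h. fm_rep \<nu>' h (fourier_meas \<nu> g) \<and> integrable \<nu>' (\<lambda>\<xi>. cscale (mi_symbol \<kappa> \<xi>) (h \<xi>))"
      by (intro exI[of _ \<nu>] exI[of _ g] conjI r i)
  qed
  have n: "fm_norm (fm_deriv \<kappa> (fourier_meas \<nu> g)) = (\<integral>\<xi>. norm (mi_symbol \<kappa> \<xi>) * norm (g \<xi>) \<partial>\<nu>)"
    if "mi_abs \<kappa> \<le> 4" for \<kappa>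
    unfolding fm_deriv_fourier_meas[OF integrable_of_weight[OF g] i[OF that]]
    by (subst fm_norm_eq[OF fm_rep_fourier_meas[OF \<nu> i[OF that]]]) simp
  have "fmk_norm 4 (fourier_meas \<nu> g) = (\<Sum>\<kappa>\<in>{\<kappa>::'n \<Rightarrow> nat. mi_abs \<kappa> \<le> 4}. \<integral>\<xi>. norm (mi_symbol \<kappa> \<xi>) * norm (g \<xi>) \<partial>\<nu>)"
    unfolding fmk_norm_def by (intro sum.cong refl) (simp add: n)
  also have "\<dots> = (\<integral>\<xi>. (\<Sum>\<kappa>\<in>{\<kappa>::'n \<Rightarrow> nat. mi_abs \<kappa> \<le> 4}. norm (mi_symbol \<kappa> \<xi>) * norm (g \<xi>)) \<partial>\<nu>)"
    by (rule Bochner_Integration.integral_sum[symmetric]) (use integrable_norm[OF i] in simp)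
  finally show "fmk_norm 4 (fourier_meas \<nu> g) = (\<integral>\<xi>. fm4_weight \<xi> * norm (g \<xi>) \<partial>\<nu>)"
    by (simp add: fm4_weight_def sum_distrib_right)
qed

text \<open>Each multi-index of order at most 4 contributes one integrable multiplier, and the
  absolute values of these multipliers add up to the weight.\<close>

lemma integrable_weight_if_in_FM4:
  fixes g :: "real^'n \<Rightarrow> complex^'m"
  assumes r: "fm_rep \<nu> g u" and u: "in_FMk 4 u"
  shows "integrable \<nu> (\<lambda>\<xi>. fm4_weight \<xi> *\<^sub>R g \<xi>)"
proof -
  have g: "integrable \<nu> g" using r by (simp add: fm_rep_def)
  have "integrable \<nu> (\<lambda>\<xi>. cscale (mi_symbol \<kappa> \<xi>) (g \<xi>))" if "mi_abs \<kappa> \<le> 4" for \<kappa>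
    by (rule has_fm_mult_integrable[OF r _ borel_measurable_mi_symbol]) (use u that in \<open>simp add: in_FMk_def\<close>)
  then have "integrable \<nu> (\<lambda>\<xi>. \<Sum>\<kappa>\<in>{\<kappa>::'n \<Rightarrow> nat. mi_abs \<kappa> \<le> 4}. norm (cscale (mi_symbol \<kappa> \<xi>) (g \<xi>)))"
    by (intro Bochner_Integration.integrable_sum integrable_norm) simp
  then have "integrable \<nu> (\<lambda>\<xi>. fm4_weight \<xi> * norm (g \<xi>))"
    by (simp add: fm4_weight_def sum_distrib_right)
  moreover have "(\<lambda>\<xi>. fm4_weight \<xi> *\<^sub>R g \<xi>) \<in> borel_measurable \<nu>"
    using borel_measurable_integrable[OF g] measurable_if_sets_borel[OF \<nu>(2) borel_measurable_fm4_weight] by measurable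
  ultimately show ?thesis
    by (rule Bochner_Integration.integrable_bound) (use fm4_weight_ge_1 in \<open>auto simp: abs_mult\<close>)
qed

end

lemma L1_sp_fm4I:
  fixes v :: "real \<Rightarrow> real^'n \<Rightarrow> complex^'m"
  assumes \<nu>: "finite_measure \<nu>" "sets \<nu> = sets borel"
    and v: "integrable (Lon T \<Otimes>\<^sub>M \<nu>) (\<lambda>p. fm4_weight (snd p) *\<^sub>R v (fst p) (snd p))"
    and u: "AE t in Lon T. u t = fourier_meas \<nu> (v t)"
  shows "L1_sp (in_FMk 4) (fmk_norm 4) T u"
    and "L1_norm (fmk_norm 4) T u = (\<integral>p. fm4_weight (snd p) * norm (v (fst p) (snd p)) \<partial>(Lon T \<Otimes>\<^sub>M \<nu>))"
  by (rule L1_spI[where \<omega> = fm4_weight and X = "in_FMk 4" and nrm = "fmk_norm 4" and u = u and v = v and T = T and \<nu> = \<nu>,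
      OF \<nu> borel_measurable_fm4_weight fm4_weight_ge_1 in_FM4_fourier_meas[OF \<nu>] v u]; assumption)+

section \<open>Differential operators and pressure gradients on the Fourier side\<close>

lemma bounded_linear_mat_act: "bounded_linear (mat_act M)"
proof (rule linear_conv_bounded_linear[THEN iffD1], rule linearI)
  show "mat_act M (r *\<^sub>R v) = r *\<^sub>R mat_act M v" for r v
    by (simp add: mat_act_def vec_eq_iff scaleR_sum_right)
qed (simp add: mat_act_def vec_eq_iff sum.distrib algebra_simps)

lemma mat_act_cscale: "mat_act M (cscale c v) = cscale c (mat_act M v)"
  by (simp add: mat_act_def vec_eq_iff sum_distrib_left mult_ac)

text \<open>With the kernel \<open>exp (-\<i> x \<xi>)\<close> a derivative becomes multiplication
  by \<open>-\<i> \<xi>\<close>; hence the sign of the drift term, while minus the Laplacian and the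
  bi-Laplacian give the second and fourth powers of \<open>norm \<xi>\<close>. The matrix
  \<open>M\<close> is kept apart, being the only part that is not scalar.\<close>

definition stokes_symbol :: "real \<Rightarrow> real \<Rightarrow> real \<Rightarrow> real^'n \<Rightarrow> real^'n \<Rightarrow> complex" where
  "stokes_symbol lam Gam0 Gam2 V \<xi> =
     complex_of_real (Gam0 * (norm \<xi>)\<^sup>2 + Gam2 * norm \<xi> ^ 4) - \<i> * complex_of_real (lam * (V \<bullet> \<xi>))"

lemma borel_measurable_stokes_symbol [measurable]: "stokes_symbol lam Gam0 Gam2 V \<in> borel_measurable borel"
  unfolding stokes_symbol_def[abs_def] by measurable

context
  fixes \<nu> :: "(real^'n::finite) measure" and g :: "real^'n \<Rightarrow> complex^'m"
  assumes \<nu>: "finite_measure \<nu>" "sets \<nu> = sets borel"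
    and g: "integrable \<nu> (\<lambda>\<xi>. fm4_weight \<xi> *\<^sub>R g \<xi>)"
begin

lemma integrable_cscale_poly:
  assumes m: "m \<in> borel_measurable borel" and le: "\<And>\<xi>. norm (m \<xi>) \<le> C * (1 + norm \<xi> ^ 4)"
  shows "integrable \<nu> (\<lambda>\<xi>. cscale (m \<xi>) (g \<xi>))"
proof (rule integrable_cscale_weight[OF \<nu> g m])
  fix \<xi> :: "real^'n"
  have "norm (m \<xi>) \<le> \<bar>C\<bar> * (1 + norm \<xi> ^ 4)"
    using le[of \<xi>] mult_right_mono[OF abs_ge_self[of C], of "1 + norm \<xi> ^ 4"] by simp
  also have "\<dots> \<le> \<bar>C\<bar> * ((1 + real CARD('n) ^ 2) * fm4_weight \<xi>)"
    by (intro mult_left_mono power4_le_weight) simp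
  finally show "norm (m \<xi>) \<le> (\<bar>C\<bar> * (1 + real CARD('n) ^ 2)) * fm4_weight \<xi>" by (simp only: mult.assoc)
qed

lemma integrable_cscale_component:
  assumes "k \<le> 4"
  shows "integrable \<nu> (\<lambda>\<xi>. cscale ((- \<i> * complex_of_real (\<xi> $ j)) ^ k) (g \<xi>))"
proof (rule integrable_cscale_poly[of _ 1])
  fix \<xi> :: "real^'n"
  have "norm ((- \<i> * complex_of_real (\<xi> $ j)) ^ k) \<le> norm \<xi> ^ k"
    using component_le_norm_cart[of \<xi> j] by (simp add: norm_power norm_mult power_mono)
  then show "norm ((- \<i> * complex_of_real (\<xi> $ j)) ^ k) \<le> 1 * (1 + norm \<xi> ^ 4)"
    using power_le_1_plus_power4[OF norm_ge_zero assms, of \<xi>] by simp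
qed measurable

lemma fm_vgrad_fourier_meas:
  "fm_vgrad V (fourier_meas \<nu> g) = fourier_meas \<nu> (\<lambda>\<xi>. cscale (- \<i> * complex_of_real (V \<bullet> \<xi>)) (g \<xi>))"
proof
  fix x
  have i: "integrable \<nu> (\<lambda>\<xi>. cscale ((- \<i> * complex_of_real (\<xi> $ j)) ^ 1) (g \<xi>))" for j
    by (rule integrable_cscale_component) simp
  have "fm_vgrad V (fourier_meas \<nu> g) x
      = (\<Sum>j\<in>UNIV. fourier_meas \<nu> (\<lambda>\<xi>. (V $ j) *\<^sub>R cscale ((- \<i> * complex_of_real (\<xi> $ j)) ^ 1) (g \<xi>)) x)"
    unfolding fm_vgrad_def
    by (intro sum.cong refl)
      (simp only: fm_deriv_fourier_meas[OF \<nu> integrable_of_weight[OF \<nu> g], of "unit_mi 1 _", unfolded mi_symbol_unit, OF i]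
        fourier_meas_scaleR[OF \<nu>(2) i])
  also have "\<dots> = fourier_meas \<nu> (\<lambda>\<xi>. \<Sum>j\<in>UNIV. (V $ j) *\<^sub>R cscale ((- \<i> * complex_of_real (\<xi> $ j)) ^ 1) (g \<xi>)) x"
    by (rule fourier_meas_sum[symmetric, OF \<nu>(2)]) (rule integrable_scaleR_right[OF i])
  also have "(\<lambda>\<xi>. \<Sum>j\<in>UNIV. (V $ j) *\<^sub>R cscale ((- \<i> * complex_of_real (\<xi> $ j)) ^ 1) (g \<xi>))
      = (\<lambda>\<xi>. cscale (- \<i> * complex_of_real (V \<bullet> \<xi>)) (g \<xi>))"
    by (simp add: fun_eq_iff vec_eq_iff inner_vec_def sum_distrib_left sum_distrib_right sum_negf)
      (simp add: scaleR_conv_of_real mult_ac)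
  finally show "fm_vgrad V (fourier_meas \<nu> g) x = fourier_meas \<nu> (\<lambda>\<xi>. cscale (- \<i> * complex_of_real (V \<bullet> \<xi>)) (g \<xi>)) x" .
qed

end

text \<open>The hypotheses ask for bare integrability of the products involved, because the lemma is
  applied a second time to a density already multiplied by the square of \<open>norm \<xi>\<close>,
  which has only two orders of integrability left.\<close>

lemma fm_laplace_fourier_meas:
  fixes g :: "real^'n::finite \<Rightarrow> complex^'m"
  assumes \<nu>: "finite_measure \<nu>" "sets \<nu> = sets borel" and g: "integrable \<nu> g"
    and i: "\<And>j. integrable \<nu> (\<lambda>\<xi>. cscale ((- \<i> * complex_of_real (\<xi> $ j)) ^ 2) (g \<xi>))"
  shows "fm_laplace (fourier_meas \<nu> g) = fourier_meas \<nu> (\<lambda>\<xi>. cscale (- complex_of_real ((norm \<xi>)\<^sup>2)) (g \<xi>))"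
proof
  fix x
  have "fm_laplace (fourier_meas \<nu> g) x
      = (\<Sum>j\<in>UNIV. fourier_meas \<nu> (\<lambda>\<xi>. cscale ((- \<i> * complex_of_real (\<xi> $ j)) ^ 2) (g \<xi>)) x)"
    unfolding fm_laplace_def
    by (intro sum.cong refl) (simp only: fm_deriv_fourier_meas[OF \<nu> g, of "unit_mi 2 _", unfolded mi_symbol_unit, OF i])
  also have "\<dots> = fourier_meas \<nu> (\<lambda>\<xi>. \<Sum>j\<in>UNIV. cscale ((- \<i> * complex_of_real (\<xi> $ j)) ^ 2) (g \<xi>)) x"
    by (rule fourier_meas_sum[symmetric, OF \<nu>(2) i])
  also have "(\<lambda>\<xi>. \<Sum>j\<in>UNIV. cscale ((- \<i> * complex_of_real (\<xi> $ j)) ^ 2) (g \<xi>))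
      = (\<lambda>\<xi>. cscale (- complex_of_real ((norm \<xi>)\<^sup>2)) (g \<xi>))"
    by (simp only: power2_norm_eq_inner)
      (simp add: fun_eq_iff vec_eq_iff inner_vec_def sum_distrib_right sum_negf power_mult_distrib flip: power2_eq_square)
  finally show "fm_laplace (fourier_meas \<nu> g) x = fourier_meas \<nu> (\<lambda>\<xi>. cscale (- complex_of_real ((norm \<xi>)\<^sup>2)) (g \<xi>)) x" .
qed

lemma fourier_meas_mat_act:
  assumes \<nu>: "sets \<nu> = sets borel" "integrable \<nu> g"
  shows "mat_act M (fourier_meas \<nu> g x) = fourier_meas \<nu> (\<lambda>\<xi>. mat_act M (g \<xi>)) x"
  by (simp add: fourier_meas_eq \<nu> integrable_bounded_linear[OF bounded_linear_mat_act]
      integral_bounded_linear[OF bounded_linear_mat_act] integrable_cscale_ek flip: mat_act_cscale)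

lemma stokes_symbol_le:
  fixes V :: "real^'n"
  obtains C :: real where "C > 0" "\<And>\<xi> :: real^'n. norm (stokes_symbol lam Gam0 Gam2 V \<xi>) \<le> C * (1 + norm \<xi> ^ 4)"
proof
  define C where "C = 1 + \<bar>Gam0\<bar> + \<bar>Gam2\<bar> + \<bar>lam\<bar> * norm V"
  show "C > 0" by (simp add: C_def add_pos_nonneg)
  fix \<xi> :: "real^'n"
  let ?w = "1 + norm \<xi> ^ 4"
  have p: "norm \<xi> ^ k \<le> ?w" if "k \<le> 4" for k using power_le_1_plus_power4[OF norm_ge_zero that] .
  have "norm (stokes_symbol lam Gam0 Gam2 V \<xi>) \<le> \<bar>Gam0 * (norm \<xi>)\<^sup>2 + Gam2 * norm \<xi> ^ 4\<bar> + \<bar>lam * (V \<bullet> \<xi>)\<bar>"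
    unfolding stokes_symbol_def by (rule order_trans[OF norm_triangle_ineq4]) (simp only: norm_of_real norm_mult norm_ii mult_1_left order_refl)
  also have "\<dots> \<le> \<bar>Gam0\<bar> * norm \<xi> ^ 2 + \<bar>Gam2\<bar> * norm \<xi> ^ 4 + \<bar>lam\<bar> * (norm V * norm \<xi> ^ 1)"
    using abs_triangle_ineq[of "Gam0 * (norm \<xi>)\<^sup>2" "Gam2 * norm \<xi> ^ 4"] mult_left_mono[OF Cauchy_Schwarz_ineq2[of V \<xi>], of "\<bar>lam\<bar>"]
    by (simp add: abs_mult)
  also have "\<dots> \<le> \<bar>Gam0\<bar> * ?w + \<bar>Gam2\<bar> * ?w + \<bar>lam\<bar> * (norm V * ?w)"
    by (intro add_mono mult_left_mono p) auto
  also have "\<dots> \<le> C * ?w" by (simp add: C_def algebra_simps)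
  finally show "norm (stokes_symbol lam Gam0 Gam2 V \<xi>) \<le> C * ?w" .
qed

lemma stokes_operator_fourier_meas:
  fixes g :: "real^'n::finite \<Rightarrow> complex^'n"
  assumes \<nu>: "finite_measure \<nu>" "sets \<nu> = sets borel"
    and g: "integrable \<nu> (\<lambda>\<xi>. fm4_weight \<xi> *\<^sub>R g \<xi>)"
  shows "integrable \<nu> (\<lambda>\<xi>. cscale (stokes_symbol lam Gam0 Gam2 V \<xi>) (g \<xi>) + mat_act M (g \<xi>))"
    and "lam *\<^sub>R fm_vgrad V (fourier_meas \<nu> g) x + mat_act M (fourier_meas \<nu> g x)
       - Gam0 *\<^sub>R fm_laplace (fourier_meas \<nu> g) x + Gam2 *\<^sub>R fm_laplace (fm_laplace (fourier_meas \<nu> g)) x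
      = fourier_meas \<nu> (\<lambda>\<xi>. cscale (stokes_symbol lam Gam0 Gam2 V \<xi>) (g \<xi>) + mat_act M (g \<xi>)) x"
proof -
  note g1 = integrable_of_weight[OF \<nu> g]
  have gM: "integrable \<nu> (\<lambda>\<xi>. mat_act M (g \<xi>))" by (rule integrable_bounded_linear[OF bounded_linear_mat_act g1])
  have gs: "integrable \<nu> (\<lambda>\<xi>. cscale (stokes_symbol lam Gam0 Gam2 V \<xi>) (g \<xi>))"
    by (rule stokes_symbol_le[of lam Gam0 Gam2 V]) (rule integrable_cscale_poly[OF \<nu> g borel_measurable_stokes_symbol])
  have gl: "integrable \<nu> (\<lambda>\<xi>. cscale (- complex_of_real ((norm \<xi>)\<^sup>2)) (g \<xi>))"
    by (rule integrable_cscale_poly[OF \<nu> g, of _ 1]) (use power_le_1_plus_power4 in \<open>simp_all add: norm_power\<close>)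
  have gll: "integrable \<nu> (\<lambda>\<xi>. cscale (- complex_of_real ((norm \<xi>)\<^sup>2)) (cscale (- complex_of_real ((norm \<xi>)\<^sup>2)) (g \<xi>)))"
    unfolding cscale_cscale
    by (rule integrable_cscale_poly[OF \<nu> g, of _ 1]) (simp_all add: norm_mult norm_power flip: power_add)
  have gv: "integrable \<nu> (\<lambda>\<xi>. cscale (- \<i> * complex_of_real (V \<bullet> \<xi>)) (g \<xi>))"
  proof (rule integrable_cscale_poly[OF \<nu> g, of _ "norm V"])
    fix \<xi> :: "real^'n"
    have "norm \<xi> ^ 1 \<le> 1 + norm \<xi> ^ 4" by (rule power_le_1_plus_power4) auto
    from mult_left_mono[OF this norm_ge_zero[of V]] Cauchy_Schwarz_ineq2[of V \<xi>]
    show "norm (- \<i> * complex_of_real (V \<bullet> \<xi>)) \<le> norm V * (1 + norm \<xi> ^ 4)" by (simp add: norm_mult)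
  qed measurable
  have i2: "integrable \<nu> (\<lambda>\<xi>. cscale ((- \<i> * complex_of_real (\<xi> $ j)) ^ 2) (g \<xi>))" for j
    by (rule integrable_cscale_component[OF \<nu> g]) simp
  have i22: "integrable \<nu> (\<lambda>\<xi>. cscale ((- \<i> * complex_of_real (\<xi> $ j)) ^ 2) (cscale (- complex_of_real ((norm \<xi>)\<^sup>2)) (g \<xi>)))" for j
    unfolding cscale_cscale
  proof (rule integrable_cscale_poly[OF \<nu> g, of _ 1])
    fix \<xi> :: "real^'n"
    have "\<bar>\<xi> $ j\<bar>\<^sup>2 * (norm \<xi>)\<^sup>2 \<le> (norm \<xi>)\<^sup>2 * (norm \<xi>)\<^sup>2"
      using component_le_norm_cart[of \<xi> j] by (intro mult_right_mono power_mono) auto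
    then show "norm ((- \<i> * complex_of_real (\<xi> $ j)) ^ 2 * - complex_of_real ((norm \<xi>)\<^sup>2)) \<le> 1 * (1 + norm \<xi> ^ 4)"
      by (simp add: norm_mult norm_power flip: power_add)
  qed measurable
  show "integrable \<nu> (\<lambda>\<xi>. cscale (stokes_symbol lam Gam0 Gam2 V \<xi>) (g \<xi>) + mat_act M (g \<xi>))"
    by (rule Bochner_Integration.integrable_add[OF gs gM])
  note a1 = integrable_scaleR_right[OF gv, of lam] and a3 = integrable_scaleR_right[OF gl, of Gam0]
    and a4 = integrable_scaleR_right[OF gll, of Gam2]
  note a12 = Bochner_Integration.integrable_add[OF a1 gM]
  note a123 = Bochner_Integration.integrable_diff[OF a12 a3]
  note sums = fourier_meas_add[OF \<nu>(2) a123 a4] fourier_meas_diff[OF \<nu>(2) a12 a3] fourier_meas_add[OF \<nu>(2) a1 gM]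
  have eq: "(\<lambda>\<xi>. cscale (stokes_symbol lam Gam0 Gam2 V \<xi>) (g \<xi>) + mat_act M (g \<xi>))
    = (\<lambda>\<xi>. lam *\<^sub>R cscale (- \<i> * complex_of_real (V \<bullet> \<xi>)) (g \<xi>) + mat_act M (g \<xi>)
       - Gam0 *\<^sub>R cscale (- complex_of_real ((norm \<xi>)\<^sup>2)) (g \<xi>)
       + Gam2 *\<^sub>R cscale (- complex_of_real ((norm \<xi>)\<^sup>2)) (cscale (- complex_of_real ((norm \<xi>)\<^sup>2)) (g \<xi>)))"
  proof
    fix \<xi> :: "real^'n"
    have p: "(norm \<xi>) ^ 4 = (norm \<xi>)\<^sup>2 * (norm \<xi>)\<^sup>2" by (simp flip: power_add)
    show "cscale (stokes_symbol lam Gam0 Gam2 V \<xi>) (g \<xi>) + mat_act M (g \<xi>)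
      = lam *\<^sub>R cscale (- \<i> * complex_of_real (V \<bullet> \<xi>)) (g \<xi>) + mat_act M (g \<xi>)
       - Gam0 *\<^sub>R cscale (- complex_of_real ((norm \<xi>)\<^sup>2)) (g \<xi>)
       + Gam2 *\<^sub>R cscale (- complex_of_real ((norm \<xi>)\<^sup>2)) (cscale (- complex_of_real ((norm \<xi>)\<^sup>2)) (g \<xi>))"
      unfolding vec_eq_iff stokes_symbol_def p
      by (simp only: vector_add_component vector_minus_component cscale_nth vector_scaleR_component)
        (simp add: scaleR_conv_of_real algebra_simps)
  qed
  show "lam *\<^sub>R fm_vgrad V (fourier_meas \<nu> g) x + mat_act M (fourier_meas \<nu> g x)
       - Gam0 *\<^sub>R fm_laplace (fourier_meas \<nu> g) x + Gam2 *\<^sub>R fm_laplace (fm_laplace (fourier_meas \<nu> g)) x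
      = fourier_meas \<nu> (\<lambda>\<xi>. cscale (stokes_symbol lam Gam0 Gam2 V \<xi>) (g \<xi>) + mat_act M (g \<xi>)) x"
    unfolding eq fm_laplace_fourier_meas[OF \<nu> g1 i2] fm_laplace_fourier_meas[OF \<nu> gl i22]
      fm_vgrad_fourier_meas[OF \<nu> g] fourier_meas_mat_act[OF \<nu>(2) g1]
      fourier_meas_scaleR[OF \<nu>(2) gl, symmetric] fourier_meas_scaleR[OF \<nu>(2) gll, symmetric]
      fourier_meas_scaleR[OF \<nu>(2) gv, symmetric]
    by (simp only: sums)
qed


section \<open>Differentiation under the integral and pressure gradients\<close>

lemma has_vector_derivative_integral:
  fixes k :: "real \<Rightarrow> 'a \<Rightarrow> 'b::{banach,second_countable_topology}"
  assumes k: "\<And>s. integrable \<nu> (k s)" and B: "integrable \<nu> B" and k': "k' \<in> borel_measurable \<nu>"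
    and d: "\<And>\<xi>. ((\<lambda>s. k s \<xi>) has_vector_derivative k' \<xi>) (at s0)"
    and le: "\<And>s \<xi>. norm (k s \<xi> - k s0 \<xi>) \<le> \<bar>s - s0\<bar> * B \<xi>"
  shows "((\<lambda>s. \<integral>\<xi>. k s \<xi> \<partial>\<nu>) has_vector_derivative (\<integral>\<xi>. k' \<xi> \<partial>\<nu>)) (at s0)"
proof -
  \<comment> \<open>The derivative is rewritten as a limit of difference quotients, which can be
    tested along sequences and hence by dominated convergence with the Lipschitz bound
    \<open>B\<close>.\<close>
  have iff: "(f has_vector_derivative f') (at s0) \<longleftrightarrow> ((\<lambda>s. (f s - f s0) /\<^sub>R (s - s0)) \<longlongrightarrow> f') (at s0)"
    for f :: "real \<Rightarrow> 'b" and f'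
  proof -
    have "(f has_vector_derivative f') (at s0) \<longleftrightarrow>
        ((\<lambda>s. norm (f s - f s0 - (s - s0) *\<^sub>R f') / norm (s - s0)) \<longlongrightarrow> 0) (at s0)"
      by (simp add: has_vector_derivative_def has_derivative_iff_norm bounded_linear_scaleR_left)
    also have "\<dots> \<longleftrightarrow> ((\<lambda>s. norm ((f s - f s0) /\<^sub>R (s - s0) - f')) \<longlongrightarrow> 0) (at s0)"
    proof (rule tendsto_cong)
      have "norm (f s - f s0 - (s - s0) *\<^sub>R f') / norm (s - s0) = norm ((f s - f s0) /\<^sub>R (s - s0) - f')" if "s \<noteq> s0" for s
      proof -
        have "(f s - f s0) /\<^sub>R (s - s0) - f' = (f s - f s0 - (s - s0) *\<^sub>R f') /\<^sub>R (s - s0)"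
          using that by (simp add: scaleR_diff_right)
        then show ?thesis by (simp add: divide_inverse mult.commute)
      qed
      then show "\<forall>\<^sub>F s in at s0. norm (f s - f s0 - (s - s0) *\<^sub>R f') / norm (s - s0) = norm ((f s - f s0) /\<^sub>R (s - s0) - f')"
        by (auto simp: eventually_at_filter)
    qed
    also have "\<dots> \<longleftrightarrow> ((\<lambda>s. (f s - f s0) /\<^sub>R (s - s0)) \<longlongrightarrow> f') (at s0)"
      by (simp add: tendsto_norm_zero_iff LIM_zero_iff)
    finally show ?thesis .
  qed
  note [measurable] = borel_measurable_integrable[OF k] k'
  show ?thesis
    unfolding iff tendsto_at_iff_sequentially
  proof (intro allI impI)
    fix X :: "nat \<Rightarrow> real" assume X: "\<forall>i. X i \<in> UNIV - {s0}" "X \<longlonglongrightarrow> s0"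
    have "(\<lambda>i. \<integral>\<xi>. (k (X i) \<xi> - k s0 \<xi>) /\<^sub>R (X i - s0) \<partial>\<nu>) \<longlonglongrightarrow> (\<integral>\<xi>. k' \<xi> \<partial>\<nu>)"
    proof (rule integral_dominated_convergence[where w = B])
      show "AE \<xi> in \<nu>. (\<lambda>i. (k (X i) \<xi> - k s0 \<xi>) /\<^sub>R (X i - s0)) \<longlonglongrightarrow> k' \<xi>"
        using d X unfolding iff tendsto_at_iff_sequentially by (auto simp: comp_def)
      show "AE \<xi> in \<nu>. norm ((k (X i) \<xi> - k s0 \<xi>) /\<^sub>R (X i - s0)) \<le> B \<xi>" for i
      proof (rule AE_I2)
        fix \<xi>
        have "\<bar>X i - s0\<bar> > 0" using X(1) by auto
        then show "norm ((k (X i) \<xi> - k s0 \<xi>) /\<^sub>R (X i - s0)) \<le> B \<xi>"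
          using le[of "X i" \<xi>] by (simp only: norm_scaleR norm_inverse real_norm_def) (simp add: field_simps)
      qed
    qed (use B in measurable)
    then show "((\<lambda>s. ((\<integral>\<xi>. k s \<xi> \<partial>\<nu>) - (\<integral>\<xi>. k s0 \<xi> \<partial>\<nu>)) /\<^sub>R (s - s0)) \<circ> X) \<longlonglongrightarrow> (\<integral>\<xi>. k' \<xi> \<partial>\<nu>)"
      by (simp add: comp_def k)
  qed
qed

lemma norm_ek_diff_le: "norm (ek x \<xi> - ek y \<xi>) \<le> \<bar>(x - y) \<bullet> \<xi>\<bar>"
proof -
  have "norm (exp (\<i> * complex_of_real t) - 1) \<le> \<bar>t\<bar>" for t
    using abs_sin_x_le_abs_x[of "t / 2"] by (simp add: dist_exp_i_1)
  from this[of "- ((x - y) \<bullet> \<xi>)"] have 1: "norm (ek (x - y) \<xi> - 1) \<le> \<bar>(x - y) \<bullet> \<xi>\<bar>" by (simp add: ek_def)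
  have "ek x \<xi> - ek y \<xi> = ek y \<xi> * (ek (x - y) \<xi> - 1)"
    using ek_add[of y "x - y" \<xi>] by (simp add: algebra_simps)
  then show ?thesis using 1 by (simp add: norm_mult)
qed

lemma ek_has_vector_derivative:
  "((\<lambda>s. ek (x + s *\<^sub>R y) \<xi>) has_vector_derivative (- \<i> * complex_of_real (y \<bullet> \<xi>) * ek (x + s *\<^sub>R y) \<xi>)) (at s within S)"
proof -
  have eq: "ek (x + s *\<^sub>R y) \<xi> = ek x \<xi> * exp (s *\<^sub>R (- \<i> * complex_of_real (y \<bullet> \<xi>)))" for s
    by (simp add: ek_def inner_add_left scaleR_conv_of_real algebra_simps flip: exp_add)
  have "((\<lambda>s. ek x \<xi> * exp (s *\<^sub>R (- \<i> * complex_of_real (y \<bullet> \<xi>)))) has_vector_derivative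
      ek x \<xi> * (exp (s *\<^sub>R (- \<i> * complex_of_real (y \<bullet> \<xi>))) * (- \<i> * complex_of_real (y \<bullet> \<xi>)))) (at s within S)"
    by (intro has_vector_derivative_mult_right exp_scaleR_has_vector_derivative_right)
  then show ?thesis unfolding eq by (simp add: mult_ac)
qed

lemma borel_measurable_cvec [measurable]: "cvec \<in> borel_measurable borel"
  unfolding cvec_def[abs_def] by (intro borel_measurable_continuous_onI continuous_intros)

lemma borel_measurable_component [measurable]: "(\<lambda>\<xi>. (\<xi>::real^'n) $ j) \<in> borel_measurable borel"
  by (intro borel_measurable_continuous_onI continuous_intros)

text \<open>The density \<open>b\<close> itself need not be integrable near the origin; subtracting 1 from the
  exponential compensates this without changing the gradient.\<close>
lemma pgrad_potential:
  fixes b :: "real^'n::finite \<Rightarrow> complex"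
  assumes \<nu>: "finite_measure \<nu>" "sets \<nu> = sets borel"
    and b: "b \<in> borel_measurable \<nu>" "integrable \<nu> (\<lambda>\<xi>. cscale (b \<xi>) (cvec \<xi>))"
  defines "q \<equiv> \<lambda>x. \<integral>\<xi>. (ek x \<xi> - 1) * (\<i> * b \<xi>) \<partial>\<nu>"
  shows "pgrad_exists q" and "pgrad q = fourier_meas \<nu> (\<lambda>\<xi>. cscale (b \<xi>) (cvec \<xi>))"
proof -
  note [measurable] = b(1) measurable_if_sets_borel[OF \<nu>(2) borel_measurable_ek] measurable_if_sets_borel[OF \<nu>(2) borel_measurable_component]
    measurable_if_sets_borel[OF \<nu>(2) borel_measurable_cvec]
  have B: "integrable \<nu> (\<lambda>\<xi>. norm \<xi> * norm (b \<xi>))" using integrable_norm[OF b(2)] by (simp add: mult.commute)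
  have int: "integrable \<nu> (\<lambda>\<xi>. (ek x \<xi> - 1) * (\<i> * b \<xi>))" for x
  proof (rule Bochner_Integration.integrable_bound)
    show "integrable \<nu> (\<lambda>\<xi>. norm x * (norm \<xi> * norm (b \<xi>)))" using B by simp
    have "norm (ek x \<xi> - 1) \<le> norm x * norm \<xi>" for \<xi>
      using norm_ek_diff_le[of x \<xi> 0] Cauchy_Schwarz_ineq2[of x \<xi>] by simp
    then show "AE \<xi> in \<nu>. norm ((ek x \<xi> - 1) * (\<i> * b \<xi>)) \<le> norm (norm x * (norm \<xi> * norm (b \<xi>)))"
      by (intro AE_I2) (simp add: norm_mult mult_right_mono abs_mult flip: mult.assoc)
  qed measurable
  have d: "((\<lambda>s. q (x + s *\<^sub>R axis j 1)) has_vector_derivative fourier_meas \<nu> (\<lambda>\<xi>. cscale (b \<xi>) (cvec \<xi>)) x $ j) (at 0)" for x j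
  proof -
    have "((\<lambda>s. \<integral>\<xi>. (ek (x + s *\<^sub>R axis j 1) \<xi> - 1) * (\<i> * b \<xi>) \<partial>\<nu>) has_vector_derivative
        (\<integral>\<xi>. ek x \<xi> * (b \<xi> * complex_of_real (\<xi> $ j)) \<partial>\<nu>)) (at 0)"
    proof (rule has_vector_derivative_integral[OF int B])
      \<comment> \<open>The factor \<open>\<i>\<close> in the potential cancels the
        \<open>-\<i>\<close> produced by differentiating the character.\<close>
      show "((\<lambda>s. (ek (x + s *\<^sub>R axis j 1) \<xi> - 1) * (\<i> * b \<xi>)) has_vector_derivative
         ek x \<xi> * (b \<xi> * complex_of_real (\<xi> $ j))) (at 0)" for \<xi>
        by (rule has_vector_derivative_eq_rhs)
          (rule has_vector_derivative_mult_left has_vector_derivative_diff_const[THEN iffD2] ek_has_vector_derivative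
            | simp add: inner_axis' algebra_simps)+
      fix s \<xi>
      have "norm (ek (x + s *\<^sub>R axis j 1) \<xi> - ek x \<xi>) \<le> \<bar>s\<bar> * norm \<xi>"
        using norm_ek_diff_le[of "x + s *\<^sub>R axis j 1" \<xi> x] component_le_norm_cart[of \<xi> j]
          mult_left_mono[of "\<bar>\<xi> $ j\<bar>" "norm \<xi>" "\<bar>s\<bar>"] by (simp add: inner_axis' abs_mult)
      then have "norm (ek (x + s *\<^sub>R axis j 1) \<xi> - ek x \<xi>) * norm (b \<xi>) \<le> \<bar>s\<bar> * norm \<xi> * norm (b \<xi>)"
        by (rule mult_right_mono) simp
      moreover have "(ek (x + s *\<^sub>R axis j 1) \<xi> - 1) * (\<i> * b \<xi>) - (ek (x + 0 *\<^sub>R axis j 1) \<xi> - 1) * (\<i> * b \<xi>)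
          = (ek (x + s *\<^sub>R axis j 1) \<xi> - ek x \<xi>) * (\<i> * b \<xi>)" by (simp add: algebra_simps)
      ultimately show "norm ((ek (x + s *\<^sub>R axis j 1) \<xi> - 1) * (\<i> * b \<xi>) - (ek (x + 0 *\<^sub>R axis j 1) \<xi> - 1) * (\<i> * b \<xi>))
          \<le> \<bar>s - 0\<bar> * (norm \<xi> * norm (b \<xi>))" by (simp add: norm_mult)
    qed measurable
    then show ?thesis unfolding q_def fourier_meas_nth by (simp add: cvec_def)
  qed
  show "pgrad_exists q" unfolding pgrad_exists_def using d by (auto simp: differentiable_def has_vector_derivative_def)
  show "pgrad q = fourier_meas \<nu> (\<lambda>\<xi>. cscale (b \<xi>) (cvec \<xi>))"
    using vector_derivative_at[OF d] by (simp add: pgrad_def fun_eq_iff vec_eq_iff)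
qed

text \<open>\<open>edge_int a y\<close> is the integral of \<open>exp (-\<i> s y)\<close> over \<open>s\<close> between 0 and \<open>a\<close>.\<close>
definition edge_int :: "real \<Rightarrow> real \<Rightarrow> complex" where
  "edge_int a y = (if y = 0 then of_real a else (1 - exp (- \<i> * of_real (a * y))) / (\<i> * of_real y))"

lemma edge_int_eq: "1 - exp (- \<i> * complex_of_real (a * y)) = \<i> * of_real y * edge_int a y"
  by (simp add: edge_int_def)

lemma edge_int_0 [simp]: "edge_int 0 y = 0" by (simp add: edge_int_def)

lemma edge_int_has_vector_derivative:
  "((\<lambda>s. edge_int s y) has_vector_derivative exp (- \<i> * complex_of_real (s * y))) (at s)"
proof (cases "y = 0")
  case True
  then show ?thesis using has_vector_derivative_of_real[OF DERIV_ident] by (simp add: edge_int_def[abs_def])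
next
  case False
  have e: "exp (- \<i> * complex_of_real (s * y)) = exp (s *\<^sub>R (- \<i> * complex_of_real y))" for s
    by (simp add: scaleR_conv_of_real algebra_simps)
  have "((\<lambda>s. (1 - exp (s *\<^sub>R (- \<i> * complex_of_real y))) * inverse (\<i> * of_real y)) has_vector_derivative
      (0 - exp (s *\<^sub>R (- \<i> * complex_of_real y)) * (- \<i> * complex_of_real y)) * inverse (\<i> * of_real y)) (at s)"
    by (intro has_vector_derivative_mult_left has_vector_derivative_diff has_vector_derivative_const
        exp_scaleR_has_vector_derivative_right)
  moreover have "(0 - Z * (- \<i> * complex_of_real y)) * inverse (\<i> * of_real y) = Z" for Z
    using False by (simp add: field_simps)
  ultimately have "((\<lambda>s. (1 - exp (s *\<^sub>R (- \<i> * complex_of_real y))) * inverse (\<i> * of_real y)) has_vector_derivative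
      exp (s *\<^sub>R (- \<i> * complex_of_real y))) (at s)" by (simp only:)
  moreover have "edge_int s y = (1 - exp (s *\<^sub>R (- \<i> * complex_of_real y))) * inverse (\<i> * of_real y)" for s
    using False unfolding edge_int_def e by (simp only: if_False divide_inverse)
  ultimately show ?thesis by (simp only: e)
qed

lemma norm_edge_int_diff_le: "norm (edge_int a y - edge_int b y) \<le> \<bar>a - b\<bar>"
proof (cases "y = 0")
  case True
  then show ?thesis by (simp add: edge_int_def flip: of_real_diff)
next
  case False
  have "edge_int a y - edge_int b y = (ek b y - ek a y) / (\<i> * of_real y)"
    using False by (simp add: edge_int_def ek_def diff_divide_distrib)
  then have "norm (edge_int a y - edge_int b y) = norm (ek b y - ek a y) / \<bar>y\<bar>"
    by (simp add: norm_divide norm_mult)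
  also have "\<dots> \<le> \<bar>(b - a) * y\<bar> / \<bar>y\<bar>"
    using norm_ek_diff_le[of b y a] by (intro divide_right_mono) auto
  also have "\<dots> = \<bar>a - b\<bar>" using False by (simp add: abs_mult)
  finally show ?thesis .
qed

lemma borel_measurable_edge_int [measurable]: "edge_int a \<in> borel_measurable borel"
  unfolding edge_int_def[abs_def] by measurable

text \<open>The zeros of \<open>edge_int a\<close> are the nonzero multiples of
  \<open>2 * pi / a\<close>. Short edges push them beyond any given frequency, so that edge factors
  can be divided out.\<close>

lemma edge_int_nonzero: "a > 0 \<Longrightarrow> a * \<bar>y\<bar> < 1 \<Longrightarrow> edge_int a y \<noteq> 0"
proof
  assume a: "a > 0" "a * \<bar>y\<bar> < 1" and 0: "edge_int a y = 0"
  have y: "y \<noteq> 0" using a 0 by (auto simp: edge_int_def)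
  have "exp (\<i> * complex_of_real (- (a * y))) = 1" using edge_int_eq[of a y] 0 by simp
  then have "Im (cis (- (a * y))) = Im 1" by (simp add: cis_conv_exp)
  then have "sin (a * y) = 0" by simp
  then have "sin (a * \<bar>y\<bar>) = 0" by (cases "y \<ge> 0") auto
  moreover have "sin (a * \<bar>y\<bar>) > 0"
    using a y pi_gt3 by (intro sin_gt_zero) (auto intro!: mult_pos_pos)
  ultimately show False by simp
qed

text \<open>\<open>pgrad_exists\<close> supplies only partial derivatives, so the argument stays on
  one coordinate line: both sides have the same derivative in the edge length and agree at length
  0.\<close>

lemma pgrad_edge_integral:
  fixes r :: "real^'n::finite \<Rightarrow> complex^'n"
  assumes \<nu>: "finite_measure \<nu>" "sets \<nu> = sets borel" and r: "integrable \<nu> r"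
    and q: "pgrad_exists q" "pgrad q = fourier_meas \<nu> r"
  shows "q (x + a *\<^sub>R axis j 1) - q x = (\<integral>\<xi>. ek x \<xi> * (edge_int a (\<xi> $ j) * r \<xi> $ j) \<partial>\<nu>)"
proof -
  have rj: "integrable \<nu> (\<lambda>\<xi>. r \<xi> $ j)" by (rule integrable_vec_nth[OF r])
  note [measurable] = measurable_if_sets_borel[OF \<nu>(2) borel_measurable_ek] measurable_if_sets_borel[OF \<nu>(2) borel_measurable_component]
    borel_measurable_integrable[OF rj]
  have le: "norm (edge_int s y) \<le> \<bar>s\<bar>" for s y using norm_edge_int_diff_le[of s y 0] by simp
  have int: "integrable \<nu> (\<lambda>\<xi>. ek x \<xi> * (edge_int s (\<xi> $ j) * r \<xi> $ j))" for s
    by (rule Bochner_Integration.integrable_bound[OF integrable_mult_right[OF integrable_norm[OF rj], of "\<bar>s\<bar>"]])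
      (auto intro!: AE_I2 mult_right_mono le simp: norm_mult)
  define D where "D s = q (x + s *\<^sub>R axis j 1) - (\<integral>\<xi>. ek x \<xi> * (edge_int s (\<xi> $ j) * r \<xi> $ j) \<partial>\<nu>)" for s
  have "(D has_vector_derivative 0) (at s within UNIV)" for s
  proof -
    let ?y = "x + s *\<^sub>R axis j 1"
    have "((\<lambda>h. q (?y + h *\<^sub>R axis j 1)) has_vector_derivative pgrad q ?y $ j) (at (s - s))"
      using q(1) by (simp add: pgrad_def pgrad_exists_def vector_derivative_works)
    then have "(((\<lambda>h. q (?y + h *\<^sub>R axis j 1)) \<circ> (\<lambda>h. h - s)) has_vector_derivative 1 *\<^sub>R (pgrad q ?y $ j)) (at s)"
      by (intro vector_diff_chain_at) (auto intro!: derivative_eq_intros)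
    moreover have "(\<lambda>h. q (?y + h *\<^sub>R axis j 1)) \<circ> (\<lambda>h. h - s) = (\<lambda>h. q (x + h *\<^sub>R axis j 1))"
      by (simp add: fun_eq_iff algebra_simps)
    ultimately have 1: "((\<lambda>h. q (x + h *\<^sub>R axis j 1)) has_vector_derivative (\<integral>\<xi>. ek ?y \<xi> * r \<xi> $ j \<partial>\<nu>)) (at s)"
      by (simp add: q(2) fourier_meas_nth)
    have 2: "((\<lambda>s. \<integral>\<xi>. ek x \<xi> * (edge_int s (\<xi> $ j) * r \<xi> $ j) \<partial>\<nu>) has_vector_derivative (\<integral>\<xi>. ek ?y \<xi> * r \<xi> $ j \<partial>\<nu>)) (at s)"
    proof (rule has_vector_derivative_integral[OF int integrable_norm[OF rj]])
      fix \<xi>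
      have "((\<lambda>s. ek x \<xi> * (edge_int s (\<xi> $ j) * r \<xi> $ j)) has_vector_derivative
          ek x \<xi> * (exp (- \<i> * complex_of_real (s * \<xi> $ j)) * r \<xi> $ j)) (at s)"
        by (intro has_vector_derivative_mult_right has_vector_derivative_mult_left edge_int_has_vector_derivative)
      moreover have "exp (- \<i> * complex_of_real (s * \<xi> $ j)) = ek (s *\<^sub>R axis j 1) \<xi>"
        by (simp add: ek_def inner_axis')
      ultimately show "((\<lambda>s. ek x \<xi> * (edge_int s (\<xi> $ j) * r \<xi> $ j)) has_vector_derivative ek ?y \<xi> * r \<xi> $ j) (at s)"
        by (simp add: ek_add mult.assoc)
      fix t
      have "norm (ek x \<xi> * (edge_int t (\<xi> $ j) * r \<xi> $ j) - ek x \<xi> * (edge_int s (\<xi> $ j) * r \<xi> $ j))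
        = norm (edge_int t (\<xi> $ j) - edge_int s (\<xi> $ j)) * norm (r \<xi> $ j)"
        by (simp add: norm_mult flip: right_diff_distrib left_diff_distrib)
      also have "\<dots> \<le> \<bar>t - s\<bar> * norm (r \<xi> $ j)" by (intro mult_right_mono norm_edge_int_diff_le) simp
      finally show "norm (ek x \<xi> * (edge_int t (\<xi> $ j) * r \<xi> $ j) - ek x \<xi> * (edge_int s (\<xi> $ j) * r \<xi> $ j))
        \<le> \<bar>t - s\<bar> * norm (r \<xi> $ j)" .
    qed measurable
    show ?thesis using has_vector_derivative_diff[OF 1 2] unfolding D_def[abs_def] by simp
  qed
  then obtain c where "\<And>s. D s = c"
    by (metis has_vector_derivative_zero_constant[of UNIV D] convex_UNIV UNIV_I)
  then have "D a = D 0" by simp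
  then show ?thesis by (simp add: D_def algebra_simps)
qed

text \<open>The two ways around a square from \<open>x\<close> to the opposite corner give the same
  increment of \<open>q\<close>. In terms of densities this says that
  \<open>\<xi> $ k * r \<xi> $ j - \<xi> $ j * r \<xi> $ k\<close> vanishes after multiplication by
  two edge factors. Increments are compared instead of mixed second derivatives because
  \<open>r\<close> is merely integrable and has no moments.\<close>

lemma pgrad_curl_free:
  fixes r :: "real^'n::finite \<Rightarrow> complex^'n"
  assumes \<nu>: "finite_measure \<nu>" "sets \<nu> = sets borel" and r: "integrable \<nu> r"
    and q: "pgrad_exists q" "pgrad q = fourier_meas \<nu> r"
  shows "AE \<xi> in \<nu>. Pr \<xi> (r \<xi>) = 0"
proof -
  note edge = pgrad_edge_integral[OF \<nu> r q]
  have rj: "integrable \<nu> (\<lambda>\<xi>. r \<xi> $ j)" for j by (rule integrable_vec_nth[OF r])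
  note [measurable] = measurable_if_sets_borel[OF \<nu>(2) borel_measurable_ek] measurable_if_sets_borel[OF \<nu>(2) borel_measurable_component]
    borel_measurable_integrable[OF rj]
  have le: "norm (edge_int s y) \<le> \<bar>s\<bar>" for s y using norm_edge_int_diff_le[of s y 0] by simp
  have int: "integrable \<nu> (\<lambda>\<xi>. c \<xi> * (edge_int s (\<xi> $ j) * r \<xi> $ j))"
    if "c \<in> borel_measurable \<nu>" "\<And>\<xi>. norm (c \<xi>) \<le> 1" for s j and c :: "real^'n \<Rightarrow> complex"
  proof (rule Bochner_Integration.integrable_bound[OF integrable_mult_right[OF integrable_norm[OF rj[of j]], of "\<bar>s\<bar>"]])
    show "(\<lambda>\<xi>. c \<xi> * (edge_int s (\<xi> $ j) * r \<xi> $ j)) \<in> borel_measurable \<nu>" using that(1) by measurable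
    show "AE \<xi> in \<nu>. norm (c \<xi> * (edge_int s (\<xi> $ j) * r \<xi> $ j)) \<le> norm (\<bar>s\<bar> * norm (r \<xi> $ j))"
    proof (rule AE_I2)
      fix \<xi>
      have "norm (c \<xi>) * (norm (edge_int s (\<xi> $ j)) * norm (r \<xi> $ j)) \<le> 1 * (\<bar>s\<bar> * norm (r \<xi> $ j))"
        by (intro mult_mono le that(2)) auto
      then show "norm (c \<xi> * (edge_int s (\<xi> $ j) * r \<xi> $ j)) \<le> norm (\<bar>s\<bar> * norm (r \<xi> $ j))" by (simp add: norm_mult)
    qed
  qed
  have loop: "AE \<xi> in \<nu>. edge_int a (\<xi> $ j) * edge_int a (\<xi> $ k) * (of_real (\<xi> $ k) * r \<xi> $ j - of_real (\<xi> $ j) * r \<xi> $ k) = 0" for a j k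
  proof -
    define e where "e i \<xi> = edge_int a (\<xi> $ i) * r \<xi> $ i" for i \<xi>
    define m where "m i \<xi> = ek (a *\<^sub>R axis i (1::real)) \<xi>" for i :: 'n and \<xi> :: "real^'n"
    have [measurable]: "m i \<in> borel_measurable \<nu>" for i unfolding m_def[abs_def] by measurable
    have ei: "integrable \<nu> (\<lambda>\<xi>. ek x \<xi> * e i \<xi>)" "integrable \<nu> (\<lambda>\<xi>. (ek x \<xi> * m l \<xi>) * e i \<xi>)" for x i l
      unfolding e_def by (intro int; simp add: m_def norm_mult)+
    have "AE \<xi> in \<nu>. e j \<xi> + m j \<xi> * e k \<xi> - (e k \<xi> + m k \<xi> * e j \<xi>) = 0"
    proof (rule fourier_injective_scalar[OF \<nu>])
      show "integrable \<nu> (\<lambda>\<xi>. e j \<xi> + m j \<xi> * e k \<xi> - (e k \<xi> + m k \<xi> * e j \<xi>))"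
        using ei(1)[of 0] ei(2)[of 0] by (intro Bochner_Integration.integrable_diff Bochner_Integration.integrable_add) simp_all
      fix x
      have s: "(\<integral>\<xi>. ek (x + a *\<^sub>R axis i 1) \<xi> * e l \<xi> \<partial>\<nu>) = (\<integral>\<xi>. (ek x \<xi> * m i \<xi>) * e l \<xi> \<partial>\<nu>)" for i l
        by (simp add: ek_add m_def)
      have sw: "x + a *\<^sub>R axis k 1 + a *\<^sub>R axis j 1 = x + a *\<^sub>R axis j 1 + a *\<^sub>R axis k 1" by (simp add: algebra_simps)
      have "(\<integral>\<xi>. ek x \<xi> * (e j \<xi> + m j \<xi> * e k \<xi> - (e k \<xi> + m k \<xi> * e j \<xi>)) \<partial>\<nu>)
        = (\<integral>\<xi>. ek x \<xi> * e j \<xi> + (ek x \<xi> * m j \<xi>) * e k \<xi> - (ek x \<xi> * e k \<xi> + (ek x \<xi> * m k \<xi>) * e j \<xi>) \<partial>\<nu>)"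
        by (simp add: algebra_simps)
      also have "\<dots> = (\<integral>\<xi>. ek x \<xi> * e j \<xi> \<partial>\<nu>) + (\<integral>\<xi>. (ek x \<xi> * m j \<xi>) * e k \<xi> \<partial>\<nu>)
          - ((\<integral>\<xi>. ek x \<xi> * e k \<xi> \<partial>\<nu>) + (\<integral>\<xi>. (ek x \<xi> * m k \<xi>) * e j \<xi> \<partial>\<nu>))"
        by (simp only: Bochner_Integration.integral_diff[OF Bochner_Integration.integrable_add[OF ei] Bochner_Integration.integrable_add[OF ei]]
            Bochner_Integration.integral_add[OF ei])
      also have "\<dots> = 0"
        unfolding s[symmetric] unfolding e_def edge[symmetric] sw by simp
      finally show "(\<integral>\<xi>. ek x \<xi> * (e j \<xi> + m j \<xi> * e k \<xi> - (e k \<xi> + m k \<xi> * e j \<xi>)) \<partial>\<nu>) = 0" .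
    qed
    then show ?thesis
    proof eventually_elim
      case (elim \<xi>)
      have m: "m i \<xi> = 1 - \<i> * of_real (\<xi> $ i) * edge_int a (\<xi> $ i)" for i
        unfolding edge_int_eq[symmetric] by (simp add: m_def ek_def inner_axis')
      have "\<i> * (edge_int a (\<xi> $ j) * edge_int a (\<xi> $ k) * (of_real (\<xi> $ k) * r \<xi> $ j - of_real (\<xi> $ j) * r \<xi> $ k))
        = e j \<xi> + m j \<xi> * e k \<xi> - (e k \<xi> + m k \<xi> * e j \<xi>)"
        unfolding m e_def by (simp add: algebra_simps)
      then show ?case using elim by simp
    qed
  qed
  \<comment> \<open>Countably many side lengths share one null set of frequencies; for each
    remaining frequency some side is short enough for its edge factors to be nonzero.\<close>
  have "AE \<xi> in \<nu>. \<forall>N::nat. \<forall>j\<in>UNIV. \<forall>k\<in>UNIV. edge_int (1 / real (Suc N)) (\<xi> $ j) * edge_int (1 / real (Suc N)) (\<xi> $ k)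
      * (of_real (\<xi> $ k) * r \<xi> $ j - of_real (\<xi> $ j) * r \<xi> $ k) = 0"
    unfolding AE_all_countable by (intro allI AE_finite_allI loop) auto
  then show ?thesis
  proof eventually_elim
    case (elim \<xi>)
    obtain N where N: "norm \<xi> < real N" using reals_Archimedean2 by blast
    have "edge_int (1 / real (Suc N)) (\<xi> $ j) \<noteq> 0" for j
      using N component_le_norm_cart[of \<xi> j] by (intro edge_int_nonzero) (auto simp: field_simps)
    then have c: "of_real (\<xi> $ k) * r \<xi> $ j = of_real (\<xi> $ j) * r \<xi> $ k" for j k
      using elim[rule_format, of j k N] by simp
    show ?case
    proof (cases "\<xi> = 0")
      case False
      have "cdot \<xi> (r \<xi>) * of_real (\<xi> $ j) = of_real ((norm \<xi>)\<^sup>2) * r \<xi> $ j" for j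
      proof -
        have "cdot \<xi> (r \<xi>) * of_real (\<xi> $ j) = (\<Sum>k\<in>UNIV. of_real (\<xi> $ k) * (of_real (\<xi> $ j) * r \<xi> $ k))"
          unfolding cdot_def sum_distrib_right by (simp add: mult_ac)
        also have "\<dots> = (\<Sum>k\<in>UNIV. of_real (\<xi> $ k) * (of_real (\<xi> $ k) * r \<xi> $ j))" by (simp only: c)
        also have "\<dots> = of_real ((norm \<xi>)\<^sup>2) * r \<xi> $ j"
          by (simp only: power2_norm_eq_inner) (simp add: inner_vec_def sum_distrib_right mult.assoc)
        finally show ?thesis .
      qed
      then have "cscale (cdot \<xi> (r \<xi>) / of_real ((norm \<xi>)\<^sup>2)) (cvec \<xi>) = r \<xi>"
        using False by (simp add: vec_eq_iff cvec_def)
      then show ?thesis using False by (simp add: Pr_def)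
    qed (simp add: Pr_def)
  qed
qed

section \<open>Duhamel's formula\<close>

text \<open>The operator exponential \<open>exp (t A)\<close> applied to \<open>v\<close>, as a
  series of vectors. \<open>A\<close> remains a plain function, and measurability in a parameter of
  \<open>A\<close> can be read off term by term.\<close>

definition blexp :: "('a::banach \<Rightarrow> 'a) \<Rightarrow> real \<Rightarrow> 'a \<Rightarrow> 'a" where
  "blexp A t v = (\<Sum>k. (t ^ k / fact k) *\<^sub>R (A ^^ k) v)"

lemma norm_funpow_le:
  fixes A :: "'a::real_normed_vector \<Rightarrow> 'a"
  assumes "\<And>v. norm (A v) \<le> b * norm v" "0 \<le> b"
  shows "norm ((A ^^ k) v) \<le> b ^ k * norm v"
proof (induction k)
  case (Suc k)
  have "norm ((A ^^ Suc k) v) \<le> b * norm ((A ^^ k) v)" using assms(1) by simp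
  also have "\<dots> \<le> b * (b ^ k * norm v)" using Suc assms(2) by (rule mult_left_mono)
  finally show ?case by (simp add: mult.assoc)
qed simp

context
  fixes A :: "'a::banach \<Rightarrow> 'a" and b :: real
  assumes A: "\<And>v. norm (A v) \<le> b * norm v" "0 \<le> b"
begin

lemma norm_blexp_term_le: "norm ((t ^ k / fact k) *\<^sub>R (A ^^ k) v) \<le> ((\<bar>t\<bar> * b) ^ k /\<^sub>R fact k) * norm v"
proof -
  have "norm ((t ^ k / fact k) *\<^sub>R (A ^^ k) v) = (\<bar>t\<bar> ^ k / fact k) * norm ((A ^^ k) v)"
    by (simp add: power_abs)
  also have "\<dots> \<le> (\<bar>t\<bar> ^ k / fact k) * (b ^ k * norm v)"
    by (intro mult_left_mono norm_funpow_le[OF A]) simp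
  finally show ?thesis by (simp add: power_mult_distrib divide_inverse mult_ac)
qed

lemma summable_norm_blexp: "summable (\<lambda>k. norm ((t ^ k / fact k) *\<^sub>R (A ^^ k) v))"
proof (rule summable_comparison_test)
  show "\<exists>N. \<forall>k\<ge>N. norm (norm ((t ^ k / fact k) *\<^sub>R (A ^^ k) v)) \<le> ((\<bar>t\<bar> * b) ^ k /\<^sub>R fact k) * norm v"
    using norm_blexp_term_le by (intro exI[of _ 0]) simp
  show "summable (\<lambda>k. ((\<bar>t\<bar> * b) ^ k /\<^sub>R fact k) * norm v)"
    by (intro summable_mult2 summable_exp_generic)
qed

lemma summable_blexp: "summable (\<lambda>k. (t ^ k / fact k) *\<^sub>R (A ^^ k) v)"
  by (rule summable_norm_cancel[OF summable_norm_blexp])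

lemma norm_blexp_le: "norm (blexp A t v) \<le> exp (\<bar>t\<bar> * b) * norm v"
proof -
  have "norm (blexp A t v) \<le> (\<Sum>k. norm ((t ^ k / fact k) *\<^sub>R (A ^^ k) v))"
    unfolding blexp_def by (rule summable_norm[OF summable_norm_blexp])
  also have "\<dots> \<le> (\<Sum>k. ((\<bar>t\<bar> * b) ^ k /\<^sub>R fact k) * norm v)"
    by (intro suminf_le summable_norm_blexp norm_blexp_term_le summable_mult2 summable_exp_generic)
  also have "\<dots> = exp (\<bar>t\<bar> * b) * norm v"
    unfolding exp_def by (rule suminf_mult2[symmetric, OF summable_exp_generic])
  finally show ?thesis .
qed

text \<open>Serves with \<open>P\<close> equal to \<open>A\<close> itself and
  \<open>w = A v\<close>, and with \<open>P\<close> the Helmholtz projection and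
  \<open>w = v\<close>.\<close>

lemma blexp_commute:
  assumes P: "bounded_linear P" and c: "\<And>k. P ((A ^^ k) v) = (A ^^ k) w"
  shows "P (blexp A t v) = blexp A t w"
proof -
  have "P (blexp A t v) = (\<Sum>k. P ((t ^ k / fact k) *\<^sub>R (A ^^ k) v))"
    unfolding blexp_def by (rule bounded_linear.suminf[OF P summable_blexp])
  also have "\<dots> = blexp A t w"
    unfolding blexp_def by (simp add: linear_scale[OF bounded_linear.linear[OF P]] c)
  finally show ?thesis .
qed

end

lemma blexp_0 [simp]: "blexp A 0 v = v"
  unfolding blexp_def by (subst suminf_finite[of "{0}"]) auto

text \<open>Finite dimension enters here: each coordinate is a scalar power series in
  \<open>t\<close>, convergent everywhere, which may be differentiated term by term.\<close>

lemma blexp_has_vector_derivative: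
  fixes A :: "'a::euclidean_space \<Rightarrow> 'a"
  assumes A: "\<And>v. norm (A v) \<le> b * norm v" "0 \<le> b"
  shows "((\<lambda>t. blexp A t v) has_vector_derivative blexp A t (A v)) (at t)"
  unfolding has_vector_derivative_def
proof (subst has_derivative_componentwise_within, rule ballI)
  fix i :: 'a assume i: "i \<in> Basis"
  define c where "c k = ((A ^^ k) v \<bullet> i) / fact k" for k
  have in1: "blexp A t v \<bullet> i = (\<Sum>k. ((t ^ k / fact k) *\<^sub>R (A ^^ k) v) \<bullet> i)" for t v
    unfolding blexp_def by (rule bounded_linear.suminf[OF bounded_linear_inner_left summable_blexp[OF A]])
  have eq: "blexp A t v \<bullet> i = (\<Sum>k. c k * t ^ k)" for t
    unfolding in1 c_def by (simp add: mult_ac)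
  have "summable (\<lambda>k. ((t ^ k / fact k) *\<^sub>R (A ^^ k) v) \<bullet> i)" for t
    by (rule bounded_linear.summable[OF bounded_linear_inner_left summable_blexp[OF A]])
  then have "summable (\<lambda>k. c k * t ^ k)" for t by (simp add: c_def mult_ac)
  then have "((\<lambda>t. \<Sum>k. c k * t ^ k) has_field_derivative (\<Sum>k. diffs c k * t ^ k)) (at t)"
    by (rule termdiffs_strong_converges_everywhere)
  moreover have "diffs c k = ((A ^^ k) (A v) \<bullet> i) / fact k" for k
    unfolding diffs_def c_def fact_Suc funpow_Suc_right by (simp add: field_simps del: of_nat_Suc)
  then have "(\<Sum>k. diffs c k * t ^ k) = blexp A t (A v) \<bullet> i"
    unfolding in1 by (simp add: mult_ac)
  ultimately have "((\<lambda>t. blexp A t v \<bullet> i) has_field_derivative blexp A t (A v) \<bullet> i) (at t)" by (simp add: eq)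
  then show "((\<lambda>t. blexp A t v \<bullet> i) has_derivative (\<lambda>h. (h *\<^sub>R blexp A t (A v)) \<bullet> i)) (at t)"
    by (simp add: has_field_derivative_def mult_commute_abs)
qed

section \<open>Integral calculus on the time interval\<close>

lemma borel_measurable_lebesgue_on_ident: "(\<lambda>s. s) \<in> borel_measurable (lebesgue_on S)"
  by (intro measurable_restrict_space1 measurable_completion) simp

lemma integral_Lon_FTC:
  fixes f :: "real \<Rightarrow> 'a::euclidean_space"
  assumes ab: "0 \<le> a" "a \<le> b" "b \<le> T"
    and F: "\<And>x. (F has_vector_derivative f x) (at x)" and f: "continuous_on UNIV f"
  shows "(\<integral>s. indicator {a<..<b} s *\<^sub>R f s \<partial>Lon T) = F b - F a"
    and "integrable (Lon T) (\<lambda>s. indicator {a<..<b} s *\<^sub>R f s)"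
proof -
  have [measurable]: "f \<in> borel_measurable borel" by (rule borel_measurable_continuous_onI[OF f])
  have "(\<integral>s. indicator {a<..<b} s *\<^sub>R f s \<partial>Lon T) = (\<integral>s. indicator {0<..<T} s *\<^sub>R (indicator {a<..<b} s *\<^sub>R f s) \<partial>lebesgue)"
    by (rule integral_restrict_space) simp
  also have "\<dots> = (\<integral>s. indicator {0<..<T} s *\<^sub>R (indicator {a<..<b} s *\<^sub>R f s) \<partial>lborel)"
    by (rule integral_completion) measurable
  also have "\<dots> = (\<integral>s. indicator {a..b} s *\<^sub>R f s \<partial>lborel)"
  proof (rule integral_cong_AE)
    show "AE s in lborel. indicator {0<..<T} s *\<^sub>R (indicator {a<..<b} s *\<^sub>R f s) = indicator {a..b} s *\<^sub>R f s"
      using AE_lborel_singleton[of a] AE_lborel_singleton[of b]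
      by eventually_elim (use ab in \<open>auto simp: indicator_def\<close>)
  qed measurable
  also have "\<dots> = F b - F a"
    using F f by (intro integral_FTC_atLeastAtMost ab) (auto intro: has_vector_derivative_at_within continuous_on_subset)
  finally show "(\<integral>s. indicator {a<..<b} s *\<^sub>R f s \<partial>Lon T) = F b - F a" .
  have "integrable lborel (\<lambda>s. indicator {a..b} s *\<^sub>R f s)"
    using borel_integrable_atLeastAtMost'[of a b f] f
    by (simp add: set_integrable_def continuous_on_subset)
  then have "integrable lborel (\<lambda>s. indicator {0<..<T} s *\<^sub>R (indicator {a<..<b} s *\<^sub>R f s))"
    by (rule Bochner_Integration.integrable_bound) (use ab in \<open>auto simp: indicator_def\<close>)
  then have "integrable lebesgue (\<lambda>s. indicator {0<..<T} s *\<^sub>R (indicator {a<..<b} s *\<^sub>R f s))"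
    by (subst integrable_completion) auto
  then show "integrable (Lon T) (\<lambda>s. indicator {a<..<b} s *\<^sub>R f s)"
    by (subst integrable_restrict_space) auto
qed

lemma borel_measurable_Lon_lessThan: "(\<lambda>s. indicator {..<t} s :: real) \<in> borel_measurable (Lon T)"
  by (rule measurable_compose[OF borel_measurable_lebesgue_on_ident]) simp

lemma integrable_Lon_lessThan:
  fixes f :: "real \<Rightarrow> 'b::{banach,second_countable_topology}"
  assumes f: "integrable (Lon T) f"
  shows "integrable (Lon T) (\<lambda>s. indicator {..<t} s *\<^sub>R f s)"
proof (rule Bochner_Integration.integrable_bound[OF f])
  show "(\<lambda>s. indicator {..<t} s *\<^sub>R f s) \<in> borel_measurable (Lon T)"
    by (intro borel_measurable_scaleR borel_measurable_Lon_lessThan borel_measurable_integrable[OF f])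
qed (auto simp: indicator_def)

text \<open>As \<open>d\<close> is only integrable, the inequality is iterated instead of
  differentiated. In the weight \<open>exp (2 * K * t)\<close> one application of \<open>K\<close>
  times the integral gains the factor \<open>1/2\<close>, so the bound after \<open>n\<close> rounds
  is of order \<open>1 / 2 ^ n\<close>.\<close>

lemma gronwall_zero:
  fixes d :: "real \<Rightarrow> 'a::{banach,second_countable_topology}"
  assumes K: "K > 0" and d: "integrable (Lon T) d"
    and le: "\<And>t. t \<in> {0..T} \<Longrightarrow> norm (d t) \<le> K * (\<integral>s. indicator {..<t} s * norm (d s) \<partial>Lon T)"
    and t: "t \<in> {0..T}"
  shows "d t = 0"
proof -
  define D where "D = K * (\<integral>s. norm (d s) \<partial>Lon T)"
  have ind: "integrable (Lon T) (\<lambda>s. indicator {..<t} s * norm (d s))" for t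
    using integrable_Lon_lessThan[OF integrable_norm[OF d]] by simp
  have F: "((\<lambda>s. exp (2 * K * s) / (2 * K)) has_vector_derivative exp (2 * K * s)) (at s)" for s
    using K by (auto intro!: derivative_eq_intros simp flip: has_real_derivative_iff_has_vector_derivative)
  note FTC = integral_Lon_FTC[OF order_refl _ _ F, of _ T]
  have "norm (d t) \<le> D / 2 ^ n * exp (2 * K * t)" if "t \<in> {0..T}" for n t
    using that
  proof (induction n arbitrary: t)
    case 0
    have "norm (d t) \<le> K * (\<integral>s. indicator {..<t} s * norm (d s) \<partial>Lon T)" by (rule le[OF 0])
    also have "\<dots> \<le> D"
      unfolding D_def using K d by (intro mult_left_mono integral_mono ind) (auto simp: indicator_def)
    also have "\<dots> \<le> D * exp (2 * K * t)"
      using K 0 mult_left_mono[of 1 "exp (2 * K * t)" D] by (simp add: D_def)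
    finally show ?case by simp
  next
    case (Suc n)
    have c: "continuous_on UNIV (\<lambda>s. exp (2 * K * s))" by (intro continuous_intros)
    have i: "integrable (Lon T) (\<lambda>s. indicator {0<..<t} s *\<^sub>R exp (2 * K * s))"
      and v: "(\<integral>s. indicator {0<..<t} s *\<^sub>R exp (2 * K * s) \<partial>Lon T) = exp (2 * K * t) / (2 * K) - exp (2 * K * 0) / (2 * K)"
      using FTC[of t] Suc.prems c by simp_all
    have D0: "D \<ge> 0" using K by (simp add: D_def)
    have "norm (d t) \<le> K * (\<integral>s. indicator {..<t} s * norm (d s) \<partial>Lon T)" by (rule le[OF Suc.prems])
    also have "\<dots> \<le> K * (\<integral>s. D / 2 ^ n * (indicator {0<..<t} s *\<^sub>R exp (2 * K * s)) \<partial>Lon T)"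
    proof (intro mult_left_mono integral_mono ind integrable_mult_right i)
      fix s assume "s \<in> space (Lon T)"
      then show "indicator {..<t} s * norm (d s) \<le> D / 2 ^ n * (indicator {0<..<t} s *\<^sub>R exp (2 * K * s))"
        using Suc.IH[of s] Suc.prems by (cases "s < t") simp_all
    qed (use K in simp)
    also have "\<dots> = K * (D / 2 ^ n * (exp (2 * K * t) / (2 * K) - exp (2 * K * 0) / (2 * K)))"
      by (simp only: integral_mult_right_zero v)
    also have "\<dots> = D / 2 ^ Suc n * (exp (2 * K * t) - 1)"
    proof -
      have "K * (y * (x / (2 * K) - exp (2 * K * 0) / (2 * K))) = y / 2 * (x - 1)" for x y :: real
        using K by (simp add: field_simps)
      from this[of "D / 2 ^ n" "exp (2 * K * t)"] show ?thesis
        by (simp only: power_Suc divide_divide_eq_left mult.commute[of 2])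
    qed
    also have "\<dots> \<le> D / 2 ^ Suc n * exp (2 * K * t)" using D0 by (intro mult_left_mono) auto
    finally show ?case .
  qed
  note bound = this[OF t]
  have "(\<lambda>n. D * exp (2 * K * t) * (1/2) ^ n) \<longlonglongrightarrow> D * exp (2 * K * t) * 0"
    by (intro tendsto_mult tendsto_const LIMSEQ_power_zero) simp
  moreover have "norm (d t) \<le> D * exp (2 * K * t) * (1/2) ^ n" for n
    using bound[of n] by (simp add: power_divide)
  then have "\<exists>N. \<forall>n\<ge>N. norm (d t) \<le> D * exp (2 * K * t) * (1/2) ^ n" by blast
  ultimately have "norm (d t) \<le> D * exp (2 * K * t) * 0" by (rule LIMSEQ_le_const)
  then show ?thesis by simp
qed

text \<open>The upper limit \<open>t\<close> is encoded by an indicator, so that all integrals run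
  over the fixed space \<open>Lon T\<close> and Fubini works on one product.\<close>

definition duhamel :: "real \<Rightarrow> (real \<Rightarrow> 'a \<Rightarrow> 'a) \<Rightarrow> 'a \<Rightarrow> (real \<Rightarrow> 'a) \<Rightarrow> real \<Rightarrow> 'a::{banach,second_countable_topology}" where
  "duhamel T E h0 h t = E t h0 + (\<integral>s. indicator {..<t} s *\<^sub>R E (t - s) (h s) \<partial>Lon T)"

text \<open>The equation is kept in integrated form because \<open>h\<close> is merely integrable in
  time. Inserting the formula on the right and exchanging the integrals over the triangle
  \<open>r < s < t\<close> leaves the integral of \<open>A (E (s - r) (h r))\<close> over
  \<open>s\<close>, which telescopes to \<open>h r - E (t - r) (h r)\<close>.\<close>

lemma duhamel_integral_equation:
  fixes A :: "'a::euclidean_space \<Rightarrow> 'a"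
  assumes A: "bounded_linear A" and E0: "\<And>v. E 0 v = v"
    and Ed: "\<And>t v. ((\<lambda>t. E t v) has_vector_derivative - A (E t v)) (at t)"
    and Em: "(\<lambda>p. E (fst p) (snd p)) \<in> borel_measurable borel"
    and EK: "\<And>t v. t \<in> {0..T} \<Longrightarrow> norm (E t v) \<le> K * norm v"
    and h: "integrable (Lon T) h"
  shows "integrable (Lon T) (duhamel T E h0 h)"
    and "t \<in> {0..T} \<Longrightarrow> duhamel T E h0 h t = h0 + (\<integral>s. indicator {..<t} s *\<^sub>R (h s - A (duhamel T E h0 h s)) \<partial>Lon T)"
proof -
  interpret L: finite_measure "Lon T" by (rule finite_measure_Lon)
  interpret P: pair_sigma_finite "Lon T" "Lon T" ..
  note [measurable] = borel_measurable_integrable[OF h]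
  have EE: "(\<lambda>x. E (f x) (g x)) \<in> borel_measurable M" if "f \<in> borel_measurable M" "g \<in> borel_measurable M" for f g and M :: "'b measure"
    using measurable_compose[OF borel_measurable_Pair[OF that] Em] by simp
  have fs [measurable]: "fst \<in> borel_measurable (Lon T \<Otimes>\<^sub>M Lon T)" "snd \<in> borel_measurable (Lon T \<Otimes>\<^sub>M Lon T)"
    using measurable_compose[OF measurable_fst borel_measurable_lebesgue_on_ident, of "{0<..<T}" "Lon T"]
      measurable_compose[OF measurable_snd borel_measurable_lebesgue_on_ident, of "Lon T" "{0<..<T}"] by simp_all
  have hs [measurable]: "(\<lambda>p. h (snd p)) \<in> borel_measurable (Lon T \<Otimes>\<^sub>M Lon T)"
    by (rule measurable_compose[OF measurable_snd]) simp
  have ind [measurable]: "(\<lambda>p. indicator {..<fst p} (snd p) :: real) \<in> borel_measurable (Lon T \<Otimes>\<^sub>M Lon T)"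
    unfolding indicator_def by simp measurable
  \<comment> \<open>The bound on \<open>E\<close> is available only for times in
    \<open>{0..T}\<close>; the indicator restricts the kernel to lags in that range.\<close>
  have kern: "integrable (Lon T \<Otimes>\<^sub>M Lon T) (\<lambda>p. indicator {..<fst p} (snd p) *\<^sub>R E (fst p - snd p) (h (snd p)))"
  proof (rule Bochner_Integration.integrable_bound)
    show "integrable (Lon T \<Otimes>\<^sub>M Lon T) (\<lambda>p. K * norm (h (snd p)))"
      by (rule P.Fubini_integrable) (use h in simp_all)
    show "(\<lambda>p. indicator {..<fst p} (snd p) *\<^sub>R E (fst p - snd p) (h (snd p))) \<in> borel_measurable (Lon T \<Otimes>\<^sub>M Lon T)"
      by (intro borel_measurable_scaleR ind EE borel_measurable_diff fs hs)
    show "AE p in Lon T \<Otimes>\<^sub>M Lon T. norm (indicator {..<fst p} (snd p) *\<^sub>R E (fst p - snd p) (h (snd p))) \<le> norm (K * norm (h (snd p)))"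
    proof (rule AE_I2)
      fix p assume "p \<in> space (Lon T \<Otimes>\<^sub>M Lon T)"
      then have p: "fst p \<in> {0<..<T}" "snd p \<in> {0<..<T}" by (auto simp: space_pair_measure)
      show "norm (indicator {..<fst p} (snd p) *\<^sub>R E (fst p - snd p) (h (snd p))) \<le> norm (K * norm (h (snd p)))"
      proof (cases "snd p < fst p")
        case True
        then have "norm (E (fst p - snd p) (h (snd p))) \<le> K * norm (h (snd p))" using p by (intro EK) auto
        also have "\<dots> \<le> norm (K * norm (h (snd p)))" by simp
        finally show ?thesis using True by simp
      qed simp
    qed
  qed
  have AEc: "continuous_on UNIV (\<lambda>t. A (E t v))" for v
    using Ed by (intro bounded_linear.continuous_on[OF A] has_vector_derivative_continuous continuous_at_imp_continuous_on) (blast intro: has_vector_derivative_continuous)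
  have h0i: "integrable (Lon T) (\<lambda>t. E t h0)"
  proof (rule L.integrable_const_bound[where B = "K * norm h0"])
    show "AE t in Lon T. norm (E t h0) \<le> K * norm h0" by (intro AE_I2 EK) simp
  qed (rule EE[OF borel_measurable_lebesgue_on_ident borel_measurable_const])
  note duhi = P.integrable_fst'[OF kern, simplified]
  show wi: "integrable (Lon T) (duhamel T E h0 h)"
    unfolding duhamel_def[abs_def] by (intro Bochner_Integration.integrable_add h0i duhi)
  assume t: "t \<in> {0..T}"
  have FTC: "(\<integral>s. indicator {r<..<t} s *\<^sub>R A (E (s - r) v) \<partial>Lon T) = v - E (t - r) v" if "0 \<le> r" "r \<le> t" for r v
  proof -
    have "((\<lambda>s. - E (s - r) v) has_vector_derivative A (E (s - r) v)) (at s)" for s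
    proof -
      have "(((\<lambda>s. E s v) \<circ> (\<lambda>s. s - r)) has_vector_derivative 1 *\<^sub>R (- A (E (s - r) v))) (at s)"
        by (intro vector_diff_chain_at Ed) (auto intro!: derivative_eq_intros)
      then show ?thesis using has_vector_derivative_minus by (fastforce simp: comp_def)
    qed
    moreover have "continuous_on UNIV (\<lambda>s. A (E (s - r) v))"
      by (rule continuous_on_compose2[OF AEc[of v]]) (auto intro!: continuous_intros)
    ultimately have "(\<integral>s. indicator {r<..<t} s *\<^sub>R A (E (s - r) v) \<partial>Lon T) = - E (t - r) v - - E (r - r) v"
      using that t by (intro integral_Lon_FTC) auto
    then show ?thesis by (simp add: E0)
  qed
  have swap: "(\<integral>s. indicator {..<t} s *\<^sub>R A (\<integral>r. indicator {..<s} r *\<^sub>R E (s - r) (h r) \<partial>Lon T) \<partial>Lon T)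
     = (\<integral>r. indicator {..<t} r *\<^sub>R (h r - E (t - r) (h r)) \<partial>Lon T)"
  proof -
    have it: "integrable (Lon T \<Otimes>\<^sub>M Lon T) (\<lambda>p. indicator {..<t} (fst p) *\<^sub>R A (indicator {..<fst p} (snd p) *\<^sub>R E (fst p - snd p) (h (snd p))))"
      (is "integrable _ ?k")
    proof (rule Bochner_Integration.integrable_bound[OF integrable_bounded_linear[OF A kern]])
      show "?k \<in> borel_measurable (Lon T \<Otimes>\<^sub>M Lon T)"
      proof (rule borel_measurable_scaleR)
        show "(\<lambda>p. indicator {..<t} (fst p) :: real) \<in> borel_measurable (Lon T \<Otimes>\<^sub>M Lon T)"
          using fs(1) by measurable
      qed (rule borel_measurable_integrable[OF integrable_bounded_linear[OF A kern]])
    qed (auto intro!: AE_I2 simp: indicator_def)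
    have "AE s in Lon T. indicator {..<t} s *\<^sub>R A (\<integral>r. indicator {..<s} r *\<^sub>R E (s - r) (h r) \<partial>Lon T)
        = (\<integral>r. indicator {..<t} s *\<^sub>R A (indicator {..<s} r *\<^sub>R E (s - r) (h r)) \<partial>Lon T)"
      using P.AE_integrable_fst'[OF kern]
      by eventually_elim (simp add: integral_bounded_linear[OF A])
    then have "(\<integral>s. indicator {..<t} s *\<^sub>R A (\<integral>r. indicator {..<s} r *\<^sub>R E (s - r) (h r) \<partial>Lon T) \<partial>Lon T)
        = (\<integral>s. (\<integral>r. indicator {..<t} s *\<^sub>R A (indicator {..<s} r *\<^sub>R E (s - r) (h r)) \<partial>Lon T) \<partial>Lon T)"
    proof (rule integral_cong_AE[rotated 2])
      show "(\<lambda>s. \<integral>r. indicator {..<t} s *\<^sub>R A (indicator {..<s} r *\<^sub>R E (s - r) (h r)) \<partial>Lon T) \<in> borel_measurable (Lon T)"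
        using P.integrable_fst'[OF it] by (simp add: borel_measurable_integrable)
      show "(\<lambda>s. indicator {..<t} s *\<^sub>R A (\<integral>r. indicator {..<s} r *\<^sub>R E (s - r) (h r) \<partial>Lon T)) \<in> borel_measurable (Lon T)"
        by (rule borel_measurable_integrable[OF integrable_Lon_lessThan[OF integrable_bounded_linear[OF A duhi]]])
    qed
    also have "\<dots> = (\<integral>r. (\<integral>s. indicator {..<t} s *\<^sub>R A (indicator {..<s} r *\<^sub>R E (s - r) (h r)) \<partial>Lon T) \<partial>Lon T)"
      by (rule P.Fubini_integral[symmetric], unfold case_prod_unfold, rule it)
    also have "\<dots> = (\<integral>r. indicator {..<t} r *\<^sub>R (h r - E (t - r) (h r)) \<partial>Lon T)"
    proof (rule Bochner_Integration.integral_cong[OF refl])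
      fix r assume "r \<in> space (Lon T)"
      then have r: "r > 0" "r < T" by auto
      have e: "indicator {..<t} s *\<^sub>R A (indicator {..<s} r *\<^sub>R E (s - r) (h r)) = indicator {r<..<t} s *\<^sub>R A (E (s - r) (h r))" for s
        using linear_0[OF bounded_linear.linear[OF A]] by (auto simp: indicator_def)
      show "(\<integral>s. indicator {..<t} s *\<^sub>R A (indicator {..<s} r *\<^sub>R E (s - r) (h r)) \<partial>Lon T) = indicator {..<t} r *\<^sub>R (h r - E (t - r) (h r))"
      proof (cases "r < t")
        case True
        then show ?thesis unfolding e using FTC[of r "h r"] r by simp
      next
        case False
        then have "{r<..<t} = {}" by auto
        then show ?thesis unfolding e using False by simp
      qed
    qed
    finally show ?thesis .
  qed
  note indi = integrable_Lon_lessThan[where t = t]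
  have iA: "integrable (Lon T) (\<lambda>s. A (E s h0))" by (rule integrable_bounded_linear[OF A h0i])
  have iD: "integrable (Lon T) (\<lambda>s. A (\<integral>r. indicator {..<s} r *\<^sub>R E (s - r) (h r) \<partial>Lon T))"
    by (rule integrable_bounded_linear[OF A duhi])
  have iE: "integrable (Lon T) (\<lambda>r. indicator {..<t} r *\<^sub>R E (t - r) (h r))"
  proof (rule Bochner_Integration.integrable_bound[of _ "\<lambda>r. K * norm (h r)"])
    show "(\<lambda>r. indicator {..<t} r *\<^sub>R E (t - r) (h r)) \<in> borel_measurable (Lon T)"
      by (intro borel_measurable_scaleR borel_measurable_Lon_lessThan EE borel_measurable_diff borel_measurable_const
          borel_measurable_lebesgue_on_ident borel_measurable_integrable[OF h])
    show "AE r in Lon T. norm (indicator {..<t} r *\<^sub>R E (t - r) (h r)) \<le> norm (K * norm (h r))"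
    proof (rule AE_I2)
      fix r assume "r \<in> space (Lon T)"
      then have "r < t \<Longrightarrow> norm (E (t - r) (h r)) \<le> K * norm (h r)" using t by (intro EK) auto
      then show "norm (indicator {..<t} r *\<^sub>R E (t - r) (h r)) \<le> norm (K * norm (h r))"
        by (cases "r < t") (auto intro: order_trans[OF _ abs_ge_self])
    qed
  qed (use h in simp)
  have 1: "(\<integral>s. indicator {..<t} s *\<^sub>R A (E s h0) \<partial>Lon T) = h0 - E t h0"
  proof -
    have "(\<integral>s. indicator {..<t} s *\<^sub>R A (E s h0) \<partial>Lon T) = (\<integral>s. indicator {0<..<t} s *\<^sub>R A (E (s - 0) h0) \<partial>Lon T)"
      by (rule Bochner_Integration.integral_cong) (auto simp: indicator_def)
    then show ?thesis using FTC[of 0 h0] t by simp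
  qed
  have "(\<integral>s. indicator {..<t} s *\<^sub>R (h s - A (duhamel T E h0 h s)) \<partial>Lon T)
      = (\<integral>s. indicator {..<t} s *\<^sub>R h s - (indicator {..<t} s *\<^sub>R A (E s h0)
          + indicator {..<t} s *\<^sub>R A (\<integral>r. indicator {..<s} r *\<^sub>R E (s - r) (h r) \<partial>Lon T)) \<partial>Lon T)"
    unfolding duhamel_def linear_add[OF bounded_linear.linear[OF A]] by (simp only: scaleR_diff_right scaleR_add_right)
  also have "\<dots> = (\<integral>s. indicator {..<t} s *\<^sub>R h s \<partial>Lon T) - ((\<integral>s. indicator {..<t} s *\<^sub>R A (E s h0) \<partial>Lon T)
          + (\<integral>s. indicator {..<t} s *\<^sub>R A (\<integral>r. indicator {..<s} r *\<^sub>R E (s - r) (h r) \<partial>Lon T) \<partial>Lon T))"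
    by (simp only: Bochner_Integration.integral_diff[OF indi[OF h] Bochner_Integration.integrable_add[OF indi[OF iA] indi[OF iD]]]
        Bochner_Integration.integral_add[OF indi[OF iA] indi[OF iD]])
  also have "\<dots> = (\<integral>s. indicator {..<t} s *\<^sub>R h s \<partial>Lon T) - (h0 - E t h0
          + ((\<integral>r. indicator {..<t} r *\<^sub>R h r \<partial>Lon T) - (\<integral>r. indicator {..<t} r *\<^sub>R E (t - r) (h r) \<partial>Lon T)))"
    unfolding 1 swap scaleR_diff_right by (simp only: Bochner_Integration.integral_diff[OF indi[OF h] iE])
  finally show "duhamel T E h0 h t = h0 + (\<integral>s. indicator {..<t} s *\<^sub>R (h s - A (duhamel T E h0 h s)) \<partial>Lon T)"
    by (simp add: duhamel_def)
qed

lemma integral_equation_unique: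
  fixes A :: "'a::euclidean_space \<Rightarrow> 'a"
  assumes A: "bounded_linear A" and h: "integrable (Lon T) h"
    and v: "integrable (Lon T) v" "\<And>t. t \<in> {0..T} \<Longrightarrow> v t = h0 + (\<integral>s. indicator {..<t} s *\<^sub>R (h s - A (v s)) \<partial>Lon T)"
    and w: "integrable (Lon T) w" "\<And>t. t \<in> {0..T} \<Longrightarrow> w t = h0 + (\<integral>s. indicator {..<t} s *\<^sub>R (h s - A (w s)) \<partial>Lon T)"
    and t: "t \<in> {0..T}"
  shows "v t = w t"
proof -
  obtain K where K: "K > 0" "\<And>x. norm (A x) \<le> norm x * K" using bounded_linear.pos_bounded[OF A] by blast
  note indi = integrable_Lon_lessThan
  have i: "integrable (Lon T) (\<lambda>s. h s - A (u s))" if "integrable (Lon T) u" for u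
    by (intro Bochner_Integration.integrable_diff h integrable_bounded_linear[OF A that])
  have "v t - w t = 0"
  proof (rule gronwall_zero[OF K(1) _ _ t])
    show "integrable (Lon T) (\<lambda>t. v t - w t)" using v w by simp
    fix t assume t: "t \<in> {0..T}"
    have "v t - w t = (\<integral>s. indicator {..<t} s *\<^sub>R (h s - A (v s)) - indicator {..<t} s *\<^sub>R (h s - A (w s)) \<partial>Lon T)"
      unfolding v(2)[OF t] w(2)[OF t] Bochner_Integration.integral_diff[OF indi[OF i[OF v(1)]] indi[OF i[OF w(1)]]] by simp
    also have "norm \<dots> \<le> (\<integral>s. K * (indicator {..<t} s * norm (v s - w s)) \<partial>Lon T)"
    proof (rule Bochner_Integration.integral_norm_bound_integral)
      show "integrable (Lon T) (\<lambda>s. K * (indicator {..<t} s * norm (v s - w s)))"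
        using indi[where f = "\<lambda>s. norm (v s - w s)" and t = t] v(1) w(1) by simp
      fix s
      have "indicator {..<t} s *\<^sub>R (h s - A (v s)) - indicator {..<t} s *\<^sub>R (h s - A (w s)) = indicator {..<t} s *\<^sub>R A (w s - v s)"
        unfolding linear_diff[OF bounded_linear.linear[OF A]] by (simp flip: scaleR_diff_right)
      then show "norm (indicator {..<t} s *\<^sub>R (h s - A (v s)) - indicator {..<t} s *\<^sub>R (h s - A (w s))) \<le> K * (indicator {..<t} s * norm (v s - w s))"
        using K(2)[of "w s - v s"] by (auto simp: indicator_def norm_minus_commute mult.commute)
    qed (intro Bochner_Integration.integrable_diff indi i v(1) w(1))
    finally show "norm (v t - w t) \<le> K * (\<integral>s. indicator {..<t} s * norm (v s - w s) \<partial>Lon T)" by simp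
  qed
  then show ?thesis by simp
qed

section \<open>The Stokes semigroup on the Fourier side\<close>

lemma Pr_cscale: "Pr \<xi> (cscale c v) = cscale c (Pr \<xi> v)"
  by (simp add: Pr_def cdot_simps cscale_simps)

lemma borel_measurable_Pr:
  assumes [measurable]: "f \<in> borel_measurable M" "g \<in> borel_measurable M"
  shows "(\<lambda>x. Pr (f x) (g x)) \<in> borel_measurable M"
proof -
  have [measurable]: "(\<lambda>x. f x $ j) \<in> borel_measurable M" for j
    by (rule measurable_compose[OF assms(1) borel_measurable_component])
  have [measurable]: "(\<lambda>x. g x $ j) \<in> borel_measurable M" for j
    by (rule measurable_compose[OF assms(2)], intro borel_measurable_continuous_onI continuous_intros)
  have [measurable]: "(\<lambda>x. cdot (f x) (g x)) \<in> borel_measurable M"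
    unfolding cdot_def by measurable
  have [measurable]: "(\<lambda>x. cvec (f x)) \<in> borel_measurable M"
    by (rule measurable_compose[OF assms(1) borel_measurable_cvec])
  show ?thesis unfolding Pr_def by measurable
qed

locale stokes =
  fixes lam Gam0 Gam2 T :: real and V :: "real^'n::finite" and M :: "real^'n^'n"
  assumes Gam2_pos: "Gam2 > 0" and T_pos: "T > 0"
begin

abbreviation symb :: "real^'n \<Rightarrow> complex" where "symb \<equiv> stokes_symbol lam Gam0 Gam2 V"

definition Bop :: "real^'n \<Rightarrow> complex^'n \<Rightarrow> complex^'n" where "Bop \<xi> v = Pr \<xi> (mat_act M v)"

definition Aop :: "real^'n \<Rightarrow> complex^'n \<Rightarrow> complex^'n" where "Aop \<xi> v = cscale (symb \<xi>) v + Bop \<xi> v"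

text \<open>The scalar symbol commutes with \<open>Bop \<xi>\<close>, so the exponential of their
  sum factors. Decay in \<open>\<xi>\<close> is read off the scalar factor, and only the bounded
  part needs a power series.\<close>

definition Eop :: "real^'n \<Rightarrow> real \<Rightarrow> complex^'n \<Rightarrow> complex^'n" where
  "Eop \<xi> t v = cscale (exp (t *\<^sub>R (- symb \<xi>))) (blexp (Bop \<xi>) (- t) v)"

definition bM :: real where "bM = 2 * onorm (mat_act M)"

text \<open>Half of \<open>Gam2\<close> is reserved for decay; the other half absorbs the term with
  \<open>Gam0\<close>, of either sign, by completing the square. The price
  \<open>Gam0\<^sup>2 / (2 * Gam2)\<close> is a growth rate and goes into
  \<open>rate\<close>.\<close>

definition cG :: real where "cG = Gam2 / 2"

definition rate :: real where "rate = bM + Gam0\<^sup>2 / (2 * Gam2)"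

lemma bM_nonneg: "0 \<le> bM"
  using onorm_pos_le[OF bounded_linear_mat_act] by (simp add: bM_def)

lemma rate_nonneg: "0 \<le> rate"
  unfolding rate_def using bM_nonneg Gam2_pos by (intro add_nonneg_nonneg) auto

lemma cG_pos: "cG > 0" using Gam2_pos by (simp add: cG_def)

lemma norm_Bop_le: "norm (Bop \<xi> v) \<le> bM * norm v"
  using norm_Pr_le[of \<xi> "mat_act M v"] onorm[OF bounded_linear_mat_act, of M v]
  unfolding Bop_def bM_def by simp

lemma bounded_linear_Bop: "bounded_linear (Bop \<xi>)"
  unfolding Bop_def[abs_def] by (rule bounded_linear_compose[OF bounded_linear_Pr bounded_linear_mat_act])

lemma bounded_linear_cscale_right: "bounded_linear (cscale c)"
  by (rule bounded_bilinear.bounded_linear_right[OF bounded_bilinear_cscale])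

lemma bounded_linear_Aop: "bounded_linear (Aop \<xi>)"
  unfolding Aop_def[abs_def] by (intro bounded_linear_add bounded_linear_cscale_right bounded_linear_Bop)

lemma Bop_cscale: "Bop \<xi> (cscale c v) = cscale c (Bop \<xi> v)"
  by (simp add: Bop_def mat_act_cscale Pr_cscale)

lemma Bop_blexp: "Bop \<xi> (blexp (Bop \<xi>) t v) = blexp (Bop \<xi>) t (Bop \<xi> v)"
  by (rule blexp_commute[OF norm_Bop_le bM_nonneg bounded_linear_Bop]) (simp flip: funpow_swap1)

lemma Eop_0: "Eop \<xi> 0 v = v"
  by (simp add: Eop_def)

lemma Eop_has_vector_derivative: "((\<lambda>t. Eop \<xi> t v) has_vector_derivative - Aop \<xi> (Eop \<xi> t v)) (at t)"
proof -
  have 1: "((\<lambda>t. exp (t *\<^sub>R (- symb \<xi>))) has_vector_derivative exp (t *\<^sub>R (- symb \<xi>)) * (- symb \<xi>)) (at t)"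
    by (rule exp_scaleR_has_vector_derivative_right)
  have "(((\<lambda>t. blexp (Bop \<xi>) t v) \<circ> uminus) has_vector_derivative (- 1) *\<^sub>R blexp (Bop \<xi>) (- t) (Bop \<xi> v)) (at t)"
    by (intro vector_diff_chain_at blexp_has_vector_derivative[OF norm_Bop_le bM_nonneg]) (auto intro!: derivative_eq_intros)
  then have 2: "((\<lambda>t. blexp (Bop \<xi>) (- t) v) has_vector_derivative - blexp (Bop \<xi>) (- t) (Bop \<xi> v)) (at t)"
    by (simp add: comp_def)
  have "((\<lambda>t. Eop \<xi> t v) has_vector_derivative cscale (exp (t *\<^sub>R (- symb \<xi>))) (- blexp (Bop \<xi>) (- t) (Bop \<xi> v))
      + cscale (exp (t *\<^sub>R (- symb \<xi>)) * (- symb \<xi>)) (blexp (Bop \<xi>) (- t) v)) (at t)"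
    unfolding Eop_def[abs_def]
    by (rule bounded_bilinear.has_vector_derivative[OF bounded_bilinear_cscale 1 2])
  moreover have "cscale (exp (t *\<^sub>R (- symb \<xi>))) (- blexp (Bop \<xi>) (- t) (Bop \<xi> v))
      + cscale (exp (t *\<^sub>R (- symb \<xi>)) * (- symb \<xi>)) (blexp (Bop \<xi>) (- t) v) = - Aop \<xi> (Eop \<xi> t v)"
    unfolding Aop_def Eop_def Bop_cscale Bop_blexp by (simp add: vec_eq_iff algebra_simps)
  ultimately show ?thesis by (simp only:)
qed

lemma Re_sym_ge: "cG * norm \<xi> ^ 4 - Gam0\<^sup>2 / (2 * Gam2) \<le> Re (symb \<xi>)"
proof -
  define y where "y = (norm \<xi>)\<^sup>2"
  have r: "Re (symb \<xi>) = Gam0 * y + Gam2 * y\<^sup>2" by (simp add: stokes_symbol_def y_def)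
  have "0 \<le> (Gam2 * y + Gam0)\<^sup>2 / (2 * Gam2)" using Gam2_pos by simp
  also have "\<dots> = Gam0 * y + Gam2 * y\<^sup>2 - (cG * y\<^sup>2 - Gam0\<^sup>2 / (2 * Gam2))"
    using Gam2_pos unfolding cG_def by (simp add: field_simps power2_eq_square)
  finally show ?thesis unfolding r by (simp add: y_def)
qed

lemma norm_Eop_le:
  assumes "0 \<le> t" "t \<le> T"
  shows "norm (Eop \<xi> t v) \<le> exp (T * rate) * exp (- (cG * norm \<xi> ^ 4 * t)) * norm v"
proof -
  have "norm (Eop \<xi> t v) = exp (- (t * Re (symb \<xi>))) * norm (blexp (Bop \<xi>) (- t) v)"
    by (simp add: Eop_def norm_exp_eq_Re)
  also have "\<dots> \<le> exp (- (t * Re (symb \<xi>))) * (exp (t * bM) * norm v)"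
    using norm_blexp_le[OF norm_Bop_le[of \<xi>] bM_nonneg, where t = "- t" and v = v] assms by (intro mult_left_mono) auto
  also have "\<dots> = exp (t * bM - t * Re (symb \<xi>)) * norm v"
    by (simp add: exp_diff exp_minus field_simps)
  also have "\<dots> \<le> exp (T * rate - cG * norm \<xi> ^ 4 * t) * norm v"
  proof (intro mult_right_mono)
    have "t * (cG * norm \<xi> ^ 4 - Gam0\<^sup>2 / (2 * Gam2)) \<le> t * Re (symb \<xi>)"
      by (intro mult_left_mono Re_sym_ge assms)
    moreover have "t * rate \<le> T * rate" by (intro mult_right_mono assms rate_nonneg)
    ultimately show "exp (t * bM - t * Re (symb \<xi>)) \<le> exp (T * rate - cG * norm \<xi> ^ 4 * t)"
      by (simp add: rate_def algebra_simps)
  qed simp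
  finally show ?thesis by (simp add: exp_diff exp_minus field_simps)
qed

lemma norm_Eop_le_exp:
  assumes "t \<in> {0..T}"
  shows "norm (Eop \<xi> t v) \<le> exp (T * rate) * norm v"
proof -
  have "exp (T * rate) * exp (- (cG * norm \<xi> ^ 4 * t)) * norm v \<le> exp (T * rate) * 1 * norm v"
    using cG_pos assms by (intro mult_right_mono mult_left_mono) auto
  moreover have "norm (Eop \<xi> t v) \<le> exp (T * rate) * exp (- (cG * norm \<xi> ^ 4 * t)) * norm v"
    using assms by (intro norm_Eop_le) auto
  ultimately show ?thesis by linarith
qed

lemma borel_measurable_Bop:
  assumes "f \<in> borel_measurable N" "g \<in> borel_measurable N"
  shows "(\<lambda>x. Bop (f x) (g x)) \<in> borel_measurable N"
proof -
  have "(\<lambda>x. mat_act M (g x)) \<in> borel_measurable N"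
    by (rule measurable_compose[OF assms(2)])
      (intro borel_measurable_continuous_onI linear_continuous_on bounded_linear_mat_act)
  then show ?thesis unfolding Bop_def by (intro borel_measurable_Pr assms(1))
qed

lemma borel_measurable_Eop:
  assumes f: "f \<in> borel_measurable N" and t: "t \<in> borel_measurable N" and g: "g \<in> borel_measurable N"
  shows "(\<lambda>x. Eop (f x) (t x) (g x)) \<in> borel_measurable N"
proof -
  have p: "(\<lambda>x. (Bop (f x) ^^ k) (g x)) \<in> borel_measurable N" for k
    by (induction k) (use g borel_measurable_Bop[OF f] in auto)
  have b: "(\<lambda>x. blexp (Bop (f x)) (- t x) (g x)) \<in> borel_measurable N"
    unfolding blexp_def using p t by measurable
  have s: "(\<lambda>x. symb (f x)) \<in> borel_measurable N"
    by (rule measurable_compose[OF f borel_measurable_stokes_symbol])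
  then have "(\<lambda>x. exp (t x *\<^sub>R (- symb (f x)))) \<in> borel_measurable N" using t by measurable
  then show ?thesis unfolding Eop_def by (intro borel_measurable_cscale b)
qed

lemma borel_measurable_Aop:
  assumes f: "f \<in> borel_measurable N" and g: "g \<in> borel_measurable N"
  shows "(\<lambda>x. Aop (f x) (g x)) \<in> borel_measurable N"
  unfolding Aop_def
  by (intro borel_measurable_add borel_measurable_cscale borel_measurable_Bop assms
      measurable_compose[OF f borel_measurable_stokes_symbol])

text \<open>Every positive power of \<open>Bop \<xi>\<close> ends with \<open>Pr \<xi>\<close>, and
  the zeroth power is covered by the assumption, so the whole series stays in the range of the
  projection.\<close>

lemma Pr_Eop:
  assumes "Pr \<xi> v = v"
  shows "Pr \<xi> (Eop \<xi> t v) = Eop \<xi> t v"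
proof -
  have "Pr \<xi> ((Bop \<xi> ^^ k) v) = (Bop \<xi> ^^ k) v" for k
    by (cases k) (simp_all add: assms Bop_def)
  then have "Pr \<xi> (blexp (Bop \<xi>) (- t) v) = blexp (Bop \<xi>) (- t) v"
    by (rule blexp_commute[OF norm_Bop_le bM_nonneg bounded_linear_Pr])
  then show ?thesis by (simp add: Eop_def Pr_cscale)
qed

text \<open>For every \<open>\<rho> \<ge> 0\<close> the integral of
  \<open>1 + \<rho> * exp (- (cG * \<rho> * t))\<close> over the time interval is at most
  \<open>T + 1 / cG\<close>; the remaining factor bounds the exponential growth on that
  interval.\<close>

definition smooth_const :: real where "smooth_const = exp (T * rate) * (T + 1 / cG)"

text \<open>Maximal regularity comes from this bound being uniform in \<open>\<xi>\<close>.\<close>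
lemma nn_integral_weighted_kernel_le:
  assumes s: "0 \<le> s" "s \<le> T"
  shows "(\<integral>\<^sup>+t. ennreal (indicator {s<..<T} t * ((1 + norm \<xi> ^ 4) * (exp (T * rate) * exp (- (cG * norm \<xi> ^ 4 * (t - s)))))) \<partial>Lon T)
    \<le> ennreal smooth_const"
proof -
  define \<rho> where "\<rho> = norm \<xi> ^ 4"
  have \<rho>: "0 \<le> \<rho>" by (simp add: \<rho>_def)
  \<comment> \<open>Replacing \<open>(1 + \<rho>)\<close> times the exponential by 1 plus
    \<open>\<rho>\<close> times the exponential gives a primitive without division by
    \<open>\<rho>\<close>, valid at \<open>\<rho> = 0\<close> as well.\<close>
  define f where "f t = exp (T * rate) * (1 + \<rho> * exp (- (cG * \<rho> * (t - s))))" for t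
  define F where "F t = exp (T * rate) * (t - exp (- (cG * \<rho> * (t - s))) / cG)" for t
  have F: "(F has_vector_derivative f t) (at t)" for t
    unfolding F_def f_def using cG_pos
    by (auto intro!: derivative_eq_intros simp: field_simps simp flip: has_real_derivative_iff_has_vector_derivative)
  have c: "continuous_on UNIV f" unfolding f_def by (intro continuous_intros)
  note FTC = integral_Lon_FTC[OF s order_refl F c]
  have "(\<integral>\<^sup>+t. ennreal (indicator {s<..<T} t * ((1 + norm \<xi> ^ 4) * (exp (T * rate) * exp (- (cG * norm \<xi> ^ 4 * (t - s)))))) \<partial>Lon T)
      \<le> (\<integral>\<^sup>+t. ennreal (indicator {s<..<T} t *\<^sub>R f t) \<partial>Lon T)"
  proof (intro nn_integral_mono ennreal_leI)
    fix t
    have "(1 + \<rho>) * exp (- (cG * \<rho> * (t - s))) \<le> 1 + \<rho> * exp (- (cG * \<rho> * (t - s)))" if "t > s"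
      using mult_nonneg_nonneg[OF mult_nonneg_nonneg[of cG \<rho>], of "t - s"] that \<rho> cG_pos
      by (simp only: ring_distribs mult_1_left mult_1_right add_right_mono) simp
    then have "t > s \<Longrightarrow> exp (T * rate) * ((1 + \<rho>) * exp (- (cG * \<rho> * (t - s)))) \<le> f t"
      unfolding f_def by (intro mult_left_mono) auto
    then show "indicator {s<..<T} t * ((1 + norm \<xi> ^ 4) * (exp (T * rate) * exp (- (cG * norm \<xi> ^ 4 * (t - s))))) \<le> indicator {s<..<T} t *\<^sub>R f t"
      unfolding \<rho>_def[symmetric] by (auto simp: indicator_def mult_ac)
  qed
  also have "\<dots> = ennreal (F T - F s)"
    unfolding FTC(1)[symmetric]
    by (rule nn_integral_eq_integral[OF FTC(2)]) (auto simp: f_def indicator_def \<rho>)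
  also have "\<dots> \<le> ennreal smooth_const"
  proof (rule ennreal_leI)
    have "T - exp (- (cG * \<rho> * (T - s))) / cG - (s - 1 / cG) \<le> T + 1 / cG"
      using s divide_nonneg_pos[OF exp_ge_zero cG_pos, of "- (cG * \<rho> * (T - s))"] by linarith
    then show "F T - F s \<le> smooth_const"
      unfolding F_def smooth_const_def by (simp flip: right_diff_distrib)
  qed
  finally show ?thesis .
qed

section \<open>Weighted estimate of the solution at one frequency\<close>

definition fsol :: "(real^'n \<Rightarrow> complex^'n) \<Rightarrow> (real \<Rightarrow> real^'n \<Rightarrow> complex^'n) \<Rightarrow> real \<Rightarrow> real^'n \<Rightarrow> complex^'n" where
  "fsol h0 h t \<xi> = duhamel T (Eop \<xi>) (h0 \<xi>) (\<lambda>s. h s \<xi>) t"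

text \<open>A function that is not integrable has Bochner integral 0, so this bound can be used
  before integrability is established.\<close>

lemma ennreal_norm_integral_le:
  fixes f :: "'a \<Rightarrow> 'b::{banach,second_countable_topology}"
  shows "ennreal (norm (integral\<^sup>L N f)) \<le> (\<integral>\<^sup>+x. ennreal (norm (f x)) \<partial>N)"
  by (cases "integrable N f") (simp_all add: integral_norm_bound_ennreal not_integrable_integral_eq)

text \<open>A convolution estimate of Young type: after exchanging the two times, a source at time
  \<open>s\<close> contributes at most \<open>smooth_const\<close> times its norm, and the initial
  value acts like a source at time 0. Extended nonnegative integrals let one computation prove both
  finiteness and the bound.\<close>

lemma nn_integral_weighted_fsol_le:
  assumes hm: "(\<lambda>s. h s \<xi>) \<in> borel_measurable (Lon T)"
  shows "(\<integral>\<^sup>+t. ennreal ((1 + norm \<xi> ^ 4) * norm (fsol h0 h t \<xi>)) \<partial>Lon T)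
    \<le> ennreal smooth_const * (ennreal (norm (h0 \<xi>)) + (\<integral>\<^sup>+s. ennreal (norm (h s \<xi>)) \<partial>Lon T))"
proof -
  interpret L: finite_measure "Lon T" by (rule finite_measure_Lon)
  interpret P: pair_sigma_finite "Lon T" "Lon T" ..
  define \<kappa> where "\<kappa> s t = indicator {s<..<T} t * ((1 + norm \<xi> ^ 4) * (exp (T * rate) * exp (- (cG * norm \<xi> ^ 4 * (t - s)))))" for s t :: real
  have \<kappa>0: "0 \<le> \<kappa> s t" for s t by (simp add: \<kappa>_def)
  have \<kappa>int: "(\<integral>\<^sup>+t. ennreal (\<kappa> s t) \<partial>Lon T) \<le> ennreal smooth_const" if "0 \<le> s" "s \<le> T" for s
    unfolding \<kappa>_def by (rule nn_integral_weighted_kernel_le[OF that])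
  have kE: "(1 + norm \<xi> ^ 4) * norm (Eop \<xi> (t - s) v) \<le> \<kappa> s t * norm v" if "0 \<le> s" "s < t" "t < T" for s t v
  proof -
    have "(1 + norm \<xi> ^ 4) * norm (Eop \<xi> (t - s) v) \<le> (1 + norm \<xi> ^ 4) * (exp (T * rate) * exp (- (cG * norm \<xi> ^ 4 * (t - s))) * norm v)"
      using that by (intro mult_left_mono norm_Eop_le) auto
    then show ?thesis using that by (simp add: \<kappa>_def mult_ac)
  qed
  have id: "(\<lambda>t. t) \<in> borel_measurable (Lon T)" by (rule borel_measurable_lebesgue_on_ident)
  have fs: "fst \<in> borel_measurable (Lon T \<Otimes>\<^sub>M Lon T)" "snd \<in> borel_measurable (Lon T \<Otimes>\<^sub>M Lon T)"
    using measurable_compose[OF measurable_fst borel_measurable_lebesgue_on_ident, of "{0<..<T}" "Lon T"]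
      measurable_compose[OF measurable_snd borel_measurable_lebesgue_on_ident, of "Lon T" "{0<..<T}"] by simp_all
  have \<kappa>b: "(\<lambda>p. \<kappa> (snd p) (fst p)) \<in> borel_measurable (borel \<Otimes>\<^sub>M borel)"
    unfolding \<kappa>_def greaterThanLessThan_iff indicator_def by measurable
  have \<kappa>m: "(\<lambda>p. \<kappa> (snd p) (fst p)) \<in> borel_measurable (Lon T \<Otimes>\<^sub>M Lon T)"
    using measurable_compose[OF measurable_Pair[OF fs] \<kappa>b] by simp
  have \<kappa>1: "(\<lambda>t. \<kappa> s t) \<in> borel_measurable (Lon T)" for s
    using measurable_compose[OF measurable_Pair[OF id measurable_const[of s]] \<kappa>b] by simp
  have kh: "(\<lambda>p. ennreal (\<kappa> (snd p) (fst p) * norm (h (snd p) \<xi>))) \<in> borel_measurable (Lon T \<Otimes>\<^sub>M Lon T)"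
    using \<kappa>m measurable_compose[OF measurable_snd hm, of "Lon T"] by measurable
  have pt: "ennreal ((1 + norm \<xi> ^ 4) * norm (fsol h0 h t \<xi>))
      \<le> ennreal (\<kappa> 0 t) * ennreal (norm (h0 \<xi>)) + (\<integral>\<^sup>+s. ennreal (\<kappa> s t * norm (h s \<xi>)) \<partial>Lon T)" if t: "t \<in> {0<..<T}" for t
  proof -
    define I where "I = (\<integral>s. indicator {..<t} s *\<^sub>R Eop \<xi> (t - s) (h s \<xi>) \<partial>Lon T)"
    have "(1 + norm \<xi> ^ 4) * norm (fsol h0 h t \<xi>) \<le> (1 + norm \<xi> ^ 4) * (norm (Eop \<xi> t (h0 \<xi>)) + norm I)"
      unfolding fsol_def duhamel_def I_def by (intro mult_left_mono norm_triangle_ineq) simp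
    also have "\<dots> \<le> \<kappa> 0 t * norm (h0 \<xi>) + (1 + norm \<xi> ^ 4) * norm I"
      using kE[of 0 t "h0 \<xi>"] t by (simp add: ring_distribs)
    finally have "ennreal ((1 + norm \<xi> ^ 4) * norm (fsol h0 h t \<xi>)) \<le> ennreal (\<kappa> 0 t * norm (h0 \<xi>) + (1 + norm \<xi> ^ 4) * norm I)"
      by (rule ennreal_leI)
    also have "\<dots> = ennreal (\<kappa> 0 t) * ennreal (norm (h0 \<xi>)) + ennreal (1 + norm \<xi> ^ 4) * ennreal (norm I)"
      using \<kappa>0[of 0 t] by (simp add: ennreal_plus ennreal_mult del: ennreal_plus[symmetric])
    also have "ennreal (1 + norm \<xi> ^ 4) * ennreal (norm I)
        \<le> ennreal (1 + norm \<xi> ^ 4) * (\<integral>\<^sup>+s. ennreal (norm (indicator {..<t} s *\<^sub>R Eop \<xi> (t - s) (h s \<xi>))) \<partial>Lon T)"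
      unfolding I_def by (intro mult_left_mono ennreal_norm_integral_le) simp
    also have "\<dots> = (\<integral>\<^sup>+s. ennreal (1 + norm \<xi> ^ 4) * ennreal (norm (indicator {..<t} s *\<^sub>R Eop \<xi> (t - s) (h s \<xi>))) \<partial>Lon T)"
    proof (rule nn_integral_cmult[symmetric])
      have "(\<lambda>s. indicator {..<t} s *\<^sub>R Eop \<xi> (t - s) (h s \<xi>)) \<in> borel_measurable (Lon T)"
        by (intro borel_measurable_scaleR borel_measurable_Lon_lessThan borel_measurable_Eop borel_measurable_diff
            borel_measurable_const id hm)
      then show "(\<lambda>s. ennreal (norm (indicator {..<t} s *\<^sub>R Eop \<xi> (t - s) (h s \<xi>)))) \<in> borel_measurable (Lon T)"
        by (rule measurable_compose) measurable
    qed
    also have "\<dots> \<le> (\<integral>\<^sup>+s. ennreal (\<kappa> s t * norm (h s \<xi>)) \<partial>Lon T)"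
    proof (rule nn_integral_mono)
      fix s assume "s \<in> space (Lon T)"
      then have "(1 + norm \<xi> ^ 4) * norm (indicator {..<t} s *\<^sub>R Eop \<xi> (t - s) (h s \<xi>)) \<le> \<kappa> s t * norm (h s \<xi>)"
        using kE[of s t "h s \<xi>"] \<kappa>0[of s t] t by (cases "s < t") simp_all
      then have "ennreal ((1 + norm \<xi> ^ 4) * norm (indicator {..<t} s *\<^sub>R Eop \<xi> (t - s) (h s \<xi>))) \<le> ennreal (\<kappa> s t * norm (h s \<xi>))"
        by (rule ennreal_leI)
      then show "ennreal (1 + norm \<xi> ^ 4) * ennreal (norm (indicator {..<t} s *\<^sub>R Eop \<xi> (t - s) (h s \<xi>))) \<le> ennreal (\<kappa> s t * norm (h s \<xi>))"
        by (subst (asm) ennreal_mult) auto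
    qed
    finally show ?thesis by (simp add: add_left_mono)
  qed
  have "(\<integral>\<^sup>+t. ennreal ((1 + norm \<xi> ^ 4) * norm (fsol h0 h t \<xi>)) \<partial>Lon T)
      \<le> (\<integral>\<^sup>+t. ennreal (\<kappa> 0 t) * ennreal (norm (h0 \<xi>)) + (\<integral>\<^sup>+s. ennreal (\<kappa> s t * norm (h s \<xi>)) \<partial>Lon T) \<partial>Lon T)"
    by (rule nn_integral_mono) (rule pt, simp)
  also have "\<dots> = (\<integral>\<^sup>+t. ennreal (\<kappa> 0 t) * ennreal (norm (h0 \<xi>)) \<partial>Lon T) + (\<integral>\<^sup>+t. (\<integral>\<^sup>+s. ennreal (\<kappa> s t * norm (h s \<xi>)) \<partial>Lon T) \<partial>Lon T)"
  proof (rule nn_integral_add)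
    show "(\<lambda>t. ennreal (\<kappa> 0 t) * ennreal (norm (h0 \<xi>))) \<in> borel_measurable (Lon T)" using \<kappa>1[of 0] by measurable
    show "(\<lambda>t. \<integral>\<^sup>+s. ennreal (\<kappa> s t * norm (h s \<xi>)) \<partial>Lon T) \<in> borel_measurable (Lon T)"
      using L.borel_measurable_nn_integral_fst[OF kh] by simp
  qed
  also have "(\<integral>\<^sup>+t. ennreal (\<kappa> 0 t) * ennreal (norm (h0 \<xi>)) \<partial>Lon T) = (\<integral>\<^sup>+t. ennreal (\<kappa> 0 t) \<partial>Lon T) * ennreal (norm (h0 \<xi>))"
    by (rule nn_integral_multc) (use \<kappa>1[of 0] in measurable)
  also have "(\<integral>\<^sup>+t. (\<integral>\<^sup>+s. ennreal (\<kappa> s t * norm (h s \<xi>)) \<partial>Lon T) \<partial>Lon T)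
      = (\<integral>\<^sup>+s. (\<integral>\<^sup>+t. ennreal (\<kappa> s t * norm (h s \<xi>)) \<partial>Lon T) \<partial>Lon T)"
    using P.Fubini'[of "\<lambda>t s. ennreal (\<kappa> s t * norm (h s \<xi>))"] kh by (simp add: case_prod_unfold)
  also have "\<dots> \<le> (\<integral>\<^sup>+s. ennreal smooth_const * ennreal (norm (h s \<xi>)) \<partial>Lon T)"
  proof (rule nn_integral_mono)
    fix s assume "s \<in> space (Lon T)"
    then have s: "0 \<le> s" "s \<le> T" by auto
    have "(\<integral>\<^sup>+t. ennreal (\<kappa> s t * norm (h s \<xi>)) \<partial>Lon T) = (\<integral>\<^sup>+t. ennreal (\<kappa> s t) * ennreal (norm (h s \<xi>)) \<partial>Lon T)"
      by (simp add: ennreal_mult \<kappa>0)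
    also have "\<dots> = (\<integral>\<^sup>+t. ennreal (\<kappa> s t) \<partial>Lon T) * ennreal (norm (h s \<xi>))"
      by (rule nn_integral_multc) (use \<kappa>1[of s] in measurable)
    also have "\<dots> \<le> ennreal smooth_const * ennreal (norm (h s \<xi>))"
      by (rule mult_right_mono[OF \<kappa>int[OF s]]) simp
    finally show "(\<integral>\<^sup>+t. ennreal (\<kappa> s t * norm (h s \<xi>)) \<partial>Lon T) \<le> ennreal smooth_const * ennreal (norm (h s \<xi>))" .
  qed
  also have "\<dots> = ennreal smooth_const * (\<integral>\<^sup>+s. ennreal (norm (h s \<xi>)) \<partial>Lon T)"
    by (rule nn_integral_cmult) (use hm in measurable)
  also have "(\<integral>\<^sup>+t. ennreal (\<kappa> 0 t) \<partial>Lon T) * ennreal (norm (h0 \<xi>)) \<le> ennreal smooth_const * ennreal (norm (h0 \<xi>))"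
    using T_pos by (intro mult_right_mono \<kappa>int) auto
  finally show ?thesis by (simp add: distrib_left add_right_mono)
qed

end

section \<open>Time integrals\<close>

text \<open>Only rational end points are tested because the hypothesis will be verified frequency by
  frequency, and one null set of frequencies can serve countably many times only. Dominated
  convergence passes to real end points, and intervals generate the Borel sets.\<close>

lemma AE_Lon_zero_if_integrals_zero:
  fixes g :: "real \<Rightarrow> 'b::{banach,second_countable_topology}"
  assumes g: "integrable (Lon T) g"
    and z: "\<And>q. q \<in> \<rat> \<Longrightarrow> q \<in> {0..T} \<Longrightarrow> (\<integral>s. indicator {..<q} s *\<^sub>R g s \<partial>Lon T) = 0"
    and T: "T > 0"
  shows "AE s in Lon T. g s = 0"
proof -
  have real: "(\<integral>s. indicator {..<t} s *\<^sub>R g s \<partial>Lon T) = 0" if t: "0 < t" "t \<le> T" for t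
  proof -
    \<comment> \<open>The rationals approach \<open>t\<close> strictly from below, since the sets
      \<open>{..<q}\<close> then converge to \<open>{..<t}\<close> with \<open>t\<close>
      excluded.\<close>
    have "\<exists>q\<in>\<rat>. max 0 (t - 1 / real (Suc n)) < q \<and> q < t" for n
      using t by (intro Rats_dense_in_real) simp
    then have "\<forall>n. \<exists>q. q \<in> \<rat> \<and> max 0 (t - 1 / real (Suc n)) < q \<and> q < t" by blast
    from choice[OF this] obtain q where "\<forall>n. q n \<in> \<rat> \<and> max 0 (t - 1 / real (Suc n)) < q n \<and> q n < t" ..
    then have q: "\<And>n. q n \<in> \<rat>" "\<And>n. max 0 (t - 1 / real (Suc n)) < q n" "\<And>n. q n < t" by simp_all
    have "(\<lambda>n. \<integral>s. indicator {..<q n} s *\<^sub>R g s \<partial>Lon T) \<longlonglongrightarrow> (\<integral>s. indicator {..<t} s *\<^sub>R g s \<partial>Lon T)"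
    proof (rule integral_dominated_convergence[where w = "\<lambda>s. norm (g s)"])
      show "AE s in Lon T. (\<lambda>n. indicator {..<q n} s *\<^sub>R g s) \<longlonglongrightarrow> indicator {..<t} s *\<^sub>R g s"
      proof (rule AE_I2)
        fix s
        show "(\<lambda>n. indicator {..<q n} s *\<^sub>R g s) \<longlonglongrightarrow> indicator {..<t} s *\<^sub>R g s"
        proof (rule tendsto_eventually)
          show "\<forall>\<^sub>F n in sequentially. indicator {..<q n} s *\<^sub>R g s = indicator {..<t} s *\<^sub>R g s"
          proof (cases "s < t")
            case True
            then obtain N where N: "1 / (t - s) < real N" using reals_Archimedean2 by blast
            have "s < q n" if "n \<ge> N" for n
            proof -
              have "1 / (t - s) < real (Suc n)" using N that by linarith
              then have "1 / real (Suc n) < t - s" using True by (simp add: field_simps)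
              then show ?thesis using q(2)[of n] by linarith
            qed
            then show ?thesis using True by (intro eventually_sequentiallyI[of N]) simp
          next
            case False
            then have "\<not> s < q n" for n using q(3)[of n] by linarith
            then show ?thesis using False by simp
          qed
        qed
      qed
      show "AE s in Lon T. norm (indicator {..<q n} s *\<^sub>R g s) \<le> norm (g s)" for n
        by (intro AE_I2) (simp add: indicator_def)
    qed (use g borel_measurable_integrable[OF integrable_Lon_lessThan[OF g]] in simp_all)
    moreover have "(\<integral>s. indicator {..<q n} s *\<^sub>R g s \<partial>Lon T) = 0" for n
      using q[of n] t by (intro z) simp_all
    ultimately show ?thesis by (simp add: LIMSEQ_const_iff)
  qed
  define G where "G = (\<lambda>t. {0<..<T} \<inter> {..<t}) ` (UNIV :: real set)"
  show ?thesis
  proof (rule AE_zero_if_integral_zero_on_generator[OF _ g])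
    show "sigma_finite_measure (Lon T)" by (rule finite_measure.axioms[OF finite_measure_Lon])
    show "G \<subseteq> sets (Lon T)"
    proof
      fix A assume "A \<in> G"
      then obtain t where A: "A = {0<..<T} \<inter> {..<t}" unfolding G_def by (elim imageE)
      show "A \<in> sets (Lon T)" unfolding A by (subst sets_restrict_space_iff) simp_all
    qed
    show "Int_stable G"
    proof (rule Int_stableI)
      fix a b assume "a \<in> G" "b \<in> G"
      then obtain t u where "a = {0<..<T} \<inter> {..<t}" "b = {0<..<T} \<inter> {..<u}" unfolding G_def by (elim imageE)
      then have "a \<inter> b = {0<..<T} \<inter> {..<min t u}" by (simp add: set_eq_iff) linarith
      then show "a \<inter> b \<in> G" unfolding G_def by (rule image_eqI) simp
    qed
    have full: "(\<integral>s. g s \<partial>Lon T) = 0"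
    proof -
      have "(\<integral>s. indicator {..<T} s *\<^sub>R g s \<partial>Lon T) = (\<integral>s. g s \<partial>Lon T)"
        by (rule Bochner_Integration.integral_cong) auto
      then show ?thesis using real[of T] T by simp
    qed
    then show "integral\<^sup>L (Lon T) g = 0" .
    fix A
    { assume "A \<in> G"
      then obtain t where A: "A = {0<..<T} \<inter> {..<t}" unfolding G_def by blast
      have "set_lebesgue_integral (Lon T) A g = (\<integral>s. indicator {..<t} s *\<^sub>R g s \<partial>Lon T)"
        unfolding set_lebesgue_integral_def A by (rule Bochner_Integration.integral_cong) (auto simp: indicator_def)
      also have "\<dots> = 0"
      proof (cases "t \<le> 0")
        case True
        then have "(\<integral>s. indicator {..<t} s *\<^sub>R g s \<partial>Lon T) = (\<integral>s. 0 \<partial>Lon T)"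
          by (intro Bochner_Integration.integral_cong) (auto simp: indicator_def)
        then show ?thesis by simp
      next
        case False
        show ?thesis
        proof (cases "t \<le> T")
          case True then show ?thesis using real False by simp
        next
          case tT: False
          then have "(\<integral>s. indicator {..<t} s *\<^sub>R g s \<partial>Lon T) = (\<integral>s. g s \<partial>Lon T)"
            by (intro Bochner_Integration.integral_cong) (auto simp: indicator_def)
          then show ?thesis using full by simp
        qed
      qed
      finally show "set_lebesgue_integral (Lon T) A g = 0" . }
    assume "A \<in> sets (Lon T)"
    then have A: "A \<in> sets lebesgue" "A \<subseteq> {0<..<T}" by (simp_all add: sets_restrict_space_iff)
    \<comment> \<open>The main part of a Lebesgue measurable set is Borel and differs from the set
      by a null set.\<close>
    define B where "B = {0<..<T} \<inter> main_part lborel A"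
    have "main_part lborel A \<in> sets (borel :: real measure)" using main_part_sets[OF A(1)] by simp
    then have "main_part lborel A \<in> sigma_sets UNIV (range lessThan)"
      by (simp add: borel_Iio)
    then have "B \<in> (\<inter>) {0<..<T} ` sigma_sets UNIV (range lessThan)" unfolding B_def by (rule imageI)
    also have "\<dots> = sigma_sets {0<..<T} ((\<inter>) {0<..<T} ` range lessThan)"
    proof (rule sigma_sets_Int)
      have "{0<..<T} \<in> sets (borel :: real measure)" by simp
      then show "{0<..<T} \<in> sigma_sets UNIV (range lessThan)" by (simp add: borel_Iio)
    qed simp
    also have "(\<inter>) {0<..<T} ` range lessThan = G" unfolding G_def by auto
    finally have B: "B \<in> sigma_sets (space (Lon T)) G" by simp
    have "AE x in lebesgue. x \<in> main_part lborel A \<longleftrightarrow> x \<in> A"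
      by (rule AE_completion[OF AE_in_main_part[OF A(1)]])
    then have "AE x in Lon T. x \<in> A \<longleftrightarrow> x \<in> B"
      unfolding AE_Lon by eventually_elim (auto simp: B_def)
    with B show "\<exists>B\<in>sigma_sets (space (Lon T)) G. AE x in Lon T. x \<in> A \<longleftrightarrow> x \<in> B" by blast
  qed
qed

text \<open>Exchanging the two quantifiers requires the set of equality to be measurable in the
  product; joint measurability of both sides provides that.\<close>

lemma AE_Lon_swap:
  fixes f g :: "real \<Rightarrow> 'a \<Rightarrow> 'b::euclidean_space"
  assumes \<nu>: "finite_measure \<nu>"
    and f: "(\<lambda>p. f (fst p) (snd p)) \<in> borel_measurable (Lon T \<Otimes>\<^sub>M \<nu>)"
    and g: "(\<lambda>p. g (fst p) (snd p)) \<in> borel_measurable (Lon T \<Otimes>\<^sub>M \<nu>)"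
  shows "(AE t in Lon T. AE \<xi> in \<nu>. f t \<xi> = g t \<xi>) \<longleftrightarrow> (AE \<xi> in \<nu>. AE t in Lon T. f t \<xi> = g t \<xi>)"
proof -
  interpret L: finite_measure "Lon T" by (rule finite_measure_Lon)
  interpret N: finite_measure \<nu> by (rule \<nu>)
  interpret P: pair_sigma_finite "Lon T" \<nu> ..
  have "(\<lambda>p. f (fst p) (snd p) - g (fst p) (snd p)) -` {0} \<inter> space (Lon T \<Otimes>\<^sub>M \<nu>) \<in> sets (Lon T \<Otimes>\<^sub>M \<nu>)"
    by (rule measurable_sets[OF borel_measurable_diff[OF f g]]) simp
  moreover have "(\<lambda>p. f (fst p) (snd p) - g (fst p) (snd p)) -` {0} \<inter> space (Lon T \<Otimes>\<^sub>M \<nu>)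
      = {p \<in> space (Lon T \<Otimes>\<^sub>M \<nu>). f (fst p) (snd p) = g (fst p) (snd p)}" by auto
  ultimately show ?thesis by (intro P.AE_commute) (simp only:)
qed

lemma set_integral_lebesgue_Icc:
  fixes f :: "real \<Rightarrow> 'b::{banach,second_countable_topology}"
  assumes f: "integrable (Lon T) f" and t: "t \<in> {0..T}"
  shows "(LINT s:{0..t}|lebesgue. f s) = (\<integral>s. indicator {..<t} s *\<^sub>R f s \<partial>Lon T)"
proof -
  have sing: "AE s in lebesgue. s \<noteq> a" for a :: real
    by (rule AE_completion[OF AE_lborel_singleton])
  have m: "(\<lambda>s. indicator {0<..<T} s *\<^sub>R (indicator {..<t} s *\<^sub>R f s)) \<in> borel_measurable lebesgue"
    using borel_measurable_integrable[OF integrable_Lon_lessThan[OF f, of t]] by (subst (asm) borel_measurable_restrict_space_iff) simp_all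
  have eq: "AE s in lebesgue. indicator {0<..<T} s *\<^sub>R (indicator {..<t} s *\<^sub>R f s) = indicator {0..t} s *\<^sub>R f s"
    using sing[of 0] sing[of t] by eventually_elim (use t in \<open>auto simp: indicator_def\<close>)
  \<comment> \<open>At the end points \<open>f\<close> is unconstrained by integrability on the open
    interval, so measurability over the closed one comes from completeness.\<close>
  have m2: "(\<lambda>s. indicator {0..t} s *\<^sub>R f s) \<in> borel_measurable lebesgue"
  proof -
    have e2: "AE s in lebesgue_on UNIV. indicator {0..t} s *\<^sub>R f s = indicator {0<..<T} s *\<^sub>R (indicator {..<t} s *\<^sub>R f s)"
      unfolding lebesgue_on_UNIV_eq using eq by eventually_elim (erule sym)
    show ?thesis
      using borel_measurable_lebesgue_on_AE_eq[OF _ _ e2] m by (simp add: lebesgue_on_UNIV_eq)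
  qed
  have "(\<integral>s. indicator {..<t} s *\<^sub>R f s \<partial>Lon T) = (\<integral>s. indicator {0<..<T} s *\<^sub>R (indicator {..<t} s *\<^sub>R f s) \<partial>lebesgue)"
    by (rule integral_restrict_space) simp
  also have "\<dots> = (\<integral>s. indicator {0..t} s *\<^sub>R f s \<partial>lebesgue)"
    by (rule integral_cong_AE[OF m m2 eq])
  finally show ?thesis by (simp add: set_lebesgue_integral_def)
qed

text \<open>Fubini moves the time integral inside the Fourier transform. This translates the
  identity in \<open>W11_FM\<close>, stated for each point \<open>x\<close>, into an identity of
  densities.\<close>

lemma fourier_meas_time_integral:
  fixes z :: "real \<Rightarrow> real^'n \<Rightarrow> complex^'m"
  assumes \<nu>: "finite_measure \<nu>" "sets \<nu> = sets borel"
    and z: "integrable (Lon T \<Otimes>\<^sub>M \<nu>) (\<lambda>p. z (fst p) (snd p))"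
    and v: "AE s in Lon T. v s = fourier_meas \<nu> (z s)" and t: "t \<in> {0..T}"
    and vi: "integrable (Lon T) (\<lambda>s. v s x)"
  shows "integrable \<nu> (\<lambda>\<xi>. \<integral>s. indicator {..<t} s *\<^sub>R z s \<xi> \<partial>Lon T)"
    and "(LINT s:{0..t}|lebesgue. v s x) = fourier_meas \<nu> (\<lambda>\<xi>. \<integral>s. indicator {..<t} s *\<^sub>R z s \<xi> \<partial>Lon T) x"
proof -
  interpret L: finite_measure "Lon T" by (rule finite_measure_Lon)
  interpret N: finite_measure \<nu> by (rule \<nu>)
  interpret P: pair_sigma_finite "Lon T" \<nu> ..
  have zm: "(\<lambda>p. z (fst p) (snd p)) \<in> borel_measurable (Lon T \<Otimes>\<^sub>M \<nu>)" by (rule borel_measurable_integrable[OF z])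
  have im: "(\<lambda>p. indicator {..<t} (fst p) :: real) \<in> borel_measurable (Lon T \<Otimes>\<^sub>M \<nu>)"
    by (rule measurable_compose[OF measurable_fst borel_measurable_Lon_lessThan])
  have em: "(\<lambda>p. ek x (snd p)) \<in> borel_measurable (Lon T \<Otimes>\<^sub>M \<nu>)"
    by (rule measurable_compose[OF measurable_snd measurable_if_sets_borel[OF \<nu>(2) borel_measurable_ek]])
  have i1: "integrable (Lon T \<Otimes>\<^sub>M \<nu>) (\<lambda>p. indicator {..<t} (fst p) *\<^sub>R z (fst p) (snd p))"
    by (rule Bochner_Integration.integrable_bound[OF z borel_measurable_scaleR[OF im zm]]) (auto simp: indicator_def)
  have i2: "integrable (Lon T \<Otimes>\<^sub>M \<nu>) (\<lambda>p. cscale (ek x (snd p)) (indicator {..<t} (fst p) *\<^sub>R z (fst p) (snd p)))"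
    by (rule Bochner_Integration.integrable_bound[OF i1 borel_measurable_cscale[OF em borel_measurable_integrable[OF i1]]]) simp
  have i1': "integrable (Lon T \<Otimes>\<^sub>M \<nu>) (case_prod (\<lambda>s \<xi>. indicator {..<t} s *\<^sub>R z s \<xi>))"
    using i1 by (simp add: case_prod_unfold)
  have i2': "integrable (Lon T \<Otimes>\<^sub>M \<nu>) (case_prod (\<lambda>s \<xi>. cscale (ek x \<xi>) (indicator {..<t} s *\<^sub>R z s \<xi>)))"
    using i2 by (simp add: case_prod_unfold)
  show I: "integrable \<nu> (\<lambda>\<xi>. \<integral>s. indicator {..<t} s *\<^sub>R z s \<xi> \<partial>Lon T)"
    by (rule P.integrable_snd[OF i1'])
  have ae: "AE s in Lon T. indicator {..<t} s *\<^sub>R v s x = (\<integral>\<xi>. cscale (ek x \<xi>) (indicator {..<t} s *\<^sub>R z s \<xi>) \<partial>\<nu>)"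
    using v P.AE_integrable_fst'[OF z]
  proof eventually_elim
    case (elim s)
    then have zi: "integrable \<nu> (z s)" by simp
    show ?case
      unfolding elim(1) fourier_meas_eq[OF \<nu>(2) zi] bounded_bilinear.scaleR_right[OF bounded_bilinear_cscale] by simp
  qed
  have "(LINT s:{0..t}|lebesgue. v s x) = (\<integral>s. indicator {..<t} s *\<^sub>R v s x \<partial>Lon T)"
    by (rule set_integral_lebesgue_Icc[OF vi t])
  also have "\<dots> = (\<integral>s. (\<integral>\<xi>. cscale (ek x \<xi>) (indicator {..<t} s *\<^sub>R z s \<xi>) \<partial>\<nu>) \<partial>Lon T)"
    by (rule integral_cong_AE[OF borel_measurable_integrable[OF integrable_Lon_lessThan[OF vi]]
          borel_measurable_integrable[OF P.integrable_fst[OF i2']] ae])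
  also have "\<dots> = (\<integral>\<xi>. (\<integral>s. cscale (ek x \<xi>) (indicator {..<t} s *\<^sub>R z s \<xi>) \<partial>Lon T) \<partial>\<nu>)"
    by (rule P.Fubini_integral[symmetric, OF i2'])
  also have "\<dots> = (\<integral>\<xi>. cscale (ek x \<xi>) (\<integral>s. indicator {..<t} s *\<^sub>R z s \<xi> \<partial>Lon T) \<partial>\<nu>)"
  proof (rule integral_cong_AE)
    show "AE \<xi> in \<nu>. (\<integral>s. cscale (ek x \<xi>) (indicator {..<t} s *\<^sub>R z s \<xi>) \<partial>Lon T) = cscale (ek x \<xi>) (\<integral>s. indicator {..<t} s *\<^sub>R z s \<xi> \<partial>Lon T)"
      using P.AE_integrable_snd[OF i1']
      by eventually_elim (rule integral_bounded_linear[OF bounded_bilinear.bounded_linear_right[OF bounded_bilinear_cscale]])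
    show "(\<lambda>\<xi>. \<integral>s. cscale (ek x \<xi>) (indicator {..<t} s *\<^sub>R z s \<xi>) \<partial>Lon T) \<in> borel_measurable \<nu>"
      by (rule borel_measurable_integrable[OF P.integrable_snd[OF i2']])
    show "(\<lambda>\<xi>. cscale (ek x \<xi>) (\<integral>s. indicator {..<t} s *\<^sub>R z s \<xi> \<partial>Lon T)) \<in> borel_measurable \<nu>"
      by (rule borel_measurable_integrable[OF integrable_cscale_ek[OF \<nu>(2) I]])
  qed
  also have "\<dots> = fourier_meas \<nu> (\<lambda>\<xi>. \<integral>s. indicator {..<t} s *\<^sub>R z s \<xi> \<partial>Lon T) x"
    by (rule fourier_meas_eq[symmetric, OF \<nu>(2) I])
  finally show "(LINT s:{0..t}|lebesgue. v s x) = fourier_meas \<nu> (\<lambda>\<xi>. \<integral>s. indicator {..<t} s *\<^sub>R z s \<xi> \<partial>Lon T) x" .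
qed

section \<open>The Duhamel solution as a function of time and frequency\<close>

context stokes
begin

lemma borel_measurable_duhamel_integrand:
  assumes \<nu>: "sets \<nu> = sets borel"
    and hm: "(\<lambda>p. h (fst p) (snd p)) \<in> borel_measurable (Lon T \<Otimes>\<^sub>M \<nu>)"
  shows "(\<lambda>q. indicator {..<fst (fst q)} (snd q) *\<^sub>R Eop (snd (fst q)) (fst (fst q) - snd q) (h (snd q) (snd (fst q))))
      \<in> borel_measurable ((Lon T \<Otimes>\<^sub>M \<nu>) \<Otimes>\<^sub>M Lon T)"
proof -
  let ?N = "(Lon T \<Otimes>\<^sub>M \<nu>) \<Otimes>\<^sub>M Lon T"
  note id = borel_measurable_lebesgue_on_ident[of "{0<..<T}"]
  have t: "(\<lambda>q. fst (fst q)) \<in> borel_measurable ?N"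
    by (rule measurable_compose[OF measurable_fst measurable_compose[OF measurable_fst id]])
  have s: "(\<lambda>q. snd q) \<in> borel_measurable ?N"
    by (rule measurable_compose[OF measurable_snd id])
  have x: "(\<lambda>q. snd (fst q)) \<in> borel_measurable ?N"
    by (rule measurable_compose[OF measurable_compose[OF measurable_fst measurable_snd]])
      (simp add: measurable_ident_sets \<nu>)
  have hq: "(\<lambda>q. h (snd q) (snd (fst q))) \<in> borel_measurable ?N"
    using measurable_compose[OF measurable_Pair[OF measurable_snd measurable_compose[OF measurable_fst measurable_snd]] hm, of "Lon T"]
    by simp
  have i: "(\<lambda>q. indicator {..<fst (fst q)} (snd q) :: real) \<in> borel_measurable ?N"
  proof -
    have "(\<lambda>x. if snd x < fst x then 1 else 0 :: real) \<in> borel_measurable (borel \<Otimes>\<^sub>M (borel :: real measure))" by measurable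
    from measurable_compose[OF measurable_Pair[OF t s] this] show ?thesis by (simp add: indicator_def of_bool_def)
  qed
  show ?thesis
    by (intro borel_measurable_scaleR i borel_measurable_Eop x borel_measurable_diff t s hq)
qed

text \<open>The second claim has its own proof because joint measurability controls sections only at
  times in the open interval, whereas \<open>u t\<close> must be represented at 0 and
  \<open>T\<close> too.\<close>

lemma borel_measurable_fsol:
  assumes \<nu>: "sets \<nu> = sets borel" and h0: "h0 \<in> borel_measurable \<nu>"
    and hm: "(\<lambda>p. h (fst p) (snd p)) \<in> borel_measurable (Lon T \<Otimes>\<^sub>M \<nu>)"
  shows "(\<lambda>p. fsol h0 h (fst p) (snd p)) \<in> borel_measurable (Lon T \<Otimes>\<^sub>M \<nu>)"
    and "fsol h0 h t \<in> borel_measurable \<nu>"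
proof -
  interpret L: finite_measure "Lon T" by (rule finite_measure_Lon)
  note id = borel_measurable_lebesgue_on_ident[of "{0<..<T}"]
  have idn: "(\<lambda>x. x) \<in> borel_measurable \<nu>" by (simp add: measurable_ident_sets \<nu>)
  have "(\<lambda>p. \<integral>s. indicator {..<fst p} s *\<^sub>R Eop (snd p) (fst p - s) (h s (snd p)) \<partial>Lon T) \<in> borel_measurable (Lon T \<Otimes>\<^sub>M \<nu>)"
    by (rule L.borel_measurable_lebesgue_integral)
      (use borel_measurable_duhamel_integrand[OF \<nu> hm] in \<open>simp add: case_prod_unfold\<close>)
  moreover have "(\<lambda>p. Eop (snd p) (fst p) (h0 (snd p))) \<in> borel_measurable (Lon T \<Otimes>\<^sub>M \<nu>)"
    by (intro borel_measurable_Eop measurable_compose[OF measurable_snd idn] measurable_compose[OF measurable_fst id]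
        measurable_compose[OF measurable_snd h0])
  ultimately show "(\<lambda>p. fsol h0 h (fst p) (snd p)) \<in> borel_measurable (Lon T \<Otimes>\<^sub>M \<nu>)"
    unfolding fsol_def duhamel_def by (rule borel_measurable_add[rotated])
  let ?N = "\<nu> \<Otimes>\<^sub>M Lon T"
  have x: "(\<lambda>q. fst q) \<in> borel_measurable ?N" by (rule measurable_compose[OF measurable_fst idn])
  have s: "(\<lambda>q. snd q) \<in> borel_measurable ?N" by (rule measurable_compose[OF measurable_snd id])
  have hq: "(\<lambda>q. h (snd q) (fst q)) \<in> borel_measurable ?N"
    using measurable_compose[OF measurable_Pair[OF measurable_snd measurable_fst] hm] by simp
  have i: "(\<lambda>q. indicator {..<t} (snd q) :: real) \<in> borel_measurable ?N"
    by (rule measurable_compose[OF measurable_snd borel_measurable_Lon_lessThan])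
  have "(\<lambda>q. indicator {..<t} (snd q) *\<^sub>R Eop (fst q) (t - snd q) (h (snd q) (fst q))) \<in> borel_measurable ?N"
    by (intro borel_measurable_scaleR i borel_measurable_Eop x borel_measurable_diff s hq borel_measurable_const)
  then have "(\<lambda>\<xi>. \<integral>s. indicator {..<t} s *\<^sub>R Eop \<xi> (t - s) (h s \<xi>) \<partial>Lon T) \<in> borel_measurable \<nu>"
    by (intro L.borel_measurable_lebesgue_integral) (simp add: case_prod_unfold)
  moreover have "(\<lambda>\<xi>. Eop \<xi> t (h0 \<xi>)) \<in> borel_measurable \<nu>"
    by (intro borel_measurable_Eop idn h0 borel_measurable_const)
  ultimately have "(\<lambda>\<xi>. fsol h0 h t \<xi>) \<in> borel_measurable \<nu>"
    unfolding fsol_def duhamel_def by (rule borel_measurable_add[rotated])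
  then show "fsol h0 h t \<in> borel_measurable \<nu>" by simp
qed

lemma fsol_integral_equation:
  assumes h: "integrable (Lon T) (\<lambda>s. h s \<xi>)"
  shows "integrable (Lon T) (\<lambda>t. fsol h0 h t \<xi>)"
    and "t \<in> {0..T} \<Longrightarrow> fsol h0 h t \<xi> = h0 \<xi> + (\<integral>s. indicator {..<t} s *\<^sub>R (h s \<xi> - Aop \<xi> (fsol h0 h s \<xi>)) \<partial>Lon T)"
proof -
  have f: "fst \<in> borel_measurable (borel :: (real \<times> (complex^'n)) measure)"
    "snd \<in> borel_measurable (borel :: (real \<times> (complex^'n)) measure)"
    by (intro borel_measurable_continuous_onI continuous_intros)+
  have Em: "(\<lambda>p. Eop \<xi> (fst p) (snd p)) \<in> borel_measurable borel"
    by (intro borel_measurable_Eop borel_measurable_const f)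
  note * = duhamel_integral_equation[where E = "Eop \<xi>" and A = "Aop \<xi>" and T = T and h = "\<lambda>s. h s \<xi>" and ?h0.0 = "h0 \<xi>",
      OF bounded_linear_Aop Eop_0 Eop_has_vector_derivative Em norm_Eop_le_exp h]
  show "integrable (Lon T) (\<lambda>t. fsol h0 h t \<xi>)" unfolding fsol_def using *(1) by simp
  show "t \<in> {0..T} \<Longrightarrow> fsol h0 h t \<xi> = h0 \<xi> + (\<integral>s. indicator {..<t} s *\<^sub>R (h s \<xi> - Aop \<xi> (fsol h0 h s \<xi>)) \<partial>Lon T)"
    unfolding fsol_def by (rule *(2))
qed

lemma norm_fsol_le:
  assumes h: "integrable (Lon T) (\<lambda>s. h s \<xi>)" and t: "t \<in> {0..T}"
  shows "norm (fsol h0 h t \<xi>) \<le> exp (T * rate) * (norm (h0 \<xi>) + (\<integral>s. norm (h s \<xi>) \<partial>Lon T))"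
proof -
  have "norm (\<integral>s. indicator {..<t} s *\<^sub>R Eop \<xi> (t - s) (h s \<xi>) \<partial>Lon T) \<le> (\<integral>s. exp (T * rate) * norm (h s \<xi>) \<partial>Lon T)"
  proof (rule order_trans[OF integral_norm_bound], rule integral_mono')
    show "integrable (Lon T) (\<lambda>s. exp (T * rate) * norm (h s \<xi>))" using h by simp
    fix s assume "s \<in> space (Lon T)"
    then have "s < t \<Longrightarrow> norm (Eop \<xi> (t - s) (h s \<xi>)) \<le> exp (T * rate) * norm (h s \<xi>)"
      using t by (intro norm_Eop_le_exp) auto
    then show "norm (indicator {..<t} s *\<^sub>R Eop \<xi> (t - s) (h s \<xi>)) \<le> exp (T * rate) * norm (h s \<xi>)"
      by (cases "s < t") simp_all
  qed simp
  then have "norm (\<integral>s. indicator {..<t} s *\<^sub>R Eop \<xi> (t - s) (h s \<xi>) \<partial>Lon T) \<le> exp (T * rate) * (\<integral>s. norm (h s \<xi>) \<partial>Lon T)" by simp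
  then show ?thesis
    unfolding fsol_def duhamel_def distrib_left
    by (intro order_trans[OF norm_triangle_ineq] add_mono norm_Eop_le_exp t)
qed

lemma Pr_fsol:
  assumes h0: "Pr \<xi> (h0 \<xi>) = h0 \<xi>" and h: "AE s in Lon T. Pr \<xi> (h s \<xi>) = h s \<xi>"
    and hm: "(\<lambda>s. h s \<xi>) \<in> borel_measurable (Lon T)"
  shows "Pr \<xi> (fsol h0 h t \<xi>) = fsol h0 h t \<xi>"
proof -
  define g where "g s = indicator {..<t} s *\<^sub>R Eop \<xi> (t - s) (h s \<xi>)" for s
  have gm: "g \<in> borel_measurable (Lon T)"
    unfolding g_def[abs_def]
    by (intro borel_measurable_scaleR borel_measurable_Lon_lessThan borel_measurable_Eop borel_measurable_diff
        borel_measurable_const borel_measurable_lebesgue_on_ident hm)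
  have "Pr \<xi> (\<integral>s. g s \<partial>Lon T) = (\<integral>s. g s \<partial>Lon T)"
  proof (cases "integrable (Lon T) g")
    case True
    have "(\<integral>s. Pr \<xi> (g s) \<partial>Lon T) = (\<integral>s. g s \<partial>Lon T)"
    proof (rule integral_cong_AE)
      show "AE s in Lon T. Pr \<xi> (g s) = g s"
        using h by eventually_elim
          (simp add: g_def linear_scale[OF bounded_linear.linear[OF bounded_linear_Pr]] Pr_Eop)
    qed (intro gm borel_measurable_Pr borel_measurable_const)+
    then show ?thesis using integral_bounded_linear[OF bounded_linear_Pr True] by simp
  next
    \<comment> \<open>Then the Bochner integral is 0 by convention, and 0 is fixed by
      \<open>Pr \<xi>\<close>; the conclusion thus covers all real \<open>t\<close>.\<close>
    case False
    then show ?thesis by (simp add: not_integrable_integral_eq linear_0[OF bounded_linear.linear[OF bounded_linear_Pr]])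
  qed
  then show ?thesis
    unfolding fsol_def duhamel_def g_def[symmetric] linear_add[OF bounded_linear.linear[OF bounded_linear_Pr]]
    by (simp add: Pr_Eop h0)
qed

lemma fsol_0: "fsol h0 h 0 \<xi> = h0 \<xi>"
proof -
  have "(\<integral>s. indicator {..<0} s *\<^sub>R Eop \<xi> (0 - s) (h s \<xi>) \<partial>Lon T) = (\<integral>s. 0 \<partial>Lon T)"
    by (rule Bochner_Integration.integral_cong) auto
  then show ?thesis by (simp add: fsol_def duhamel_def Eop_0)
qed

text \<open>The number of multi-indices is the constant in \<open>fm4_weight_le\<close>, which
  converts the smoothing bound for \<open>1 + norm \<xi> ^ 4\<close> into one for
  \<open>fm4_weight\<close>.\<close>

definition wconst :: real where "wconst = real (card {\<kappa>::'n \<Rightarrow> nat. mi_abs \<kappa> \<le> 4}) * smooth_const"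

lemma smooth_const_nonneg: "0 \<le> smooth_const"
  unfolding smooth_const_def using T_pos cG_pos by simp

section \<open>Integration of the estimate over all frequencies\<close>

context
  fixes \<nu> :: "(real^'n) measure" and h0 :: "real^'n \<Rightarrow> complex^'n" and h :: "real \<Rightarrow> real^'n \<Rightarrow> complex^'n"
  assumes \<nu>: "finite_measure \<nu>" "sets \<nu> = sets borel" and h0: "integrable \<nu> h0"
    and h: "integrable (Lon T \<Otimes>\<^sub>M \<nu>) (\<lambda>p. h (fst p) (snd p))"
begin

interpretation L: finite_measure "Lon T" by (rule finite_measure_Lon)
interpretation N: finite_measure \<nu> by (rule \<nu>)
interpretation P: pair_sigma_finite "Lon T" \<nu> ..

lemma integrable_case_prod: "integrable (Lon T \<Otimes>\<^sub>M \<nu>) (case_prod h)"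
  using h by (simp add: case_prod_unfold)

lemma AE_integrable_time: "AE \<xi> in \<nu>. integrable (Lon T) (\<lambda>s. h s \<xi>)"
  using P.AE_integrable_snd[OF integrable_case_prod] by simp

lemma integrable_fsol_at:
  assumes t: "t \<in> {0..T}"
  shows "integrable \<nu> (fsol h0 h t)"
proof (rule Bochner_Integration.integrable_bound)
  have "integrable (Lon T \<Otimes>\<^sub>M \<nu>) (case_prod (\<lambda>s \<xi>. norm (h s \<xi>)))"
    using integrable_norm[OF h] by (simp add: case_prod_unfold)
  from P.integrable_snd[OF this] h0
  show "integrable \<nu> (\<lambda>\<xi>. exp (T * rate) * (norm (h0 \<xi>) + (\<integral>s. norm (h s \<xi>) \<partial>Lon T)))"
    by simp
  show "fsol h0 h t \<in> borel_measurable \<nu>"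
    by (rule borel_measurable_fsol[OF \<nu>(2) borel_measurable_integrable[OF h0] borel_measurable_integrable[OF h]])
  show "AE \<xi> in \<nu>. norm (fsol h0 h t \<xi>) \<le> norm (exp (T * rate) * (norm (h0 \<xi>) + (\<integral>s. norm (h s \<xi>) \<partial>Lon T)))"
    using AE_integrable_time
  proof eventually_elim
    case (elim \<xi>)
    from norm_fsol_le[where h = h and \<xi> = \<xi> and ?h0.0 = h0, OF elim t] show ?case by simp
  qed
qed

text \<open>The bound at each frequency is integrated over \<open>\<nu>\<close>, with the time
  integral taken first. Since the computation runs in extended nonnegative integrals, it yields
  integrability along with the inequality.\<close>

lemma weighted_fsol:
  shows "integrable (Lon T \<Otimes>\<^sub>M \<nu>) (\<lambda>p. fm4_weight (snd p) *\<^sub>R fsol h0 h (fst p) (snd p))" (is ?A)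
    and "(\<integral>p. fm4_weight (snd p) * norm (fsol h0 h (fst p) (snd p)) \<partial>(Lon T \<Otimes>\<^sub>M \<nu>))
      \<le> wconst * ((\<integral>\<xi>. norm (h0 \<xi>) \<partial>\<nu>) + (\<integral>p. norm (h (fst p) (snd p)) \<partial>(Lon T \<Otimes>\<^sub>M \<nu>)))" (is ?B)
proof -
  let ?w = "\<lambda>p. fm4_weight (snd p) *\<^sub>R fsol h0 h (fst p) (snd p)"
  define W where "W = real (card {\<kappa>::'n \<Rightarrow> nat. mi_abs \<kappa> \<le> 4})"
  have W: "W \<ge> 0" by (simp add: W_def)
  note hm = borel_measurable_integrable[OF h]
  note fm = borel_measurable_fsol(1)[OF \<nu>(2) borel_measurable_integrable[OF h0] hm]
  have wm: "(\<lambda>p. fm4_weight (snd p)) \<in> borel_measurable (Lon T \<Otimes>\<^sub>M \<nu>)"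
    by (rule measurable_compose[OF measurable_snd measurable_if_sets_borel[OF \<nu>(2) borel_measurable_fm4_weight]])
  have w0: "fm4_weight \<xi> \<ge> 0" for \<xi> :: "real^'n" using fm4_weight_ge_1[of \<xi>] by linarith
  have m: "?w \<in> borel_measurable (Lon T \<Otimes>\<^sub>M \<nu>)" by (rule borel_measurable_scaleR[OF wm fm])
  have hnm: "(\<lambda>p. ennreal (norm (h (fst p) (snd p)))) \<in> borel_measurable (Lon T \<Otimes>\<^sub>M \<nu>)" using hm by measurable
  have h1m: "(\<lambda>\<xi>. \<integral>\<^sup>+s. ennreal (norm (h s \<xi>)) \<partial>Lon T) \<in> borel_measurable \<nu>"
    using L.borel_measurable_nn_integral_fst[OF measurable_compose[OF measurable_Pair[OF measurable_snd measurable_fst] hnm]] by simp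
  have wnm: "(\<lambda>p. ennreal (norm (?w p))) \<in> borel_measurable (Lon T \<Otimes>\<^sub>M \<nu>)" using m by measurable
  have "(\<integral>\<^sup>+p. ennreal (norm (?w p)) \<partial>(Lon T \<Otimes>\<^sub>M \<nu>)) = (\<integral>\<^sup>+\<xi>. (\<integral>\<^sup>+t. ennreal (norm (?w (t, \<xi>))) \<partial>Lon T) \<partial>\<nu>)"
    by (rule P.nn_integral_snd[symmetric, of "\<lambda>p. ennreal (norm (?w p))"]) (use wnm in simp)
  also have "\<dots> \<le> (\<integral>\<^sup>+\<xi>. ennreal W * (ennreal smooth_const * (ennreal (norm (h0 \<xi>)) + (\<integral>\<^sup>+s. ennreal (norm (h s \<xi>)) \<partial>Lon T))) \<partial>\<nu>)"
  proof (rule nn_integral_mono_AE)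
    show "AE \<xi> in \<nu>. (\<integral>\<^sup>+t. ennreal (norm (?w (t, \<xi>))) \<partial>Lon T)
        \<le> ennreal W * (ennreal smooth_const * (ennreal (norm (h0 \<xi>)) + (\<integral>\<^sup>+s. ennreal (norm (h s \<xi>)) \<partial>Lon T)))"
      using AE_integrable_time
    proof eventually_elim
      case (elim \<xi>)
      have fi: "(\<lambda>t. fsol h0 h t \<xi>) \<in> borel_measurable (Lon T)"
        by (rule borel_measurable_integrable[OF fsol_integral_equation(1)[where h = h, OF elim]])
      have "(\<integral>\<^sup>+t. ennreal (norm (?w (t, \<xi>))) \<partial>Lon T) \<le> (\<integral>\<^sup>+t. ennreal W * ennreal ((1 + norm \<xi> ^ 4) * norm (fsol h0 h t \<xi>)) \<partial>Lon T)"
      proof (rule nn_integral_mono)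
        fix t
        have "norm (?w (t, \<xi>)) \<le> W * (1 + norm \<xi> ^ 4) * norm (fsol h0 h t \<xi>)"
          using mult_right_mono[OF fm4_weight_le[of \<xi>], of "norm (fsol h0 h t \<xi>)"] w0[of \<xi>] by (simp add: W_def)
        then have "ennreal (norm (?w (t, \<xi>))) \<le> ennreal (W * ((1 + norm \<xi> ^ 4) * norm (fsol h0 h t \<xi>)))"
          by (intro ennreal_leI) (simp only: mult.assoc)
        also have "\<dots> = ennreal W * ennreal ((1 + norm \<xi> ^ 4) * norm (fsol h0 h t \<xi>))" by (rule ennreal_mult[OF W]) simp
        finally show "ennreal (norm (?w (t, \<xi>))) \<le> ennreal W * ennreal ((1 + norm \<xi> ^ 4) * norm (fsol h0 h t \<xi>))" .
      qed
      also have "\<dots> = ennreal W * (\<integral>\<^sup>+t. ennreal ((1 + norm \<xi> ^ 4) * norm (fsol h0 h t \<xi>)) \<partial>Lon T)"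
        by (rule nn_integral_cmult) (use fi in measurable)
      also have "\<dots> \<le> ennreal W * (ennreal smooth_const * (ennreal (norm (h0 \<xi>)) + (\<integral>\<^sup>+s. ennreal (norm (h s \<xi>)) \<partial>Lon T)))"
        by (intro mult_left_mono nn_integral_weighted_fsol_le borel_measurable_integrable[OF elim]) simp
      finally show ?case .
    qed
  qed
  also have "\<dots> = ennreal W * (ennreal smooth_const * ((\<integral>\<^sup>+\<xi>. ennreal (norm (h0 \<xi>)) \<partial>\<nu>) + (\<integral>\<^sup>+\<xi>. (\<integral>\<^sup>+s. ennreal (norm (h s \<xi>)) \<partial>Lon T) \<partial>\<nu>)))"
  proof -
    have h0m: "(\<lambda>\<xi>. ennreal (norm (h0 \<xi>))) \<in> borel_measurable \<nu>" using borel_measurable_integrable[OF h0] by measurable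
    note sm = borel_measurable_add[OF h0m h1m]
    have sm2: "(\<lambda>\<xi>. ennreal smooth_const * (ennreal (norm (h0 \<xi>)) + (\<integral>\<^sup>+s. ennreal (norm (h s \<xi>)) \<partial>Lon T))) \<in> borel_measurable \<nu>"
      using sm by (intro borel_measurable_times_ennreal) simp_all
    show ?thesis
      by (simp only: nn_integral_cmult[OF sm2] nn_integral_cmult[OF sm] nn_integral_add[OF h0m h1m])
  qed
  also have "(\<integral>\<^sup>+\<xi>. ennreal (norm (h0 \<xi>)) \<partial>\<nu>) = ennreal (\<integral>\<xi>. norm (h0 \<xi>) \<partial>\<nu>)"
    by (rule nn_integral_eq_integral) (use h0 in auto)
  also have "(\<integral>\<^sup>+\<xi>. (\<integral>\<^sup>+s. ennreal (norm (h s \<xi>)) \<partial>Lon T) \<partial>\<nu>) = (\<integral>\<^sup>+p. ennreal (norm (h (fst p) (snd p))) \<partial>(Lon T \<Otimes>\<^sub>M \<nu>))"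
    using P.nn_integral_snd[of "\<lambda>p. ennreal (norm (h (fst p) (snd p)))"] hnm by simp
  also have "\<dots> = ennreal (\<integral>p. norm (h (fst p) (snd p)) \<partial>(Lon T \<Otimes>\<^sub>M \<nu>))"
    by (rule nn_integral_eq_integral) (use h in auto)
  finally have bound: "(\<integral>\<^sup>+p. ennreal (norm (?w p)) \<partial>(Lon T \<Otimes>\<^sub>M \<nu>))
     \<le> ennreal (wconst * ((\<integral>\<xi>. norm (h0 \<xi>) \<partial>\<nu>) + (\<integral>p. norm (h (fst p) (snd p)) \<partial>(Lon T \<Otimes>\<^sub>M \<nu>))))"
    using W smooth_const_nonneg unfolding wconst_def W_def[symmetric]
    by (simp add: mult.assoc flip: ennreal_mult ennreal_plus)
  show ?A
    by (rule integrableI_bounded[OF m]) (use bound in \<open>auto intro: le_less_trans\<close>)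
  then have i: "integrable (Lon T \<Otimes>\<^sub>M \<nu>) (\<lambda>p. norm (?w p))" by (rule integrable_norm)
  have "ennreal (\<integral>p. norm (?w p) \<partial>(Lon T \<Otimes>\<^sub>M \<nu>)) \<le> ennreal (wconst * ((\<integral>\<xi>. norm (h0 \<xi>) \<partial>\<nu>) + (\<integral>p. norm (h (fst p) (snd p)) \<partial>(Lon T \<Otimes>\<^sub>M \<nu>))))"
    using bound by (subst nn_integral_eq_integral[symmetric, OF i]) auto
  moreover have "0 \<le> wconst" unfolding wconst_def using smooth_const_nonneg by simp
  ultimately have "(\<integral>p. norm (?w p) \<partial>(Lon T \<Otimes>\<^sub>M \<nu>)) \<le> wconst * ((\<integral>\<xi>. norm (h0 \<xi>) \<partial>\<nu>) + (\<integral>p. norm (h (fst p) (snd p)) \<partial>(Lon T \<Otimes>\<^sub>M \<nu>)))"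
    by (subst (asm) ennreal_le_iff) (auto intro!: mult_nonneg_nonneg add_nonneg_nonneg)
  then show ?B using w0 by simp
qed

end

end

section \<open>Existence\<close>

lemma joint_rep_D:
  assumes "joint_rep T \<nu> z v"
  shows "integrable (Lon T \<Otimes>\<^sub>M \<nu>) (\<lambda>p. z (fst p) (snd p))" and "AE t in Lon T. fm_rep \<nu> (z t) (v t)"
    and "AE t in Lon T. v t = fourier_meas \<nu> (z t)"
proof -
  show "integrable (Lon T \<Otimes>\<^sub>M \<nu>) (\<lambda>p. z (fst p) (snd p))" and *: "AE t in Lon T. fm_rep \<nu> (z t) (v t)"
    using assms by (simp_all add: joint_rep_def case_prod_unfold)
  from * show "AE t in Lon T. v t = fourier_meas \<nu> (z t)" by eventually_elim (simp add: fm_rep_def)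
qed

lemma integrable_Lon_eval:
  fixes z :: "real \<Rightarrow> real^'n \<Rightarrow> complex^'m"
  assumes \<nu>: "finite_measure \<nu>" "sets \<nu> = sets borel"
    and z: "integrable (Lon T \<Otimes>\<^sub>M \<nu>) (\<lambda>p. z (fst p) (snd p))"
    and v: "AE s in Lon T. v s = fourier_meas \<nu> (z s)"
  shows "integrable (Lon T) (\<lambda>s. v s x)"
proof -
  interpret L: finite_measure "Lon T" by (rule finite_measure_Lon)
  interpret N: finite_measure \<nu> by (rule \<nu>)
  interpret P: pair_sigma_finite "Lon T" \<nu> ..
  have em: "(\<lambda>p. ek x (snd p)) \<in> borel_measurable (Lon T \<Otimes>\<^sub>M \<nu>)"
    by (rule measurable_compose[OF measurable_snd measurable_if_sets_borel[OF \<nu>(2) borel_measurable_ek]])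
  have "integrable (Lon T \<Otimes>\<^sub>M \<nu>) (\<lambda>p. cscale (ek x (snd p)) (z (fst p) (snd p)))"
    by (rule Bochner_Integration.integrable_bound[OF z borel_measurable_cscale[OF em borel_measurable_integrable[OF z]]]) simp
  then have "integrable (Lon T \<Otimes>\<^sub>M \<nu>) (case_prod (\<lambda>s \<xi>. cscale (ek x \<xi>) (z s \<xi>)))" by (simp add: case_prod_unfold)
  note I = P.integrable_fst[OF this]
  have ae: "AE s in Lon T. v s x = (\<integral>\<xi>. cscale (ek x \<xi>) (z s \<xi>) \<partial>\<nu>)"
    using v P.AE_integrable_fst'[OF z] by eventually_elim (simp add: fourier_meas_eq[OF \<nu>(2)])
  have "(\<lambda>s. v s x) \<in> borel_measurable (Lon T)"
    by (rule borel_measurable_lebesgue_on_AE_eq[OF borel_measurable_integrable[OF I] _ ae]) simp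
  then show ?thesis
    using ae by (intro integrable_cong_AE_imp[OF I]) (auto elim: eventually_mono)
qed

context stokes
begin

text \<open>The pressure gradient in frequency space: what the projection removes from
  \<open>mat_act M v\<close>, with a minus sign. The remaining terms act on solenoidal densities by
  scalars, so \<open>M\<close> alone generates pressure when the force is solenoidal.\<close>

definition Rop :: "real^'n \<Rightarrow> complex^'n \<Rightarrow> complex^'n" where "Rop \<xi> v = Bop \<xi> v - mat_act M v"

lemma norm_Rop_le: "norm (Rop \<xi> v) \<le> 2 * bM * norm v"
proof -
  have "norm (mat_act M v) \<le> bM * norm v"
    using onorm[OF bounded_linear_mat_act, of M v] onorm_pos_le[OF bounded_linear_mat_act, of M]
      mult_nonneg_nonneg[OF onorm_pos_le[OF bounded_linear_mat_act, of M] norm_ge_zero[of v]]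
    unfolding bM_def by linarith
  then show ?thesis using norm_Bop_le[of \<xi> v] norm_triangle_ineq4[of "Bop \<xi> v" "mat_act M v"]
    unfolding Rop_def by linarith
qed

text \<open>Exhibits the coefficient to be used in \<open>pgrad_potential\<close>. At the origin
  both sides vanish because a vector fixed by \<open>Pr 0\<close> is 0.\<close>

lemma Rop_eq:
  assumes "Pr \<xi> v = v"
  shows "Rop \<xi> v = cscale (- cdot \<xi> (mat_act M v) / of_real ((norm \<xi>)\<^sup>2)) (cvec \<xi>)"
proof (cases "\<xi> = 0")
  case True
  then have "v = 0" using assms by (simp add: Pr_eq_iff)
  then show ?thesis using True linear_0[OF bounded_linear.linear[OF bounded_linear_mat_act]]
    by (simp add: Rop_def Bop_def Pr_def)
next
  case False
  then show ?thesis by (simp add: Rop_def Bop_def Pr_def) (simp add: vec_eq_iff)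
qed

lemma borel_measurable_Rop:
  assumes f: "f \<in> borel_measurable N" and g: "g \<in> borel_measurable N"
  shows "(\<lambda>x. Rop (f x) (g x)) \<in> borel_measurable N"
proof -
  have "(\<lambda>x. mat_act M (g x)) \<in> borel_measurable N"
    by (rule measurable_compose[OF g])
      (intro borel_measurable_continuous_onI linear_continuous_on bounded_linear_mat_act)
  then show ?thesis unfolding Rop_def by (intro borel_measurable_diff borel_measurable_Bop f g)
qed

lemma Aop_bound: "\<exists>C\<ge>0. \<forall>\<xi> v. norm (Aop \<xi> v) \<le> C * (fm4_weight \<xi> * norm v)"
proof -
  obtain C where C: "C > 0" "\<And>\<xi> :: real^'n. norm (symb \<xi>) \<le> C * (1 + norm \<xi> ^ 4)"
    by (rule stokes_symbol_le[of lam Gam0 Gam2 V], rule that)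
  define D where "D = C * (1 + real CARD('n) ^ 2) + bM"
  have "norm (Aop \<xi> v) \<le> D * (fm4_weight \<xi> * norm v)" for \<xi> v
  proof -
    have "norm (symb \<xi>) \<le> C * ((1 + real CARD('n) ^ 2) * fm4_weight \<xi>)"
      using C(2)[of \<xi>] mult_left_mono[OF power4_le_weight[of \<xi>], of C] C(1) by linarith
    then have "norm (symb \<xi>) * norm v \<le> C * ((1 + real CARD('n) ^ 2) * fm4_weight \<xi>) * norm v"
      by (rule mult_right_mono) simp
    moreover have "bM * (1 * norm v) \<le> bM * (fm4_weight \<xi> * norm v)"
      by (intro mult_left_mono mult_right_mono fm4_weight_ge_1 bM_nonneg) simp
    ultimately show ?thesis
      using norm_triangle_ineq[of "cscale (symb \<xi>) v" "Bop \<xi> v"] norm_Bop_le[of \<xi> v]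
      unfolding Aop_def D_def by (simp add: algebra_simps)
  qed
  moreover have "D \<ge> 0" unfolding D_def using C(1) bM_nonneg by simp
  ultimately show ?thesis by blast
qed

text \<open>Chosen from the coefficients and the dimension before any data appear, so that the final
  constant does not depend on the solution.\<close>

definition aconst :: real where
  "aconst = (SOME C. C \<ge> 0 \<and> (\<forall>\<xi> v. norm (Aop \<xi> v) \<le> C * (fm4_weight \<xi> * norm v)))"

lemma aconst: "aconst \<ge> 0" "norm (Aop \<xi> v) \<le> aconst * (fm4_weight \<xi> * norm v)"
  using someI_ex[OF Aop_bound] unfolding aconst_def by blast+

context
  fixes \<nu> :: "(real^'n) measure" and h0 :: "real^'n \<Rightarrow> complex^'n" and h :: "real \<Rightarrow> real^'n \<Rightarrow> complex^'n"
  assumes \<nu>: "finite_measure \<nu>" "sets \<nu> = sets borel" and h0: "integrable \<nu> h0"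
    and h: "integrable (Lon T \<Otimes>\<^sub>M \<nu>) (\<lambda>p. h (fst p) (snd p))"
begin

interpretation L: finite_measure "Lon T" by (rule finite_measure_Lon)
interpretation N: finite_measure \<nu> by (rule \<nu>)
interpretation P: pair_sigma_finite "Lon T" \<nu> ..

lemmas borel_measurable_fsol_pair = borel_measurable_fsol(1)[OF \<nu>(2) borel_measurable_integrable[OF h0] borel_measurable_integrable[OF h]]
lemmas weighted_fsol_pair = weighted_fsol[OF \<nu> h0 h]

lemma borel_measurable_snd_pair: "snd \<in> borel_measurable (Lon T \<Otimes>\<^sub>M \<nu>)"
proof -
  have "(\<lambda>x. x) \<in> borel_measurable \<nu>" by (simp add: measurable_ident_sets \<nu>)
  from measurable_compose[OF measurable_snd this, of "Lon T"] show ?thesis by simp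
qed

lemma integrable_weighted_norm_fsol: "integrable (Lon T \<Otimes>\<^sub>M \<nu>) (\<lambda>p. fm4_weight (snd p) * norm (fsol h0 h (fst p) (snd p)))"
proof -
  have "\<bar>fm4_weight \<xi>\<bar> = fm4_weight \<xi>" for \<xi> :: "real^'n"
    using fm4_weight_ge_1[of \<xi>] by linarith
  then show ?thesis using integrable_norm[OF weighted_fsol_pair(1)] by simp
qed

text \<open>One domination by the weighted density handles the identity, \<open>Aop\<close> and
  \<open>Rop\<close>, that is, the solution, the spatial part of its time derivative and the
  pressure gradient.\<close>

lemma
  assumes F: "(\<lambda>p. F (snd p) (fsol h0 h (fst p) (snd p))) \<in> borel_measurable (Lon T \<Otimes>\<^sub>M \<nu>)"
    and C: "C \<ge> 0" "\<And>\<xi> v. norm (F \<xi> v :: complex^'n) \<le> C * (fm4_weight \<xi> * norm v)"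
  shows integrable_op_fsol: "integrable (Lon T \<Otimes>\<^sub>M \<nu>) (\<lambda>p. F (snd p) (fsol h0 h (fst p) (snd p)))"
    and integral_op_fsol_le: "(\<integral>p. norm (F (snd p) (fsol h0 h (fst p) (snd p))) \<partial>(Lon T \<Otimes>\<^sub>M \<nu>))
      \<le> C * (\<integral>p. fm4_weight (snd p) * norm (fsol h0 h (fst p) (snd p)) \<partial>(Lon T \<Otimes>\<^sub>M \<nu>))"
proof -
  have i: "integrable (Lon T \<Otimes>\<^sub>M \<nu>) (\<lambda>p. C * (fm4_weight (snd p) * norm (fsol h0 h (fst p) (snd p))))"
    by (rule integrable_mult_right[OF integrable_weighted_norm_fsol])
  show 1: "integrable (Lon T \<Otimes>\<^sub>M \<nu>) (\<lambda>p. F (snd p) (fsol h0 h (fst p) (snd p)))"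
  proof (rule Bochner_Integration.integrable_bound[OF i F], rule AE_I2)
    fix p
    show "norm (F (snd p) (fsol h0 h (fst p) (snd p))) \<le> norm (C * (fm4_weight (snd p) * norm (fsol h0 h (fst p) (snd p))))"
      using C(2)[of "snd p" "fsol h0 h (fst p) (snd p)"] by (simp only: real_norm_def)
  qed
  show "(\<integral>p. norm (F (snd p) (fsol h0 h (fst p) (snd p))) \<partial>(Lon T \<Otimes>\<^sub>M \<nu>))
      \<le> C * (\<integral>p. fm4_weight (snd p) * norm (fsol h0 h (fst p) (snd p)) \<partial>(Lon T \<Otimes>\<^sub>M \<nu>))"
    unfolding integral_mult_right_zero[symmetric]
    by (rule integral_mono[OF integrable_norm[OF 1] i]) (rule C(2))
qed

lemma norm_le_weight: "norm v \<le> 1 * (fm4_weight \<xi> * norm v)"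
  using mult_right_mono[OF fm4_weight_ge_1[of \<xi>] norm_ge_zero[of v]] by simp

lemmas integrable_fsol = integrable_op_fsol[where F = "\<lambda>_ v. v" and C = 1, OF borel_measurable_fsol_pair zero_le_one norm_le_weight]
  and integral_fsol_le = integral_op_fsol_le[where F = "\<lambda>_ v. v" and C = 1, OF borel_measurable_fsol_pair zero_le_one norm_le_weight]

lemmas integrable_Aop_fsol = integrable_op_fsol[where F = Aop, OF borel_measurable_Aop[OF borel_measurable_snd_pair borel_measurable_fsol_pair] aconst]
  and integral_Aop_fsol_le = integral_op_fsol_le[where F = Aop, OF borel_measurable_Aop[OF borel_measurable_snd_pair borel_measurable_fsol_pair] aconst]

lemma norm_Rop_le_weight: "norm (Rop \<xi> v) \<le> 2 * bM * (fm4_weight \<xi> * norm v)"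
proof -
  have "2 * bM * norm v \<le> 2 * bM * (1 * (fm4_weight \<xi> * norm v))"
    using bM_nonneg by (intro mult_left_mono) (use norm_le_weight in auto)
  then show ?thesis using norm_Rop_le[of \<xi> v] by simp
qed

lemma two_bM_nonneg: "0 \<le> 2 * bM" using bM_nonneg by simp

lemmas integrable_Rop_fsol = integrable_op_fsol[where F = Rop, OF borel_measurable_Rop[OF borel_measurable_snd_pair borel_measurable_fsol_pair] two_bM_nonneg norm_Rop_le_weight]
  and integral_Rop_fsol_le = integral_op_fsol_le[where F = Rop, OF borel_measurable_Rop[OF borel_measurable_snd_pair borel_measurable_fsol_pair] two_bM_nonneg norm_Rop_le_weight]

lemma integrable_time_derivative: "integrable (Lon T \<Otimes>\<^sub>M \<nu>) (\<lambda>p. h (fst p) (snd p) - Aop (snd p) (fsol h0 h (fst p) (snd p)))"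
  by (rule Bochner_Integration.integrable_diff[OF h integrable_Aop_fsol])

lemma integral_time_derivative_le: "(\<integral>p. norm (h (fst p) (snd p) - Aop (snd p) (fsol h0 h (fst p) (snd p))) \<partial>(Lon T \<Otimes>\<^sub>M \<nu>))
    \<le> (\<integral>p. norm (h (fst p) (snd p)) \<partial>(Lon T \<Otimes>\<^sub>M \<nu>))
      + aconst * (\<integral>p. fm4_weight (snd p) * norm (fsol h0 h (fst p) (snd p)) \<partial>(Lon T \<Otimes>\<^sub>M \<nu>))"
proof -
  have "(\<integral>p. norm (h (fst p) (snd p) - Aop (snd p) (fsol h0 h (fst p) (snd p))) \<partial>(Lon T \<Otimes>\<^sub>M \<nu>))
    \<le> (\<integral>p. norm (h (fst p) (snd p)) + norm (Aop (snd p) (fsol h0 h (fst p) (snd p))) \<partial>(Lon T \<Otimes>\<^sub>M \<nu>))"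
    by (rule integral_mono[OF integrable_norm[OF integrable_time_derivative] Bochner_Integration.integrable_add[OF integrable_norm[OF h] integrable_norm[OF integrable_Aop_fsol]]])
      (rule norm_triangle_ineq4)
  also have "\<dots> = (\<integral>p. norm (h (fst p) (snd p)) \<partial>(Lon T \<Otimes>\<^sub>M \<nu>)) + (\<integral>p. norm (Aop (snd p) (fsol h0 h (fst p) (snd p))) \<partial>(Lon T \<Otimes>\<^sub>M \<nu>))"
    by (rule Bochner_Integration.integral_add[OF integrable_norm[OF h] integrable_norm[OF integrable_Aop_fsol]])
  finally show ?thesis using integral_Aop_fsol_le by linarith
qed

lemma AE_Pr_fsol:
  assumes Ph0: "AE \<xi> in \<nu>. Pr \<xi> (h0 \<xi>) = h0 \<xi>" and Ph: "AE t in Lon T. AE \<xi> in \<nu>. Pr \<xi> (h t \<xi>) = h t \<xi>"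
  shows "AE \<xi> in \<nu>. \<forall>t. Pr \<xi> (fsol h0 h t \<xi>) = fsol h0 h t \<xi>"
proof -
  have "AE \<xi> in \<nu>. AE t in Lon T. Pr \<xi> (h t \<xi>) = h t \<xi>"
    using Ph by (subst (asm) AE_Lon_swap[OF \<nu>(1) borel_measurable_Pr[OF borel_measurable_snd_pair borel_measurable_integrable[OF h]] borel_measurable_integrable[OF h]])
  with Ph0 AE_integrable_time[OF \<nu> h0 h] show ?thesis
  proof eventually_elim
    case (elim \<xi>)
    show ?case by (intro allI Pr_fsol[where h = h and ?h0.0 = h0 and \<xi> = \<xi>, OF elim(1) elim(3) borel_measurable_integrable[OF elim(2)]])
  qed
qed

text \<open>With \<open>w\<close> the density of \<open>u\<close>, the derivative gets
  \<open>h - Aop w\<close> and the pressure gradient gets \<open>Rop w\<close>. The momentum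
  equation then holds identically at each frequency: the terms with \<open>Bop\<close> cancel
  between \<open>Aop\<close> and \<open>Rop\<close>, and so do those with \<open>M\<close>.\<close>

lemma fsol_solves:
  assumes u0: "u0 = fourier_meas \<nu> h0" and f: "AE t in Lon T. f t = fourier_meas \<nu> (h t)"
    and Ph0: "AE \<xi> in \<nu>. Pr \<xi> (h0 \<xi>) = h0 \<xi>" and Ph: "AE t in Lon T. AE \<xi> in \<nu>. Pr \<xi> (h t \<xi>) = h t \<xi>"
  shows "\<exists>u u' q. lin_sol_with T lam Gam0 Gam2 V M f u0 u u' q"
proof -
  define w where "w = fsol h0 h"
  define z where "z t \<xi> = h t \<xi> - Aop \<xi> (w t \<xi>)" for t \<xi>
  define b where "b t \<xi> = - cdot \<xi> (mat_act M (w t \<xi>)) / of_real ((norm \<xi>)\<^sup>2)" for t \<xi>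
  define q where "q t x = (\<integral>\<xi>. (ek x \<xi> - 1) * (\<i> * b t \<xi>) \<partial>\<nu>)" for t x
  define u where "u t = fourier_meas \<nu> (w t)" for t
  define u' where "u' t = fourier_meas \<nu> (z t)" for t
  have w: "integrable \<nu> (w t)" if "t \<in> {0..T}" for t
    unfolding w_def by (rule integrable_fsol_at[OF \<nu> h0 h that])
  have PwA: "AE \<xi> in \<nu>. \<forall>t. Pr \<xi> (w t \<xi>) = w t \<xi>"
    unfolding w_def by (rule AE_Pr_fsol[OF Ph0 Ph])
  have Pw: "AE \<xi> in \<nu>. Pr \<xi> (w t \<xi>) = w t \<xi>" for t
    using PwA by eventually_elim blast
  have idn: "(\<lambda>x. x) \<in> borel_measurable \<nu>" by (simp add: measurable_ident_sets \<nu>)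
  have wr: "fm_rep \<nu> (w t) (u t)" if "t \<in> {0..T}" for t
    unfolding u_def by (rule fm_rep_fourier_meas[OF \<nu> w[OF that]])
  have pg: "pgrad_exists (q t) \<and> integrable \<nu> (\<lambda>\<xi>. Rop \<xi> (w t \<xi>)) \<and> pgrad (q t) = fourier_meas \<nu> (\<lambda>\<xi>. Rop \<xi> (w t \<xi>))"
    if t: "t \<in> {0..T}" for t
  proof -
    note wm = borel_measurable_integrable[OF w[OF t]]
    have Rm: "(\<lambda>\<xi>. Rop \<xi> (w t \<xi>)) \<in> borel_measurable \<nu>" by (rule borel_measurable_Rop[OF idn wm])
    have Ri: "integrable \<nu> (\<lambda>\<xi>. Rop \<xi> (w t \<xi>))"
    proof (rule Bochner_Integration.integrable_bound[OF _ Rm], rule integrable_mult_right[OF integrable_norm[OF w[OF t]], of "2 * bM"], rule AE_I2)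
      fix \<xi>
      show "norm (Rop \<xi> (w t \<xi>)) \<le> norm (2 * bM * norm (w t \<xi>))"
        using norm_Rop_le[of \<xi> "w t \<xi>"] by (simp only: real_norm_def)
    qed
    have bm: "b t \<in> borel_measurable \<nu>"
    proof -
      have [measurable]: "(\<lambda>\<xi>. mat_act M (w t \<xi>) $ j) \<in> borel_measurable \<nu>" for j
        by (rule measurable_compose[OF wm])
          (intro borel_measurable_continuous_onI continuous_intros linear_continuous_on bounded_linear_mat_act)
      have [measurable]: "(\<lambda>\<xi>. \<xi> $ j) \<in> borel_measurable \<nu>" for j
        by (rule measurable_if_sets_borel[OF \<nu>(2) borel_measurable_component])
      have [measurable]: "(\<lambda>\<xi>. norm \<xi>) \<in> borel_measurable \<nu>"
        by (rule measurable_compose[OF idn]) simp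
      have "(\<lambda>\<xi>. cdot \<xi> (mat_act M (w t \<xi>))) \<in> borel_measurable \<nu>" unfolding cdot_def by measurable
      then show ?thesis unfolding b_def[abs_def] by measurable
    qed
    have eq: "AE \<xi> in \<nu>. Rop \<xi> (w t \<xi>) = cscale (b t \<xi>) (cvec \<xi>)"
      using Pw[of t] by eventually_elim (simp only: Rop_eq b_def)
    have bi: "integrable \<nu> (\<lambda>\<xi>. cscale (b t \<xi>) (cvec \<xi>))"
      by (rule integrable_cong_AE_imp[OF Ri borel_measurable_cscale[OF bm measurable_if_sets_borel[OF \<nu>(2) borel_measurable_cvec]] eq])
    have "q t = (\<lambda>x. \<integral>\<xi>. (ek x \<xi> - 1) * (\<i> * b t \<xi>) \<partial>\<nu>)" by (simp add: q_def fun_eq_iff)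
    with pgrad_potential[OF \<nu> bm bi] fourier_meas_cong_AE[OF \<nu>(2) Ri bi eq] Ri show ?thesis by simp
  qed
  have zi: "integrable (Lon T \<Otimes>\<^sub>M \<nu>) (\<lambda>p. z (fst p) (snd p))" unfolding z_def w_def by (rule integrable_time_derivative)
  have zt: "AE t in Lon T. integrable \<nu> (z t)" using P.AE_integrable_fst'[OF zi] by simp
  have wt: "AE t in Lon T. integrable \<nu> (\<lambda>\<xi>. fm4_weight \<xi> *\<^sub>R w t \<xi>)"
    using P.AE_integrable_fst'[OF weighted_fsol_pair(1)] by (simp add: w_def)
  have ht: "AE t in Lon T. integrable \<nu> (h t)" using P.AE_integrable_fst'[OF h] by simp
  have u'AE: "AE t in Lon T. u' t = fourier_meas \<nu> (z t)" by (simp add: u'_def)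
  have L1u: "L1_sp in_FM fm_norm T u" by (rule L1_sp_fmI[where v = w, OF \<nu>]) (simp_all add: u_def w_def integrable_fsol)
  have L1u': "L1_sp in_FM fm_norm T u'" by (rule L1_sp_fmI[OF \<nu> zi u'AE])
  have L1u4: "L1_sp (in_FMk 4) (fmk_norm 4) T u" by (rule L1_sp_fm4I[OF \<nu> weighted_fsol_pair(1)]) (simp add: u_def w_def)
  have pgAE: "AE t in Lon T. pgrad (q t) = fourier_meas \<nu> (\<lambda>\<xi>. Rop \<xi> (w t \<xi>))"
    by (rule AE_I2) (use pg in simp)
  have L1q: "L1_sp in_FM fm_norm T (\<lambda>t. pgrad (q t))"
    by (rule L1_sp_fmI[where v = "\<lambda>t \<xi>. Rop \<xi> (w t \<xi>)", OF \<nu> _ pgAE]) (unfold w_def, rule integrable_Rop_fsol)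
  have evo: "u t x = u 0 x + (LINT s:{0..t}|lebesgue. u' s x)" if t: "t \<in> {0..T}" for t x
  proof -
    note ti = fourier_meas_time_integral[OF \<nu> zi u'AE t integrable_Lon_eval[OF \<nu> zi u'AE]]
    have "AE \<xi> in \<nu>. w t \<xi> = h0 \<xi> + (\<integral>s. indicator {..<t} s *\<^sub>R z s \<xi> \<partial>Lon T)"
      using AE_integrable_time[OF \<nu> h0 h]
    proof eventually_elim
      case (elim \<xi>)
      show ?case using fsol_integral_equation(2)[where h = h and \<xi> = \<xi> and ?h0.0 = h0, OF elim t] by (simp add: w_def z_def)
    qed
    from fourier_meas_cong_AE[OF \<nu>(2) w[OF t] Bochner_Integration.integrable_add[OF h0 ti(1)] this]
    have "u t x = fourier_meas \<nu> (\<lambda>\<xi>. h0 \<xi> + (\<integral>s. indicator {..<t} s *\<^sub>R z s \<xi> \<partial>Lon T)) x" by (simp add: u_def)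
    also have "\<dots> = fourier_meas \<nu> h0 x + (LINT s:{0..t}|lebesgue. u' s x)"
      unfolding ti(2) by (rule fourier_meas_add[OF \<nu>(2) h0 ti(1)])
    also have "fourier_meas \<nu> h0 = u 0"
      unfolding u_def w_def using fsol_0[of h0 h] by (intro arg_cong[where f = "fourier_meas \<nu>"]) (simp add: fun_eq_iff)
    finally show ?thesis .
  qed
  have eqn: "AE t in Lon T. \<forall>x. u' t x + lam *\<^sub>R fm_vgrad V (u t) x + mat_act M (u t x)
              - Gam0 *\<^sub>R fm_laplace (u t) x + Gam2 *\<^sub>R fm_laplace (fm_laplace (u t)) x
              + pgrad (q t) x = f t x"
    using zt wt ht f AE_space[of "Lon T"]
  proof eventually_elim
    case (elim t)
    have t: "t \<in> {0..T}" using elim(5) by simp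
    let ?s = "\<lambda>\<xi>. cscale (symb \<xi>) (w t \<xi>) + mat_act M (w t \<xi>)"
    let ?r = "\<lambda>\<xi>. Rop \<xi> (w t \<xi>)"
    note st = stokes_operator_fourier_meas[OF \<nu> elim(2), where M = M and V = V and lam = lam and ?Gam0.0 = Gam0 and ?Gam2.0 = Gam2]
    have ri: "integrable \<nu> ?r" using pg[OF t] by blast
    show ?case
    proof
      fix x
      have "u' t x + (lam *\<^sub>R fm_vgrad V (u t) x + mat_act M (u t x)
              - Gam0 *\<^sub>R fm_laplace (u t) x + Gam2 *\<^sub>R fm_laplace (fm_laplace (u t)) x) + pgrad (q t) x
          = fourier_meas \<nu> (z t) x + fourier_meas \<nu> ?s x + fourier_meas \<nu> ?r x"
        unfolding u_def u'_def st(2) using pg[OF t] by simp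
      also have "\<dots> = fourier_meas \<nu> (\<lambda>\<xi>. z t \<xi> + ?s \<xi> + ?r \<xi>) x"
        by (simp only: fourier_meas_add[OF \<nu>(2) elim(1) st(1)]
            fourier_meas_add[OF \<nu>(2) Bochner_Integration.integrable_add[OF elim(1) st(1)] ri])
      also have "(\<lambda>\<xi>. z t \<xi> + ?s \<xi> + ?r \<xi>) = h t"
        by (simp add: z_def Aop_def Rop_def fun_eq_iff)
      finally have "u' t x + (lam *\<^sub>R fm_vgrad V (u t) x + mat_act M (u t x)
              - Gam0 *\<^sub>R fm_laplace (u t) x + Gam2 *\<^sub>R fm_laplace (fm_laplace (u t)) x) + pgrad (q t) x = f t x"
        by (simp add: elim(4))
      moreover have "a + c + d - e + g + k = a + (c + d - e + g) + k" for a c d e g k :: "complex^'n" by simp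
      ultimately show "u' t x + lam *\<^sub>R fm_vgrad V (u t) x + mat_act M (u t x)
              - Gam0 *\<^sub>R fm_laplace (u t) x + Gam2 *\<^sub>R fm_laplace (fm_laplace (u t)) x
              + pgrad (q t) x = f t x" by (simp only:)
    qed
  qed
  have "lin_sol_with T lam Gam0 Gam2 V M f u0 u u' q"
    unfolding lin_sol_with_def W11_FM_def AE_Lon[symmetric]
  proof (intro conjI L1u L1u' L1u4 L1q eqn ballI allI)
    show "u t x = u 0 x + (LINT s:{0..t}|lebesgue. u' s x)" if "t \<in> {0..T}" for t x by (rule evo[OF that])
    show "in_FM0s (u t)" if "t \<in> {0..T}" for t using in_FM0s_iff[OF wr[OF that]] Pw[of t] by simp
    show "AE t in Lon T. pgrad_exists (q t)" by (rule AE_I2) (use pg in simp)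
    show "u 0 = u0" unfolding u_def w_def u0 using fsol_0[of h0 h] by (intro arg_cong[where f = "fourier_meas \<nu>"]) (simp add: fun_eq_iff)
  qed
  then show ?thesis by blast
qed

end

end

section \<open>Uniqueness and the estimate\<close>

context stokes
begin

text \<open>The densities \<open>z\<close> of \<open>u'\<close> and \<open>r\<close> of the pressure
  gradient are arbitrary representatives, and \<open>z\<close> is not known to be solenoidal in
  advance. The ordinary differential equation is therefore derived first for the projection of the
  density of \<open>u\<close>; only afterwards does \<open>z\<close> turn out to be fixed by
  \<open>Pr\<close>, and \<open>r\<close> is what remains in the momentum balance.\<close>

lemma solution_formula:
  fixes \<nu> :: "(real^'n) measure"
  assumes \<nu>: "finite_measure \<nu>" "sets \<nu> = sets borel"
    and sol: "lin_sol_with T lam Gam0 Gam2 V M f u0 u u' q"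
    and r0: "fm_rep \<nu> h0 u0" and rf: "joint_rep T \<nu> h f"
    and rz: "joint_rep T \<nu> z u'" and rr: "joint_rep T \<nu> r (\<lambda>t. pgrad (q t))"
    and f: "AE t in Lon T. in_FM0s (f t)"
  shows "\<And>t. t \<in> {0..T} \<Longrightarrow> u t = fourier_meas \<nu> (fsol h0 h t)"
    and "AE t in Lon T. u' t = fourier_meas \<nu> (\<lambda>\<xi>. h t \<xi> - Aop \<xi> (fsol h0 h t \<xi>))"
    and "AE t in Lon T. pgrad (q t) = fourier_meas \<nu> (\<lambda>\<xi>. Rop \<xi> (fsol h0 h t \<xi>))"
proof -
  interpret L: finite_measure "Lon T" by (rule finite_measure_Lon)
  interpret N: finite_measure \<nu> by (rule \<nu>)
  interpret P: pair_sigma_finite "Lon T" \<nu> ..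
  have evo: "\<And>t x. t \<in> {0..T} \<Longrightarrow> u t x = u 0 x + (LINT s:{0..t}|lebesgue. u' s x)"
    and div: "\<And>t. t \<in> {0..T} \<Longrightarrow> in_FM0s (u t)" and u4: "AE t in Lon T. in_FMk 4 (u t)"
    and pge: "AE t in Lon T. pgrad_exists (q t)"
    and eqn: "AE t in Lon T. \<forall>x. u' t x + lam *\<^sub>R fm_vgrad V (u t) x + mat_act M (u t x)
              - Gam0 *\<^sub>R fm_laplace (u t) x + Gam2 *\<^sub>R fm_laplace (fm_laplace (u t)) x + pgrad (q t) x = f t x"
    and init: "u 0 = u0"
    using sol unfolding lin_sol_with_def W11_FM_def L1_sp_def AE_Lon by (elim conjE; blast)+
  have h0: "integrable \<nu> h0" "u0 = fourier_meas \<nu> h0" using r0 by (simp_all add: fm_rep_def)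
  note h = joint_rep_D[OF rf] and z = joint_rep_D[OF rz] and rD = joint_rep_D[OF rr]
  note hm = borel_measurable_integrable[OF h(1)] and zm = borel_measurable_integrable[OF z(1)]
  note sm = borel_measurable_snd_pair[OF \<nu> h0(1) h(1)]
  note fm = borel_measurable_fsol_pair[OF \<nu> h0(1) h(1)]
  have ht: "AE t in Lon T. integrable \<nu> (h t)" using P.AE_integrable_fst'[OF h(1)] by simp
  have zt: "AE t in Lon T. integrable \<nu> (z t)" using P.AE_integrable_fst'[OF z(1)] by simp
  have rt: "AE t in Lon T. integrable \<nu> (r t)" using P.AE_integrable_fst'[OF rD(1)] by simp
  have Ph: "AE t in Lon T. AE \<xi> in \<nu>. Pr \<xi> (h t \<xi>) = h t \<xi>"
    using f h(2) by eventually_elim (simp add: in_FM0s_iff[symmetric])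
  have Ph0: "AE \<xi> in \<nu>. Pr \<xi> (h0 \<xi>) = h0 \<xi>"
    using div[of 0] T_pos in_FM0s_iff[OF r0] by (simp add: init)
  \<comment> \<open>The density of \<open>u t\<close> is obtained by integrating that of
    \<open>u'\<close> instead of being chosen time by time, so it is jointly measurable and obeys
    the integral equation in \<open>t\<close> at each frequency.\<close>
  define w where "w t \<xi> = h0 \<xi> + (\<integral>s. indicator {..<t} s *\<^sub>R z s \<xi> \<partial>Lon T)" for t \<xi>
  have w: "integrable \<nu> (w t)" and uw: "u t = fourier_meas \<nu> (w t)" if t: "t \<in> {0..T}" for t
  proof -
    note ti = fourier_meas_time_integral[OF \<nu> z(1) z(3) t integrable_Lon_eval[OF \<nu> z(1) z(3)]]
    show "integrable \<nu> (w t)" unfolding w_def by (rule Bochner_Integration.integrable_add[OF h0(1) ti(1)])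
    show "u t = fourier_meas \<nu> (w t)"
    proof
      fix x
      show "u t x = fourier_meas \<nu> (w t) x"
        unfolding w_def fourier_meas_add[OF \<nu>(2) h0(1) ti(1)] ti(2)[symmetric] evo[OF t] init h0(2) ..
    qed
  qed
  have wr: "fm_rep \<nu> (w t) (u t)" if "t \<in> {0..T}" for t
    unfolding uw[OF that] by (rule fm_rep_fourier_meas[OF \<nu> w[OF that]])
  have Pw: "AE \<xi> in \<nu>. Pr \<xi> (w t \<xi>) = w t \<xi>" if "t \<in> {0..T}" for t
    using in_FM0s_iff[OF wr[OF that]] div[OF that] by simp
  have Pwt: "AE t in Lon T. AE \<xi> in \<nu>. Pr \<xi> (w t \<xi>) = w t \<xi>" by (rule AE_I2) (rule Pw, simp)
  have wm: "(\<lambda>p. w (fst p) (snd p)) \<in> borel_measurable (Lon T \<Otimes>\<^sub>M \<nu>)"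
  proof -
    let ?N = "(Lon T \<Otimes>\<^sub>M \<nu>) \<Otimes>\<^sub>M Lon T"
    note id = borel_measurable_lebesgue_on_ident[of "{0<..<T}"]
    have t: "(\<lambda>q. fst (fst q)) \<in> borel_measurable ?N"
      by (rule measurable_compose[OF measurable_fst measurable_compose[OF measurable_fst id]])
    have s: "(\<lambda>q. snd q) \<in> borel_measurable ?N" by (rule measurable_compose[OF measurable_snd id])
    have zq: "(\<lambda>q. z (snd q) (snd (fst q))) \<in> borel_measurable ?N"
      using measurable_compose[OF measurable_Pair[OF measurable_snd measurable_compose[OF measurable_fst measurable_snd]] zm, of "Lon T"]
      by simp
    have i: "(\<lambda>q. indicator {..<fst (fst q)} (snd q) :: real) \<in> borel_measurable ?N"
    proof -
      have "(\<lambda>x. if snd x < fst x then 1 else 0 :: real) \<in> borel_measurable (borel \<Otimes>\<^sub>M (borel :: real measure))" by measurable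
      from measurable_compose[OF measurable_Pair[OF t s] this] show ?thesis by (simp add: indicator_def of_bool_def)
    qed
    have "(\<lambda>q. indicator {..<fst (fst q)} (snd q) *\<^sub>R z (snd q) (snd (fst q))) \<in> borel_measurable ?N"
      by (rule borel_measurable_scaleR[OF i zq])
    then have "(\<lambda>p. \<integral>s. indicator {..<fst p} s *\<^sub>R z s (snd p) \<partial>Lon T) \<in> borel_measurable (Lon T \<Otimes>\<^sub>M \<nu>)"
      by (intro L.borel_measurable_lebesgue_integral) (simp add: case_prod_unfold)
    then show ?thesis
      unfolding w_def
      by (rule borel_measurable_add[OF measurable_compose[OF measurable_snd borel_measurable_integrable[OF h0(1)]]])
  qed
  \<comment> \<open>Injectivity of the Fourier transform turns the equation, given for all
    \<open>x\<close>, into an equation of densities.\<close>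
  have mom: "AE t in Lon T. AE \<xi> in \<nu>. z t \<xi> + (cscale (symb \<xi>) (w t \<xi>) + mat_act M (w t \<xi>)) + r t \<xi> = h t \<xi>"
    using eqn u4 zt rt ht z(3) rD(3) h(3) AE_space[of "Lon T"]
  proof eventually_elim
    case (elim t)
    have t: "t \<in> {0..T}" using elim(9) by simp
    let ?s = "\<lambda>\<xi>. cscale (symb \<xi>) (w t \<xi>) + mat_act M (w t \<xi>)"
    note wi = integrable_weight_if_in_FM4[OF \<nu> wr[OF t] elim(2)]
    note st = stokes_operator_fourier_meas[OF \<nu> wi, where M = M and V = V and lam = lam and ?Gam0.0 = Gam0 and ?Gam2.0 = Gam2]
    note i1 = Bochner_Integration.integrable_add[OF elim(3) st(1)]
    have "fourier_meas \<nu> (\<lambda>\<xi>. z t \<xi> + ?s \<xi> + r t \<xi>) = fourier_meas \<nu> (h t)"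
    proof
      fix x
      have "fourier_meas \<nu> (\<lambda>\<xi>. z t \<xi> + ?s \<xi> + r t \<xi>) x = fourier_meas \<nu> (z t) x + fourier_meas \<nu> ?s x + fourier_meas \<nu> (r t) x"
        by (simp only: fourier_meas_add[OF \<nu>(2) elim(3) st(1)] fourier_meas_add[OF \<nu>(2) i1 elim(4)])
      also have "\<dots> = u' t x + (lam *\<^sub>R fm_vgrad V (u t) x + mat_act M (u t x)
              - Gam0 *\<^sub>R fm_laplace (u t) x + Gam2 *\<^sub>R fm_laplace (fm_laplace (u t)) x) + pgrad (q t) x"
        by (simp only: elim(6,7) uw[OF t] st(2))
      also have "a + (c + d - e + g) + k = a + c + d - e + g + k" for a c d e g k :: "complex^'n" by simp
      also have "u' t x + lam *\<^sub>R fm_vgrad V (u t) x + mat_act M (u t x)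
              - Gam0 *\<^sub>R fm_laplace (u t) x + Gam2 *\<^sub>R fm_laplace (fm_laplace (u t)) x + pgrad (q t) x = f t x"
        using elim(1) by blast
      finally show "fourier_meas \<nu> (\<lambda>\<xi>. z t \<xi> + ?s \<xi> + r t \<xi>) x = fourier_meas \<nu> (h t) x" by (simp only: elim(8))
    qed
    then show ?case
      by (rule fourier_meas_injective[OF \<nu> Bochner_Integration.integrable_add[OF i1 elim(4)] elim(5)])
  qed
  have Prr: "AE t in Lon T. AE \<xi> in \<nu>. Pr \<xi> (r t \<xi>) = 0"
    using pge rt rD(3)
  proof eventually_elim
    case (elim t)
    show ?case by (rule pgrad_curl_free[OF \<nu> elim(2,1,3)])
  qed
  \<comment> \<open>Projecting the momentum balance removes \<open>r\<close> and turns
    \<open>M\<close> into \<open>Bop\<close>.\<close>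
  have Pz: "AE t in Lon T. AE \<xi> in \<nu>. Pr \<xi> (z t \<xi>) = h t \<xi> - Aop \<xi> (w t \<xi>)"
    using mom Prr Ph Pwt
  proof eventually_elim
    case (elim t)
    show ?case using elim
    proof eventually_elim
      case (elim \<xi>)
      have "Pr \<xi> (z t \<xi>) + (cscale (symb \<xi>) (Pr \<xi> (w t \<xi>)) + Bop \<xi> (w t \<xi>)) + Pr \<xi> (r t \<xi>) = Pr \<xi> (h t \<xi>)"
        unfolding elim(1)[symmetric] linear_add[OF bounded_linear.linear[OF bounded_linear_Pr]] Pr_cscale Bop_def ..
      then show ?case unfolding elim(2-4) Aop_def by (simp add: algebra_simps)
    qed
  qed
  note Pzs = Pz[unfolded AE_Lon_swap[OF \<nu>(1) borel_measurable_Pr[OF sm zm] borel_measurable_diff[OF hm borel_measurable_Aop[OF sm wm]]]]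
  note Pws = Pwt[unfolded AE_Lon_swap[OF \<nu>(1) borel_measurable_Pr[OF sm wm] wm]]
  \<comment> \<open>At each time \<open>w\<close> is solenoidal off a null set of frequencies; over
    countably many times these null sets can be united.\<close>
  have Pwq: "AE \<xi> in \<nu>. \<forall>q\<in>\<rat> \<inter> {0..T}. Pr \<xi> (w q \<xi>) = w q \<xi>"
    by (subst AE_ball_countable) (auto intro: Pw countable_subset[OF _ countable_rat])
  have main: "AE \<xi> in \<nu>. (\<forall>t\<in>{0..T}. Pr \<xi> (w t \<xi>) = fsol h0 h t \<xi>) \<and> (AE t in Lon T. z t \<xi> = h t \<xi> - Aop \<xi> (fsol h0 h t \<xi>))"
    using Pzs Pws Pwq Ph0 AE_integrable_time[OF \<nu> h0(1) h(1)] AE_integrable_time[OF \<nu> h0(1) z(1)] AE_space[of \<nu>]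
  proof eventually_elim
    case (elim \<xi>)
    note hi = elim(5) and zi = elim(6)
    have lin: "linear (Pr \<xi>)" by (rule bounded_linear.linear[OF bounded_linear_Pr])
    \<comment> \<open>At a fixed frequency \<open>w t \<xi>\<close> is known to be solenoidal only
      for almost all and for rational times; its projection obeys the integral equation at every
      time.\<close>
    define v where "v t = Pr \<xi> (w t \<xi>)" for t
    have wv: "AE s in Lon T. w s \<xi> = v s" using elim(2) by eventually_elim (simp add: v_def)
    have Pzi: "integrable (Lon T) (\<lambda>s. Pr \<xi> (z s \<xi>))" by (rule integrable_bounded_linear[OF bounded_linear_Pr zi])
    have wmt: "(\<lambda>t. w t \<xi>) \<in> borel_measurable (Lon T)"
      using measurable_compose[OF measurable_Pair2'[OF elim(7)] wm] by simp
    have vm: "v \<in> borel_measurable (Lon T)"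
      unfolding v_def[abs_def] by (rule borel_measurable_Pr[OF borel_measurable_const wmt])
    have Pint: "Pr \<xi> (\<integral>s. indicator {..<t} s *\<^sub>R z s \<xi> \<partial>Lon T) = (\<integral>s. indicator {..<t} s *\<^sub>R Pr \<xi> (z s \<xi>) \<partial>Lon T)" for t
      using integral_bounded_linear[OF bounded_linear_Pr integrable_Lon_lessThan[OF zi, of t], of \<xi>]
      by (simp add: linear_scale[OF lin])
    have v0: "v t = h0 \<xi> + (\<integral>s. indicator {..<t} s *\<^sub>R Pr \<xi> (z s \<xi>) \<partial>Lon T)" for t
      unfolding v_def w_def linear_add[OF lin] Pint elim(4) ..
    have vb: "norm (v t) \<le> norm (h0 \<xi>) + (\<integral>s. norm (Pr \<xi> (z s \<xi>)) \<partial>Lon T)" for t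
    proof -
      have "norm (\<integral>s. indicator {..<t} s *\<^sub>R Pr \<xi> (z s \<xi>) \<partial>Lon T) \<le> (\<integral>s. norm (Pr \<xi> (z s \<xi>)) \<partial>Lon T)"
        by (rule Bochner_Integration.integral_norm_bound_integral[OF integrable_Lon_lessThan[OF Pzi] integrable_norm[OF Pzi]])
          (simp add: indicator_def)
      then show ?thesis unfolding v0 by (intro order_trans[OF norm_triangle_ineq]) simp
    qed
    have vi: "integrable (Lon T) v"
      by (rule L.integrable_const_bound[OF _ vm]) (use vb in \<open>intro AE_I2\<close>)
    have Avm: "(\<lambda>s. h s \<xi> - Aop \<xi> (v s)) \<in> borel_measurable (Lon T)"
      by (intro borel_measurable_diff borel_measurable_integrable[OF hi] borel_measurable_Aop borel_measurable_const vm)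
    have v1: "v t = h0 \<xi> + (\<integral>s. indicator {..<t} s *\<^sub>R (h s \<xi> - Aop \<xi> (v s)) \<partial>Lon T)" for t
    proof -
      have "(\<integral>s. indicator {..<t} s *\<^sub>R Pr \<xi> (z s \<xi>) \<partial>Lon T) = (\<integral>s. indicator {..<t} s *\<^sub>R (h s \<xi> - Aop \<xi> (v s)) \<partial>Lon T)"
      proof (rule integral_cong_AE)
        show "AE s in Lon T. indicator {..<t} s *\<^sub>R Pr \<xi> (z s \<xi>) = indicator {..<t} s *\<^sub>R (h s \<xi> - Aop \<xi> (v s))"
          using elim(1) wv by eventually_elim simp
      qed (intro borel_measurable_scaleR borel_measurable_Lon_lessThan borel_measurable_integrable[OF Pzi] Avm)+
      then show ?thesis using v0 by simp
    qed
    have veq: "v t = fsol h0 h t \<xi>" if "t \<in> {0..T}" for t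
      by (rule integral_equation_unique[where A = "Aop \<xi>" and h = "\<lambda>s. h s \<xi>" and v = v and w = "\<lambda>t. fsol h0 h t \<xi>"
            and ?h0.0 = "h0 \<xi>" and T = T and t = t, OF bounded_linear_Aop[of \<xi>] hi vi v1 fsol_integral_equation(1)[where h = h and \<xi> = \<xi>, OF hi]
            fsol_integral_equation(2)[where h = h and \<xi> = \<xi>, OF hi] that])
    \<comment> \<open>At rational times \<open>w\<close> equals its projection, so the time
      integrals of \<open>z\<close> and of its projection up to those times coincide, and hence so
      do the integrands.\<close>
    have "AE s in Lon T. z s \<xi> - Pr \<xi> (z s \<xi>) = 0"
    proof (rule AE_Lon_zero_if_integrals_zero[OF Bochner_Integration.integrable_diff[OF zi Pzi] _ T_pos])
      fix p assume p: "p \<in> \<rat>" "p \<in> {0..T}"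
      then have "v p = w p \<xi>" using elim(3) by (simp add: v_def)
      then have "(\<integral>s. indicator {..<p} s *\<^sub>R z s \<xi> \<partial>Lon T) = (\<integral>s. indicator {..<p} s *\<^sub>R Pr \<xi> (z s \<xi>) \<partial>Lon T)"
        unfolding v0 w_def by simp
      then show "(\<integral>s. indicator {..<p} s *\<^sub>R (z s \<xi> - Pr \<xi> (z s \<xi>)) \<partial>Lon T) = 0"
        by (simp only: scaleR_diff_right Bochner_Integration.integral_diff[OF integrable_Lon_lessThan[OF zi] integrable_Lon_lessThan[OF Pzi]])
          simp
    qed
    then have "AE s in Lon T. z s \<xi> = h s \<xi> - Aop \<xi> (fsol h0 h s \<xi>)"
      using elim(1) wv AE_space[of "Lon T"]
      by eventually_elim (simp add: veq)
    then show ?case using veq by (simp add: v_def)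
  qed
  have wf: "AE \<xi> in \<nu>. w t \<xi> = fsol h0 h t \<xi>" if "t \<in> {0..T}" for t
    using main Pw[OF that] by eventually_elim (use that in auto)
  have fi: "integrable \<nu> (fsol h0 h t)" if "t \<in> {0..T}" for t
    by (rule integrable_fsol_at[OF \<nu> h0(1) h(1) that])
  show "u t = fourier_meas \<nu> (fsol h0 h t)" if "t \<in> {0..T}" for t
    unfolding uw[OF that] by (rule fourier_meas_cong_AE[OF \<nu>(2) w[OF that] fi[OF that] wf[OF that]])
  have "AE \<xi> in \<nu>. AE t in Lon T. z t \<xi> = h t \<xi> - Aop \<xi> (fsol h0 h t \<xi>)"
    using main by eventually_elim blast
  then have zf: "AE t in Lon T. AE \<xi> in \<nu>. z t \<xi> = h t \<xi> - Aop \<xi> (fsol h0 h t \<xi>)"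
    unfolding AE_Lon_swap[OF \<nu>(1) zm borel_measurable_diff[OF hm borel_measurable_Aop[OF sm fm]]] .
  have wpt: "AE t in Lon T. integrable \<nu> (\<lambda>\<xi>. h t \<xi> - Aop \<xi> (fsol h0 h t \<xi>))"
    using P.AE_integrable_fst'[OF integrable_time_derivative[OF \<nu> h0(1) h(1)]] by simp
  show "AE t in Lon T. u' t = fourier_meas \<nu> (\<lambda>\<xi>. h t \<xi> - Aop \<xi> (fsol h0 h t \<xi>))"
    using zf z(3) zt wpt
  proof eventually_elim
    case (elim t)
    show ?case unfolding elim(2) by (rule fourier_meas_cong_AE[OF \<nu>(2) elim(3,4,1)])
  qed
  have Rt: "AE t in Lon T. integrable \<nu> (\<lambda>\<xi>. Rop \<xi> (fsol h0 h t \<xi>))"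
    using P.AE_integrable_fst'[OF integrable_Rop_fsol[OF \<nu> h0(1) h(1)]] by simp
  \<comment> \<open>With the densities of \<open>u\<close> and \<open>u'\<close> identified, the
    momentum balance determines \<open>r\<close>.\<close>
  show "AE t in Lon T. pgrad (q t) = fourier_meas \<nu> (\<lambda>\<xi>. Rop \<xi> (fsol h0 h t \<xi>))"
    using zf mom rD(3) rt Rt AE_space[of "Lon T"]
  proof eventually_elim
    case (elim t)
    have t: "t \<in> {0..T}" using elim(6) by simp
    have "AE \<xi> in \<nu>. r t \<xi> = Rop \<xi> (fsol h0 h t \<xi>)"
      using elim(1,2) wf[OF t]
    proof eventually_elim
      case (elim \<xi>)
      have "r t \<xi> = h t \<xi> - z t \<xi> - (cscale (symb \<xi>) (w t \<xi>) + mat_act M (w t \<xi>))"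
        unfolding elim(2)[symmetric] by simp
      then show ?case unfolding elim(1,3) by (simp add: Rop_def Aop_def)
    qed
    then show ?case unfolding elim(3) by (rule fourier_meas_cong_AE[OF \<nu>(2) elim(4,5)])
  qed
qed

end

text \<open>Lets the initial value enter \<open>joint_rep_exists\<close> as a constant function of
  time, so that it is represented over the same measure as the time dependent data.\<close>

lemma L1_sp_const:
  fixes u0 :: "real^'n \<Rightarrow> complex^'m"
  assumes "in_FM u0"
  shows "L1_sp in_FM fm_norm T (\<lambda>_. u0)"
proof -
  obtain \<nu> g where r: "fm_rep \<nu> g u0" using assms unfolding in_FM_def by blast
  then have \<nu>: "finite_measure \<nu>" "sets \<nu> = sets borel" and g: "integrable \<nu> g" and u0: "u0 = fourier_meas \<nu> g"
    by (simp_all add: fm_rep_def)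
  interpret L: finite_measure "Lon T" by (rule finite_measure_Lon)
  interpret N: finite_measure \<nu> by (rule \<nu>)
  interpret P: pair_sigma_finite "Lon T" \<nu> ..
  have gm: "(\<lambda>p. g (snd p)) \<in> borel_measurable (Lon T \<Otimes>\<^sub>M \<nu>)"
    by (rule measurable_compose[OF measurable_snd borel_measurable_integrable[OF g]])
  have "integrable (Lon T \<Otimes>\<^sub>M \<nu>) (\<lambda>p. g (snd p))"
    by (rule P.Fubini_integrable[OF gm]) (use g in simp_all)
  from L1_sp_fmI(1)[where v = "\<lambda>_. g" and u = "\<lambda>_. u0", OF \<nu> this] u0 show ?thesis by simp
qed

lemma in_FM0s_imp_in_FM: "in_FM0s u \<Longrightarrow> in_FM u"
  unfolding in_FM0s_def in_FM_def by blast

section \<open>Comparison of data and solutions over one measure\<close>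

context stokes
begin

lemma AE_Lon_ex: "(AE t in Lon T. P t) \<Longrightarrow> \<exists>t. P t"
proof (rule ccontr)
  assume ae: "AE t in Lon T. P t" and no: "\<nexists>t. P t"
  have "AE t in Lon T. False" using ae by eventually_elim (use no in blast)
  then have "emeasure (Lon T) (space (Lon T)) = 0" by (simp add: eventually_False ae_filter_eq_bot_iff)
  moreover have "emeasure (Lon T) (space (Lon T)) = ennreal T"
    using T_pos by (simp add: emeasure_restrict_space)
  ultimately show False using T_pos by simp
qed

lemma joint_rep_const:
  assumes "joint_rep T \<nu> g (\<lambda>_. u0)"
  shows "\<exists>h0. fm_rep \<nu> h0 u0"
  using AE_Lon_ex[OF joint_rep_D(2)[OF assms]] by blast

text \<open>There is room for the derivatives and the pressure gradients of two solutions, so that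
  uniqueness can compare them over one measure. With fewer functions at hand, \<open>f\<close> is
  entered repeatedly.\<close>

lemma common_rep:
  fixes u0 :: "real^'n \<Rightarrow> complex^'n" and f a1 a2 b1 b2 :: "real \<Rightarrow> real^'n \<Rightarrow> complex^'n"
  assumes "L1_sp in_FM fm_norm T f" "in_FM u0" "L1_sp in_FM fm_norm T a1" "L1_sp in_FM fm_norm T a2"
    "L1_sp in_FM fm_norm T b1" "L1_sp in_FM fm_norm T b2"
  obtains \<nu> :: "(real^'n) measure" and h0 h z1 z2 r1 r2 where "finite_measure \<nu>" "sets \<nu> = sets borel"
    "fm_rep \<nu> h0 u0" "joint_rep T \<nu> h f" "joint_rep T \<nu> z1 a1" "joint_rep T \<nu> z2 a2"
    "joint_rep T \<nu> r1 b1" "joint_rep T \<nu> r2 b2"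
proof -
  define F where "F i = (if i = 0 then f else if i = 1 then (\<lambda>_. u0) else if i = 2 then a1 else if i = 3 then a2
    else if i = 4 then b1 else b2)" for i :: nat
  have F: "L1_sp in_FM fm_norm T (F i)" for i
    unfolding F_def by (simp add: assms L1_sp_const)
  show ?thesis
  proof (rule joint_rep_exists[OF F])
    fix \<nu> :: "(real^'n) measure" and h :: "nat \<Rightarrow> real \<Rightarrow> real^'n \<Rightarrow> complex^'n"
    assume \<nu>: "finite_measure \<nu>" "sets \<nu> = sets borel" and r: "\<And>i. joint_rep T \<nu> (h i) (F i)"
    have "joint_rep T \<nu> (h 0) f" "joint_rep T \<nu> (h 1) (\<lambda>_. u0)" "joint_rep T \<nu> (h 2) a1" "joint_rep T \<nu> (h 3) a2"
      "joint_rep T \<nu> (h 4) b1" "joint_rep T \<nu> (h 5) b2"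
      using r[of 0] r[of 1] r[of 2] r[of 3] r[of 4] r[of 5] by (simp_all add: F_def)
    moreover from joint_rep_const[OF this(2)] obtain h0 where "fm_rep \<nu> h0 u0" ..
    ultimately show ?thesis using that[OF \<nu>] by blast
  qed
qed

lemma lin_sol_L1_sp:
  assumes "lin_sol_with T lam Gam0 Gam2 V M f u0 u u' q"
  shows "L1_sp in_FM fm_norm T u'" "L1_sp in_FM fm_norm T (\<lambda>t. pgrad (q t))"
  using assms by (simp_all add: lin_sol_with_def W11_FM_def)

lemma lin_sol_exists:
  assumes f: "L1_sp in_FM fm_norm T f" "AE t in Lon T. in_FM0s (f t)" and u0: "in_FM0s u0"
  shows "\<exists>u q. lin_sol T lam Gam0 Gam2 V M f u0 u q"
proof (rule common_rep[OF f(1) in_FM0s_imp_in_FM[OF u0] f(1) f(1) f(1) f(1)])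
  fix \<nu> :: "(real^'n) measure" and h0 h
  assume \<nu>: "finite_measure \<nu>" "sets \<nu> = sets borel" and r0: "fm_rep \<nu> h0 u0" and rf: "joint_rep T \<nu> h f"
  have Ph: "AE t in Lon T. AE \<xi> in \<nu>. Pr \<xi> (h t \<xi>) = h t \<xi>"
    using f(2) joint_rep_D(2)[OF rf] by eventually_elim (simp add: in_FM0s_iff[symmetric])
  have Ph0: "AE \<xi> in \<nu>. Pr \<xi> (h0 \<xi>) = h0 \<xi>" using in_FM0s_iff[OF r0] u0 by simp
  have i0: "integrable \<nu> h0" "u0 = fourier_meas \<nu> h0" using r0 by (simp_all add: fm_rep_def)
  from fsol_solves[OF \<nu> i0(1) joint_rep_D(1)[OF rf] i0(2) joint_rep_D(3)[OF rf] Ph0 Ph]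
  show ?thesis unfolding lin_sol_def by blast
qed

lemma lin_sol_unique:
  assumes f: "L1_sp in_FM fm_norm T f" "AE t in Lon T. in_FM0s (f t)" and u0: "in_FM0s u0"
    and s1: "lin_sol_with T lam Gam0 Gam2 V M f u0 u1 u1' q1" and s2: "lin_sol_with T lam Gam0 Gam2 V M f u0 u2 u2' q2"
  shows "(\<forall>t\<in>{0..T}. u1 t = u2 t) \<and> (AE t in Lon T. pgrad (q1 t) = pgrad (q2 t))"
proof (rule common_rep[OF f(1) in_FM0s_imp_in_FM[OF u0] lin_sol_L1_sp(1)[OF s1] lin_sol_L1_sp(1)[OF s2] lin_sol_L1_sp(2)[OF s1] lin_sol_L1_sp(2)[OF s2]])
  fix \<nu> :: "(real^'n) measure" and h0 h z1 z2 r1 r2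
  assume \<nu>: "finite_measure \<nu>" "sets \<nu> = sets borel" and r0: "fm_rep \<nu> h0 u0" and rf: "joint_rep T \<nu> h f"
    and z: "joint_rep T \<nu> z1 u1'" "joint_rep T \<nu> z2 u2'" and r: "joint_rep T \<nu> r1 (\<lambda>t. pgrad (q1 t))" "joint_rep T \<nu> r2 (\<lambda>t. pgrad (q2 t))"
  note f1 = solution_formula[OF \<nu> s1 r0 rf z(1) r(1) f(2)] and f2 = solution_formula[OF \<nu> s2 r0 rf z(2) r(2) f(2)]
  have "AE t in Lon T. pgrad (q1 t) = pgrad (q2 t)" using f1(3) f2(3) by eventually_elim simp
  then show ?thesis using f1(1) f2(1) by simp
qed

text \<open>Writing \<open>W\<close> for the weighted integral of the solution density, the two
  norms of \<open>u\<close> contribute at most \<open>2 * W\<close>, the pressure gradient at most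
  \<open>2 * bM * W\<close>, and \<open>u'\<close> at most \<open>aconst * W\<close> plus the norm
  of \<open>f\<close>. The factor \<open>wconst\<close> bounds \<open>W\<close> by the data, and the
  final 1 pays for the extra norm of \<open>f\<close>.\<close>

definition est_const :: real where "est_const = (2 + aconst + 2 * bM) * wconst + 1"

lemma wconst_nonneg: "0 \<le> wconst"
  unfolding wconst_def using smooth_const_nonneg by simp

lemma est_const_pos: "est_const > 0"
  unfolding est_const_def using aconst(1) bM_nonneg wconst_nonneg by (intro add_nonneg_pos mult_nonneg_nonneg) auto

lemma lin_sol_estimate:
  assumes f: "L1_sp in_FM fm_norm T f" "AE t in Lon T. in_FM0s (f t)" and u0: "in_FM0s u0"
    and s: "lin_sol_with T lam Gam0 Gam2 V M f u0 u u' q"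
  shows "L1_norm fm_norm T u + L1_norm fm_norm T u' + L1_norm (fmk_norm 4) T u + L1_norm fm_norm T (\<lambda>t. pgrad (q t))
    \<le> est_const * (L1_norm fm_norm T f + fm_norm u0)"
proof (rule common_rep[OF f(1) in_FM0s_imp_in_FM[OF u0] lin_sol_L1_sp(1)[OF s] f(1) lin_sol_L1_sp(2)[OF s] f(1)])
  fix \<nu> :: "(real^'n) measure" and h0 h z r
  assume \<nu>: "finite_measure \<nu>" "sets \<nu> = sets borel" and r0: "fm_rep \<nu> h0 u0" and rf: "joint_rep T \<nu> h f"
    and z: "joint_rep T \<nu> z u'" and r: "joint_rep T \<nu> r (\<lambda>t. pgrad (q t))"
  note sf = solution_formula[OF \<nu> s r0 rf z r f(2)]
  have h0: "integrable \<nu> h0" using r0 by (simp add: fm_rep_def)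
  note h = joint_rep_D[OF rf]
  have uAE: "AE t in Lon T. u t = fourier_meas \<nu> (fsol h0 h t)" by (rule AE_I2) (simp add: sf(1))
  define W where "W = (\<integral>p. fm4_weight (snd p) * norm (fsol h0 h (fst p) (snd p)) \<partial>(Lon T \<Otimes>\<^sub>M \<nu>))"
  define A where "A = (\<integral>p. norm (h (fst p) (snd p)) \<partial>(Lon T \<Otimes>\<^sub>M \<nu>))"
  define B where "B = (\<integral>\<xi>. norm (h0 \<xi>) \<partial>\<nu>)"
  have nf: "L1_norm fm_norm T f = A" unfolding A_def by (rule L1_sp_fmI(2)[where v = h, OF \<nu> h(1) h(3)])
  have n0: "fm_norm u0 = B" unfolding B_def by (rule fm_norm_eq[OF r0])
  have AB: "A \<ge> 0" "B \<ge> 0" by (simp_all add: A_def B_def)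
  have W: "W \<le> wconst * (B + A)" unfolding W_def A_def B_def by (rule weighted_fsol(2)[OF \<nu> h0 h(1)])
  have "L1_norm fm_norm T u \<le> 1 * W"
    unfolding L1_sp_fmI(2)[where v = "fsol h0 h", OF \<nu> integrable_fsol[OF \<nu> h0 h(1)] uAE] W_def by (rule integral_fsol_le[OF \<nu> h0 h(1)])
  moreover have "L1_norm fm_norm T u' \<le> A + aconst * W"
    unfolding L1_sp_fmI(2)[where v = "\<lambda>t \<xi>. h t \<xi> - Aop \<xi> (fsol h0 h t \<xi>)", OF \<nu> integrable_time_derivative[OF \<nu> h0 h(1)] sf(2)] W_def A_def
    by (rule integral_time_derivative_le[OF \<nu> h0 h(1)])
  moreover have "L1_norm (fmk_norm 4) T u = W"
    unfolding W_def by (rule L1_sp_fm4I(2)[where v = "fsol h0 h", OF \<nu> weighted_fsol(1)[OF \<nu> h0 h(1)] uAE])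
  moreover have "L1_norm fm_norm T (\<lambda>t. pgrad (q t)) \<le> 2 * bM * W"
    unfolding L1_sp_fmI(2)[where v = "\<lambda>t \<xi>. Rop \<xi> (fsol h0 h t \<xi>)", OF \<nu> integrable_Rop_fsol[OF \<nu> h0 h(1)] sf(3)] W_def
    by (rule integral_Rop_fsol_le[OF \<nu> h0 h(1)])
  ultimately have "L1_norm fm_norm T u + L1_norm fm_norm T u' + L1_norm (fmk_norm 4) T u + L1_norm fm_norm T (\<lambda>t. pgrad (q t))
      \<le> (2 + aconst + 2 * bM) * W + A" by (simp add: distrib_right)
  also have "\<dots> \<le> (2 + aconst + 2 * bM) * (wconst * (B + A)) + (B + A)"
    using AB aconst(1) bM_nonneg by (intro add_mono mult_left_mono W) auto
  also have "\<dots> = est_const * (L1_norm fm_norm T f + fm_norm u0)"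
    unfolding nf n0 est_const_def by (simp add: algebra_simps)
  finally show ?thesis .
qed

end

theorem theorem3p4:
  fixes lam\<^sub>0 Gam\<^sub>0 Gam\<^sub>2 T :: real and V :: "real^'n::finite" and M :: "real^'n^'n"
  assumes "CARD('n) = 2 \<or> CARD('n) = 3"
    and "Gam\<^sub>2 > 0" and "transpose M = M" and "T > 0"
  shows "\<exists>C>0. \<forall>(f :: real \<Rightarrow> real^'n \<Rightarrow> complex^'n) (u\<^sub>0 :: real^'n \<Rightarrow> complex^'n).
     L1_sp in_FM fm_norm T f \<and> (AE t in lebesgue. t \<in> {0<..<T} \<longrightarrow> in_FM0s (f t)) \<and> in_FM0s u\<^sub>0
     \<longrightarrow> (\<exists>u q. lin_sol T lam\<^sub>0 Gam\<^sub>0 Gam\<^sub>2 V M f u\<^sub>0 u q)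
       \<and> (\<forall>u\<^sub>1 q\<^sub>1 u\<^sub>2 q\<^sub>2. lin_sol T lam\<^sub>0 Gam\<^sub>0 Gam\<^sub>2 V M f u\<^sub>0 u\<^sub>1 q\<^sub>1 \<and> lin_sol T lam\<^sub>0 Gam\<^sub>0 Gam\<^sub>2 V M f u\<^sub>0 u\<^sub>2 q\<^sub>2 \<longrightarrow>
            (\<forall>t\<in>{0..T}. u\<^sub>1 t = u\<^sub>2 t) \<and>
            (AE t in lebesgue. t \<in> {0<..<T} \<longrightarrow> pgrad (q\<^sub>1 t) = pgrad (q\<^sub>2 t)))
       \<and> (\<forall>u u' q. lin_sol_with T lam\<^sub>0 Gam\<^sub>0 Gam\<^sub>2 V M f u\<^sub>0 u u' q \<longrightarrow>
            L1_norm fm_norm T u + L1_norm fm_norm T u' + L1_norm (fmk_norm 4) T u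
              + L1_norm fm_norm T (\<lambda>t. pgrad (q t))
            \<le> C * (L1_norm fm_norm T f + fm_norm u\<^sub>0))"
proof -
  interpret stokes lam\<^sub>0 Gam\<^sub>0 Gam\<^sub>2 T V M by unfold_locales (rule assms)+
  show ?thesis
    unfolding AE_Lon[symmetric]
  proof (intro exI[of _ est_const] conjI est_const_pos allI impI; elim conjE)
    fix f :: "real \<Rightarrow> real^'n \<Rightarrow> complex^'n" and u0 :: "real^'n \<Rightarrow> complex^'n"
    assume f: "L1_sp in_FM fm_norm T f" "AE t in Lon T. in_FM0s (f t)" and u0: "in_FM0s u0"
    show "\<exists>u q. lin_sol T lam\<^sub>0 Gam\<^sub>0 Gam\<^sub>2 V M f u0 u q" by (rule lin_sol_exists[OF f u0])
    show "\<forall>t\<in>{0..T}. u1 t = u2 t"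
      if "lin_sol T lam\<^sub>0 Gam\<^sub>0 Gam\<^sub>2 V M f u0 u1 q1" "lin_sol T lam\<^sub>0 Gam\<^sub>0 Gam\<^sub>2 V M f u0 u2 q2" for u1 q1 u2 q2
      using that lin_sol_unique[OF f u0] unfolding lin_sol_def by blast
    show "AE t in Lon T. pgrad (q1 t) = pgrad (q2 t)"
      if "lin_sol T lam\<^sub>0 Gam\<^sub>0 Gam\<^sub>2 V M f u0 u1 q1" "lin_sol T lam\<^sub>0 Gam\<^sub>0 Gam\<^sub>2 V M f u0 u2 q2" for u1 q1 u2 q2
      using that lin_sol_unique[OF f u0] unfolding lin_sol_def by blast
    show "L1_norm fm_norm T u + L1_norm fm_norm T u' + L1_norm (fmk_norm 4) T u + L1_norm fm_norm T (\<lambda>t. pgrad (q t))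
        \<le> est_const * (L1_norm fm_norm T f + fm_norm u0)"
      if "lin_sol_with T lam\<^sub>0 Gam\<^sub>0 Gam\<^sub>2 V M f u0 u u' q" for u u' q
      by (rule lin_sol_estimate[OF f u0 that])
  qed
qed

end
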